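(* Let $m\geq 3$ be an integer and write $[m/2]$ for the integer part of $m/2$. Let $\phi(x)\in \mathbb{Z}[x]$ be a monic polynomial which is irreducible modulo every prime $\leq m$. Let $a_{[m/2]}\in\mathbb{Z}$ and suppose $a_0(x), \dots, a_{[m/2]-1}(x)\in \mathbb{Z}[x]$ satisfy: (i) $\deg a_i(x) < \deg \phi(x)$ for $0\leq i\leq [m/2]-1$; (ii) the content of the polynomial $a_{[m/2]}a_0(x)$ is not divisible by any prime $\leq m$. Define $$H^{\phi}_m(x)= a_{[m/2]}\phi(x)^m + \sum_{j=1}^{[m/2]}\binom{m}{2j}u_{2j}\,a_{[m/2]-j}(x)\,\phi(x)^{m-2j}.$$ Then $H^{\phi}_m(x)$ is irreducible over $\mathbb{Q}$ if $m$ is even, and $H^{\phi}_m(x)$ equals $\phi(x)$ times a polynomial irreducible over $\mathbb{Q}$ if $m$ is odd with $m\neq 3^u$ for every integer $u\geq 2$.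
   Context: For each non-negative integer $j$, $u_j$ denotes the product of the odd positive integers $\leq j$ (so $u_0=u_2=1$, $u_4=3$, ...). A polynomial in $\mathbb{Z}[x]$ is irreducible modulo a prime $p$ if its reduction modulo $p$ is irreducible in $(\mathbb{Z}/p\mathbb{Z})[x]$. The content of a polynomial in $\mathbb{Z}[x]$ is the greatest common divisor of its coefficients. *)

theory Defs
  imports "Berlekamp_Zassenhaus.Poly_Mod" "HOL-Computational_Algebra.Polynomial_Factorial"
begin

definition u :: "nat \<Rightarrow> int" where
  "u j = (\<Prod>k\<in>{k. k \<le> j \<and> odd k}. int k)"

(* H^phi_m with leading integer c = a_[m/2] and a i = a_i(x) for i < [m/2] *)
definition H_phi :: "nat \<Rightarrow> int poly \<Rightarrow> int \<Rightarrow> (nat \<Rightarrow> int poly) \<Rightarrow> int poly" where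
  "H_phi m \<phi> c a = smult c (\<phi> ^ m) +
     (\<Sum>j=1..m div 2. smult (int (m choose (2*j)) * u (2*j)) (a (m div 2 - j) * \<phi> ^ (m - 2*j)))"

end

theory Submission
  imports Defs "HOL-Analysis.Convex"
begin

text \<open>
  For even \<open>m = 2n\<close> put \<open>F = H\<^sub>m\<close>, for odd \<open>m = 2n + 1\<close> put \<open>F = H\<^sub>m / \<phi>\<close>. Then \<open>F\<close> is the sum of
  \<open>b\<^sub>i a\<^sub>i \<phi>\<^bsup>2i\<^esup>\<close> for \<open>i \<le> n\<close>, where \<open>b\<^sub>i\<close> is a binomial coefficient times the product of the odd numbers
  following the \<open>i\<close>-th one. A prime dividing the last odd number divides every \<open>b\<^sub>i\<close> with \<open>i < n\<close>, so a factor \<open>G\<close> of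
  \<open>F\<close> has degree \<open>r deg \<phi>\<close> for some \<open>r\<close>, and \<open>r \<le> n\<close> without loss of generality. Schur's analogue of
  Sylvester's theorem yields a prime \<open>p\<close> exceeding \<open>r\<close> (or \<open>r + 1\<close> for odd \<open>m\<close>) that divides one of the last
  \<open>\<lceil>r/2\<rceil>\<close> odd numbers. It divides so many low \<open>b\<^sub>i\<close> that \<open>\<phi>\<close> divides \<open>G\<close> modulo \<open>p\<close>, whereas by its size
  all slopes of the \<open>\<phi>\<close>-Newton polygon of \<open>F\<close> are below \<open>1/r\<close>, too small for an edge of the polygon of \<open>G\<close>.

  Schur's theorem is proved in the manner of Erdos: if all prime factors of \<open>k\<close> consecutive odd numbers are at
  most \<open>2k + 1\<close>, their product is at most the odd part of \<open>(k - 1)!\<close> times one prime power for each odd prime up to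
  \<open>2k + 1\<close>, each bounded by the largest of the numbers. Chebyshev-type bounds exclude this, apart from a small range
  that is covered by a chain of primes and a few exponential equations.
\<close>

hide_const (open) comm_monoid_mult_class.coprime

section \<open>Divisibility by a monic polynomial modulo a prime\<close>

text \<open>Nothing is assumed about the middle \<open>a i\<close>, which may vanish modulo any
  prime, so only the numerical factors b_i can bound the slopes. The loss v(b_0) - v(b_i) is at most
  the valuation of a product of i odd numbers that divides (2i)! or, for odd m, (2i + 1)!;
  Legendre's formula makes it less than 2i / r once p exceeds r, respectively r + 1. This extra 1 is
  why odd m needs the sharp form of Schur's theorem, with its exceptions: there a single number 3^u
  arises only from m = 3^u, and 25 * 27 only from m = 27, so the hypothesis on m removes both. For
  even m a bound weaker by one suffices, and it has no exceptions. In Schur's theorem the critical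
  size of the first number x is about k^2 / 4. Above it every prime can be charged a full power of
  size N, the largest number. Below it that is too expensive: primes above sqrt N have exponent at
  most one, and a primorial bound replaces the count. The resulting estimate is used from k = 256
  on, hence the chain of primes for k from 26 to 255.\<close>

lemma monic_division:
  fixes \<phi> :: "int poly"
  assumes m: "monic \<phi>" and d: "degree \<phi> > 0"
  shows "\<exists>Q R. A = \<phi> * Q + R \<and> degree R < degree \<phi>"
proof -
  obtain Q R where qr: "pseudo_divmod A \<phi> = (Q, R)" by force
  have "\<phi> \<noteq> 0" using d by auto
  from pseudo_divmod[OF this qr] m d have "A = \<phi> * Q + R" "degree R < degree \<phi>" by auto
  then show ?thesis by blast
qed

lemma monic_dvd_small:
  fixes \<phi> :: "int poly"
  assumes m: "monic \<phi>" and e: "A = \<phi> * Q" "degree A < degree \<phi>"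
  shows "Q = 0"
proof (rule ccontr)
  assume "Q \<noteq> 0"
  moreover have "\<phi> \<noteq> 0" using m by auto
  ultimately have "degree A = degree \<phi> + degree Q" using e by (simp add: degree_mult_eq)
  then show False using e by simp
qed

lemma monic_division_unique:
  fixes \<phi> :: "int poly"
  assumes m: "monic \<phi>" and "\<phi> * Q + R = \<phi> * Q' + R'" "degree R < degree \<phi>" "degree R' < degree \<phi>"
  shows "Q = Q' \<and> R = R'"
proof -
  have "R' - R = \<phi> * (Q - Q')" using assms by (simp add: algebra_simps)
  moreover have "degree (R' - R) < degree \<phi>" using assms by (intro degree_diff_less) auto
  ultimately have "Q - Q' = 0" by (rule monic_dvd_small[OF m])
  then show ?thesis using assms by simp
qed

lemma monic_division_const_dvd:
  fixes \<phi> :: "int poly"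
  assumes m: "monic \<phi>" and d: "degree \<phi> > 0" and e: "A = \<phi> * Q + R" "degree R < degree \<phi>"
    and c: "[:c:] dvd A"
  shows "[:c:] dvd Q \<and> [:c:] dvd R"
proof -
  from c obtain B where B: "A = [:c:] * B" by (elim dvdE)
  obtain Q' R' where B': "B = \<phi> * Q' + R'" "degree R' < degree \<phi>"
    using monic_division[OF m d] by blast
  have "\<phi> * Q + R = \<phi> * ([:c:] * Q') + [:c:] * R'" using e B B' by (simp add: algebra_simps)
  moreover have "degree ([:c:] * R') < degree \<phi>" using B' by (simp add: le_less_trans[OF degree_smult_le])
  ultimately have "Q = [:c:] * Q' \<and> R = [:c:] * R'"
    using e by (intro monic_division_unique[OF m]) auto
  then show ?thesis by (metis dvd_triv_left)
qed

text \<open>A congruence in Z[x] instead of an identity over a residue field, so that it combines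
  freely with degrees and contents over Z; \<open>dvdm_iff\<close> connects it with the hypothesis
  on \<phi>.\<close>

definition dvd_mod :: "int \<Rightarrow> int poly \<Rightarrow> int poly \<Rightarrow> bool" where
  "dvd_mod p \<phi> A \<longleftrightarrow> (\<exists>Q. [:p:] dvd A - \<phi> * Q)"

lemma Mp_eq_iff: "poly_mod.Mp p A = poly_mod.Mp p B \<longleftrightarrow> [:p:] dvd A - B"
  by (simp add: poly_eq_iff poly_mod.Mp_coeff poly_mod.M_def const_poly_dvd_iff mod_eq_dvd_iff)

lemma dvdm_iff: "poly_mod.dvdm p \<phi> A \<longleftrightarrow> dvd_mod p \<phi> A"
  by (simp add: poly_mod.dvdm_def dvd_mod_def Mp_eq_iff)

lemma prime_const_poly: "prime p \<Longrightarrow> prime_elem [:p::int:]"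
  by (metis prime_elem_const_poly_iff prime_imp_prime_elem)

text \<open>With A = \<phi> Q + p B, division of B by the monic \<phi> and uniqueness of the
  remainder show that A is p times the remainder of B.\<close>

lemma dvd_mod_small:
  assumes m: "monic \<phi>" and s: "degree A < degree \<phi>" and d: "dvd_mod p \<phi> A"
  shows "[:p:] dvd A"
proof -
  from d obtain Q B where "A - \<phi> * Q = [:p:] * B" by (auto simp: dvd_mod_def elim!: dvdE)
  then have A: "A = \<phi> * Q + [:p:] * B" by (simp add: algebra_simps)
  have dg: "degree \<phi> > 0" using s by auto
  obtain Q' R where B: "B = \<phi> * Q' + R" "degree R < degree \<phi>"
    using monic_division[OF m dg] by blast
  have "\<phi> * (Q + [:p:] * Q') + [:p:] * R = \<phi> * 0 + A" using A B by (simp add: algebra_simps)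
  moreover have "degree ([:p:] * R) < degree \<phi>" using B by (simp add: le_less_trans[OF degree_smult_le])
  ultimately have "[:p:] * R = A" using s monic_division_unique[OF m] by blast
  then show ?thesis by (metis dvd_triv_left)
qed

lemma monic_not_dvd_const:
  assumes "prime (p :: int)" "monic \<phi>" shows "\<not> [:p:] dvd \<phi>"
proof
  assume "[:p:] dvd \<phi>"
  then have "p dvd 1" using assms by (metis const_poly_dvd_iff)
  then show False using assms not_prime_unit by blast
qed

lemma monic_const_cancel:
  assumes p: "prime (p :: int)" and m: "monic \<phi>" and d: "[:p:] dvd \<phi> * A"
  shows "[:p:] dvd A"
  using prime_elem_dvd_mult_iff[OF prime_const_poly[OF p]] monic_not_dvd_const[OF p m] d by blast

lemma not_unit_irreducible_m: "poly_mod.irreducible_m p \<phi> \<Longrightarrow> monic \<phi> \<Longrightarrow> degree \<phi> > 0"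
proof (rule ccontr)
  assume i: "poly_mod.irreducible_m p \<phi>" and m: "monic \<phi>" and "\<not> degree \<phi> > 0"
  then have "\<phi> = 1" by (metis monic_degree_0 gr0I)
  then have "poly_mod.dvdm p \<phi> 1" by (auto simp: poly_mod.dvdm_def)
  then show False using i by (auto simp: poly_mod.irreducible_m_def)
qed

text \<open>Over \<open>\<int>\<close> the ideal \<open>(A, \<phi>, p)\<close> contains a monic polynomial \<open>D\<close> of least degree, which generates it
  modulo \<open>p\<close>; irreducibility makes \<open>D\<close> a unit or an associate of \<open>\<phi>\<close>.\<close>

lemma dvd_mod_mult:
  assumes p: "prime p" and m: "monic \<phi>" and irr: "poly_mod.irreducible_m p \<phi>"
    and d: "dvd_mod p \<phi> (A * B)"
  shows "dvd_mod p \<phi> A \<or> dvd_mod p \<phi> B"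
proof (rule ccontr)
  assume "\<not> ?thesis"
  then have nA: "\<not> dvd_mod p \<phi> A" and nB: "\<not> dvd_mod p \<phi> B" by auto
  define I where "I = {X * A + Y * \<phi> + [:p:] * Z | X Y Z. True}"
  have I1: "\<phi> \<in> I" unfolding I_def
    by (rule CollectI, rule exI[of _ 0], rule exI[of _ 1], rule exI[of _ 0]) auto
  have I1': "A \<in> I" unfolding I_def
    by (rule CollectI, rule exI[of _ 1], rule exI[of _ 0], rule exI[of _ 0]) auto
  have I2: "[:p:] * Z \<in> I" for Z unfolding I_def
    by (rule CollectI, rule exI[of _ 0], rule exI[of _ 0], rule exI[of _ Z]) auto
  have I3: "U + V \<in> I" if U: "U \<in> I" and V: "V \<in> I" for U V
  proof -
    obtain X Y Z X' Y' Z' where "U = X * A + Y * \<phi> + [:p:] * Z" "V = X' * A + Y' * \<phi> + [:p:] * Z'"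
      using U V unfolding I_def by auto
    then have "U + V = (X + X') * A + (Y + Y') * \<phi> + [:p:] * (Z + Z')" by (simp add: algebra_simps smult_add_right)
    then show ?thesis unfolding I_def by blast
  qed
  have I4: "W * U \<in> I" if U: "U \<in> I" for U W
  proof -
    obtain X Y Z where "U = X * A + Y * \<phi> + [:p:] * Z" using U unfolding I_def by auto
    then have "W * U = (W * X) * A + (W * Y) * \<phi> + [:p:] * (W * Z)" by (simp add: algebra_simps)
    then show ?thesis unfolding I_def by blast
  qed
  have I5: "U - V \<in> I" if "U \<in> I" "V \<in> I" for U V
    using I3[OF that(1) I4[OF that(2), of "-1"]] by simp
  obtain D where D: "D \<in> I" "monic D" and Dmin: "\<And>E. E \<in> I \<Longrightarrow> monic E \<Longrightarrow> degree D \<le> degree E"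
    using ex_has_least_nat[of "\<lambda>E. E \<in> I \<and> monic E" \<phi> degree] I1 m by blast
  \<comment> \<open>If p does not divide R, remove the top terms divisible by p and scale by an
    inverse of the last coefficient prime to p; \<open>monom t k\<close> corrects that coefficient
    to exactly 1. The result \<open>E\<close> is a monic element of I of degree below that of
    D.\<close>
  have small: "[:p:] dvd R" if R: "R \<in> I" "degree R < degree D" for R
  proof (rule ccontr)
    assume "\<not> [:p:] dvd R"
    then obtain i where i: "\<not> p dvd coeff R i" by (auto simp: const_poly_dvd_iff)
    define S where "S = {i. \<not> p dvd coeff R i}"
    have fS: "finite S" by (rule finite_subset[of _ "{..degree R}"]) (auto simp: S_def intro!: le_degree)
    define k where "k = Max S"
    have kS: "k \<in> S" unfolding k_def using fS i by (intro Max_in) (auto simp: S_def)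
    then have k: "\<not> p dvd coeff R k" by (simp add: S_def)
    have k2: "p dvd coeff R j" if "j > k" for j
      using that Max_ge[OF fS, of j] by (force simp: S_def k_def)
    have "coprime p (coeff R k)" using prime_imp_coprime[OF p k] .
    then obtain l t where lt: "l * coeff R k + t * p = 1"
      by (metis bezout_int coprime_iff_gcd_eq_1 mult.commute add.commute)
    define E where "E = smult l R + [:p:] * (monom t k - smult l (poly_of_list (map (\<lambda>j. if j > k then coeff R j div p else 0) [0..<Suc (degree R)])))"
    have cE: "coeff E j = (if j > k then 0 else if j = k then 1 else l * coeff R j)" for j
    proof -
      have "coeff (poly_of_list (map (\<lambda>j. if j > k then coeff R j div p else 0) [0..<Suc (degree R)])) j
         = (if j > k then coeff R j div p else 0)"
        by (auto simp: nth_default_def coeff_eq_0 not_less simp del: upt_Suc)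
      then show ?thesis using k2[of j] lt unfolding E_def by (auto simp: algebra_simps)
    qed
    have "E \<in> I" unfolding E_def using I4[OF R(1), of "[:l:]"] by (intro I3 I2) auto
    moreover have "degree E = k"
      by (rule antisym[OF degree_le le_degree]) (auto simp: cE)
    moreover have "k \<le> degree R" using k by (intro le_degree) auto
    ultimately show False using Dmin[of E] R(2) cE[of k] by simp
  qed
  have gen: "dvd_mod p D U" if U: "U \<in> I" for U
  proof (cases "degree D = 0")
    case True
    then have "D = 1" using D by (metis monic_degree_0)
    then show ?thesis by (auto simp: dvd_mod_def intro!: exI[of _ U])
  next
    case False
    obtain Q R where QR: "U = D * Q + R" "degree R < degree D"
      using monic_division[OF D(2)] False by blast
    have "R = U - Q * D" using QR by (simp add: algebra_simps)
    then have "R \<in> I" using U D I4 I5 by blast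
    from small[OF this QR(2)] show ?thesis using QR by (auto simp: dvd_mod_def intro!: exI[of _ Q])
  qed
  from gen[OF I1] obtain Q1 where Q1: "[:p:] dvd \<phi> - D * Q1" by (auto simp: dvd_mod_def)
  from gen[OF I1'] obtain Q2 where Q2: "[:p:] dvd A - D * Q2" by (auto simp: dvd_mod_def)
  \<comment> \<open>If D is a unit, then 1 lies in I, and multiplying by B shows that \<phi> divides
    B; if Q1 is a unit, \<phi> divides D and hence A.\<close>
  have "poly_mod.dvdm p D 1 \<or> poly_mod.dvdm p Q1 1"
    using irr Q1 unfolding poly_mod.irreducible_m_def Mp_eq_iff by blast
  then show False
  proof
    assume "poly_mod.dvdm p D 1"
    then obtain h Z where h: "1 - D * h = [:p:] * Z" by (auto simp: dvdm_iff dvd_mod_def elim!: dvdE)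
    have "h * D + [:p:] * Z \<in> I" using D I2 I3 I4 by blast
    moreover have "h * D + [:p:] * Z = 1" using h by (simp add: algebra_simps)
    ultimately obtain X Y Z where one: "1 = X * A + Y * \<phi> + [:p:] * Z" unfolding I_def by auto
    from d obtain Q T where QT: "A * B - \<phi> * Q = [:p:] * T" by (auto simp: dvd_mod_def elim!: dvdE)
    have "B = (X * A + Y * \<phi> + [:p:] * Z) * B" using one by simp
    also have "\<dots> = X * (A * B - \<phi> * Q) + \<phi> * (Y * B + X * Q) + [:p:] * (Z * B)" by (simp add: algebra_simps)
    finally have "B - \<phi> * (Y * B + X * Q) = [:p:] * (X * T + Z * B)" unfolding QT by (simp add: algebra_simps)
    then show False using nB unfolding dvd_mod_def by (metis dvd_triv_left)
  next
    assume "poly_mod.dvdm p Q1 1"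
    then obtain h Z where h: "1 - Q1 * h = [:p:] * Z" by (auto simp: dvdm_iff dvd_mod_def elim!: dvdE)
    from Q1 obtain T where T: "\<phi> - D * Q1 = [:p:] * T" by (elim dvdE)
    from Q2 obtain W where W: "A - D * Q2 = [:p:] * W" by (elim dvdE)
    have "A - \<phi> * (h * Q2) = (A - D * Q2) + D * Q2 * (1 - Q1 * h) - (\<phi> - D * Q1) * (h * Q2)"
      by (simp add: algebra_simps)
    also have "\<dots> = [:p:] * (W + D * Q2 * Z - T * (h * Q2))" unfolding T W h by (simp add: algebra_simps)
    finally show False using nA unfolding dvd_mod_def by (metis dvd_triv_left)
  qed
qed


section \<open>Expansions in powers of \<open>\<phi>\<close>\<close>

text \<open>A polynomial \<open>E\<close> over \<open>\<int>[x]\<close> encodes the \<open>\<phi>\<close>-adic expansion of \<open>poly E \<phi>\<close>.\<close>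

definition reduced_digits :: "int poly \<Rightarrow> int poly poly \<Rightarrow> bool" where
  "reduced_digits \<phi> E \<longleftrightarrow> (\<forall>i. degree (coeff E i) < degree \<phi>)"

lemma reduced_digits_exists:
  assumes m: "monic \<phi>" and d: "degree \<phi> > 0"
  shows "\<exists>E. poly E \<phi> = A \<and> reduced_digits \<phi> E"
proof (induction "degree A" arbitrary: A rule: less_induct)
  case less
  obtain Q R where QR: "A = \<phi> * Q + R" "degree R < degree \<phi>"
    using monic_division[OF m d] by blast
  have "\<exists>E. poly E \<phi> = Q \<and> reduced_digits \<phi> E"
  proof (cases "Q = 0")
    case True
    then show ?thesis using d by (intro exI[of _ 0]) (auto simp: reduced_digits_def)
  next
    case False
    have "\<phi> \<noteq> 0" using d by auto
    then have "degree (\<phi> * Q) = degree \<phi> + degree Q" using False by (simp add: degree_mult_eq)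
    then have "degree A = degree \<phi> + degree Q" using QR by (simp add: degree_add_eq_left)
    then show ?thesis using d by (intro less) auto
  qed
  then obtain E where "poly E \<phi> = Q" "reduced_digits \<phi> E" by blast
  then show ?case using QR
    by (intro exI[of _ "pCons R E"]) (auto simp: reduced_digits_def coeff_pCons split: nat.splits)
qed

lemma reduced_digits_degree:
  assumes m: "monic \<phi>" and r: "reduced_digits \<phi> E" and nz: "E \<noteq> 0"
  shows "poly E \<phi> \<noteq> 0 \<and> degree (poly E \<phi>) = degree E * degree \<phi> + degree (lead_coeff E) \<and>
    lead_coeff (poly E \<phi>) = lead_coeff (lead_coeff E)"
  using r nz
proof (induction E)
  case (pCons R E)
  have R: "degree R < degree \<phi>" using pCons.prems(1) unfolding reduced_digits_def
    by (metis coeff_pCons_0)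
  show ?case
  proof (cases "E = 0")
    case True
    then show ?thesis using pCons by auto
  next
    case False
    have "reduced_digits \<phi> E" using pCons.prems(1) unfolding reduced_digits_def
      by (metis coeff_pCons_Suc)
    note IH = pCons.IH[OF this False]
    have p0: "\<phi> \<noteq> 0" using R by auto
    have dm: "degree (\<phi> * poly E \<phi>) = degree \<phi> + degree (poly E \<phi>)"
      using p0 IH by (simp add: degree_mult_eq)
    then have dd: "degree (R + \<phi> * poly E \<phi>) = degree \<phi> + degree (poly E \<phi>)"
      using R by (subst degree_add_eq_right) auto
    have "lead_coeff (R + \<phi> * poly E \<phi>) = lead_coeff (\<phi> * poly E \<phi>)"
      using R dm by (intro lead_coeff_add_le) auto
    then have l0: "lead_coeff (R + \<phi> * poly E \<phi>) = lead_coeff (poly E \<phi>)"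
      using m by (simp only: lead_coeff_mult mult_1)
    have n: "R + \<phi> * poly E \<phi> \<noteq> 0" using dd R by auto
    have l: "lead_coeff (R + \<phi> * poly E \<phi>) = lead_coeff (lead_coeff E)"
      using IH by (intro trans[OF l0]) blast
    show ?thesis
    proof (intro conjI)
      show "poly (pCons R E) \<phi> \<noteq> 0" using n by simp
      show "degree (poly (pCons R E) \<phi>) = degree (pCons R E) * degree \<phi> + degree (lead_coeff (pCons R E))"
        using IH dd False by simp
      show "lead_coeff (poly (pCons R E) \<phi>) = lead_coeff (lead_coeff (pCons R E))"
        using l False by (simp only: poly_pCons coeff_pCons_Suc degree_pCons_eq_if if_False)
    qed
  qed
qed auto

lemma reduced_digits_unique:
  assumes m: "monic \<phi>" and r: "reduced_digits \<phi> E" "reduced_digits \<phi> E'" and e: "poly E \<phi> = poly E' \<phi>"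
  shows "E = E'"
proof (rule ccontr)
  assume "E \<noteq> E'"
  then have "E - E' \<noteq> 0" by simp
  moreover have "reduced_digits \<phi> (E - E')" using r unfolding reduced_digits_def
    by (auto intro!: degree_diff_less)
  ultimately have "poly (E - E') \<phi> \<noteq> 0" using reduced_digits_degree[OF m] by blast
  then show False using e by simp
qed

text \<open>The \<open>Q i j\<close> are the carries of the digit-by-digit multiplication.\<close>

lemma reduced_digits_mult:
  fixes \<phi> :: "int poly"
  assumes m: "monic \<phi>" and d: "degree \<phi> > 0"
    and rG: "reduced_digits \<phi> EG" and rK: "reduced_digits \<phi> EK" and rF: "reduced_digits \<phi> EF"
    and F: "poly EF \<phi> = poly EG \<phi> * poly EK \<phi>"
  obtains Q R where
    "\<And>i j. coeff EG i * coeff EK j = \<phi> * Q i j + R i j" "\<And>i j. degree (R i j) < degree \<phi>"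
    "\<And>n. coeff EF n = (\<Sum>i\<le>degree EG. \<Sum>j\<le>degree EK.
       (if i + j = n then R i j else 0) + (if i + j + 1 = n then Q i j else 0))"
proof -
  have "\<forall>i j. \<exists>q r. coeff EG i * coeff EK j = \<phi> * q + r \<and> degree r < degree \<phi>"
    using monic_division[OF m d] by blast
  then obtain Q R where QR: "\<And>i j. coeff EG i * coeff EK j = \<phi> * Q i j + R i j"
    "\<And>i j. degree (R i j) < degree \<phi>" by metis
  \<comment> \<open>A product of two digits has degree below 2 deg \<phi>, so its quotient is again
    a digit and a carry never moves further than one place.\<close>
  have dQ: "degree (Q i j) < degree \<phi>" for i j
  proof (cases "Q i j = 0")
    case False
    have "\<phi> \<noteq> 0" using d by auto
    then have "degree (\<phi> * Q i j) = degree \<phi> + degree (Q i j)" using False by (simp add: degree_mult_eq)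
    then have "degree (\<phi> * Q i j + R i j) = degree \<phi> + degree (Q i j)"
      using QR(2)[of i j] by (subst degree_add_eq_left) auto
    then have "degree \<phi> + degree (Q i j) \<le> degree (coeff EG i) + degree (coeff EK j)"
      using degree_mult_le[of "coeff EG i" "coeff EK j"] QR(1)[of i j] by simp
    then show ?thesis using rG rK unfolding reduced_digits_def
      by (meson add_less_cancel_left add_strict_mono le_less_trans)
  qed (use d in auto)
  define D where "D = (\<Sum>i\<le>degree EG. \<Sum>j\<le>degree EK. monom (R i j) (i + j) + monom (Q i j) (i + j + 1))"
  have cD: "coeff D n = (\<Sum>i\<le>degree EG. \<Sum>j\<le>degree EK.
       (if i + j = n then R i j else 0) + (if i + j + 1 = n then Q i j else 0))" for n
    unfolding D_def by (simp add: coeff_sum)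
  have "poly D \<phi> = (\<Sum>i\<le>degree EG. \<Sum>j\<le>degree EK. coeff EG i * coeff EK j * \<phi> ^ (i + j))"
    unfolding D_def by (simp add: poly_sum poly_monom QR(1) algebra_simps)
  also have "\<dots> = poly EG \<phi> * poly EK \<phi>"
    unfolding poly_altdef sum_product by (simp add: power_add mult_ac)
  finally have "poly D \<phi> = poly EF \<phi>" using F by simp
  moreover have "reduced_digits \<phi> D" unfolding reduced_digits_def cD
    using d dQ QR(2) by (auto intro!: degree_sum_less degree_add_less)
  ultimately have "D = EF" using rF by (intro reduced_digits_unique[OF m])
  then show ?thesis using that[of Q R] QR cD by blast
qed

lemma prime_const_power_dvd_iff:
  assumes "prime (p :: int)" "A \<noteq> 0"
  shows "[:p:] ^ k dvd A \<longleftrightarrow> k \<le> multiplicity [:p:] A"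
  using assms prime_const_poly[OF assms(1)] prime_elem_not_unit
  by (intro power_dvd_iff_le_multiplicity) auto

lemma argmin_last:
  fixes w :: "nat \<Rightarrow> nat"
  assumes "finite S" "S \<noteq> {}"
  shows "\<exists>e\<in>S. (\<forall>i\<in>S. w e \<le> w i) \<and> (\<forall>i\<in>S. e < i \<longrightarrow> w e < w i)"
proof -
  define T where "T = {i \<in> S. w i = Min (w ` S)}"
  have "Min (w ` S) \<in> w ` S" using assms by (intro Min_in) auto
  then obtain i where "i \<in> S" "Min (w ` S) = w i" by auto
  then have "i \<in> T" by (simp add: T_def)
  then have T: "finite T" "T \<noteq> {}" using assms by (auto simp: T_def)
  have M: "Max T \<in> T" using T(1) T(2) by (rule Max_in)
  have le: "Min (w ` S) \<le> w i" if "i \<in> S" for i using assms that by simp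
  show ?thesis
  proof (intro bexI conjI ballI impI)
    show "Max T \<in> S" using M by (simp add: T_def)
    fix i assume i: "i \<in> S"
    show "w (Max T) \<le> w i" using M le[OF i] by (simp add: T_def)
    assume "Max T < i"
    then have "i \<notin> T" using T Max_ge[of T i] by auto
    then show "w (Max T) < w i" using M le[OF i] i by (simp add: T_def)
  qed
qed

text \<open>Gauss's lemma for digits: divide out the powers of p contained in A and B; \<phi> is
  prime modulo p and has larger degree than the reduced digits, so it divides neither of them nor
  their product modulo p.\<close>

lemma multiplicity_remainder:
  assumes p: "prime p" and m: "monic \<phi>" and irr: "poly_mod.irreducible_m p \<phi>"
    and A: "A \<noteq> 0" "degree A < degree \<phi>" and B: "B \<noteq> 0" "degree B < degree \<phi>"
    and e: "A * B = \<phi> * Q + R" "degree R < degree \<phi>"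
  shows "\<not> [:p:] ^ (multiplicity [:p:] A + multiplicity [:p:] B + 1) dvd R"
proof
  let ?a = "multiplicity [:p:] A" and ?b = "multiplicity [:p:] B"
  have pe: "prime_elem [:p:]" by (rule prime_const_poly[OF p])
  obtain A' where A': "A = [:p:] ^ ?a * A'" "\<not> [:p:] dvd A'"
    using multiplicity_decompose'[of A "[:p:]"] A pe by (metis prime_elem_not_unit)
  obtain B' where B': "B = [:p:] ^ ?b * B'" "\<not> [:p:] dvd B'"
    using multiplicity_decompose'[of B "[:p:]"] B pe by (metis prime_elem_not_unit)
  have d: "degree \<phi> > 0" using A by simp
  have cp: "[:p:] ^ k = [:p ^ k:]" for k by (rule poly_const_pow)
  have p0: "p ^ k \<noteq> 0" for k using p by auto
  have dA: "degree A' < degree \<phi>" using A A' p0 by (metis cp degree_smult_eq mult_pCons_left mult_zero_left add_0_right pCons_0_0 smult_monom_mult mult_smult_left mult_1 one_pCons smult_one)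
  have dB: "degree B' < degree \<phi>" using B B' p0 by (metis cp degree_smult_eq mult_smult_left mult_1 smult_one)
  obtain Q' R' where QR': "A' * B' = \<phi> * Q' + R'" "degree R' < degree \<phi>"
    using monic_division[OF m d] by blast
  let ?c = "[:p:] ^ (?a + ?b)"
  have "A * B = ?c * (A' * B')" by (subst A'(1), subst B'(1)) (simp add: power_add mult_ac)
  then have "\<phi> * Q + R = \<phi> * (?c * Q') + ?c * R'" using e QR' by (simp add: algebra_simps)
  moreover have "degree (?c * R') < degree \<phi>" using QR' p0 by (simp add: cp)
  ultimately have R: "R = ?c * R'" using e monic_division_unique[OF m] by blast
  assume "[:p:] ^ (?a + ?b + 1) dvd R"
  then have "?c * [:p:] dvd ?c * R'" unfolding R by (simp only: power_add power_one_right)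
  moreover have "?c \<noteq> 0" using p by auto
  ultimately have "[:p:] dvd R'" by (simp only: dvd_mult_cancel_left) auto
  then have "dvd_mod p \<phi> (A' * B')" using QR' by (auto simp: dvd_mod_def intro!: exI[of _ Q'])
  then have "dvd_mod p \<phi> A' \<or> dvd_mod p \<phi> B'" by (rule dvd_mod_mult[OF p m irr])
  then show False using dvd_mod_small[OF m] dA dB A' B' by blast
qed

text \<open>Weight the \<open>i\<close>-th \<open>\<phi>\<close>-digit by \<open>r v(E\<^sub>i) + i\<close>, where \<open>v\<close> is the \<open>p\<close>-adic valuation of the content.
  The last digits of minimal weight of two factors multiply to a digit of minimal weight of the product
  (a form of Dumas' theorem), so a product with \<open>0\<close> as its only such index has factors of the same kind.\<close>

lemma minimal_weight_factor:
  fixes p :: int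
  assumes p: "prime p" and m: "monic \<phi>" and irr: "poly_mod.irreducible_m p \<phi>" and r: "r > 0"
    and rG: "reduced_digits \<phi> EG" and rK: "reduced_digits \<phi> EK" and rF: "reduced_digits \<phi> EF"
    and F: "poly EF \<phi> = poly EG \<phi> * poly EK \<phi>"
    and F0: "coeff EF 0 \<noteq> 0"
    and min: "\<And>j. j > 0 \<Longrightarrow> coeff EF j \<noteq> 0 \<Longrightarrow>
      r * multiplicity [:p:] (coeff EF 0) < r * multiplicity [:p:] (coeff EF j) + j"
    and i: "i > 0" "coeff EG i \<noteq> 0"
  shows "coeff EG 0 \<noteq> 0 \<and> r * multiplicity [:p:] (coeff EG 0) < r * multiplicity [:p:] (coeff EG i) + i"
proof -
  have d: "degree \<phi> > 0" using not_unit_irreducible_m[OF irr m] .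
  define v where "v = multiplicity [:p:]"
  have dv: "[:p:] ^ k dvd A \<longleftrightarrow> k \<le> v A" if "A \<noteq> 0" for A k
    unfolding v_def using prime_const_power_dvd_iff[OF p that] .
  have EF0: "EF \<noteq> 0" using F0 by auto
  then have "poly EF \<phi> \<noteq> 0" using reduced_digits_degree[OF m rF] by blast
  then have "EG \<noteq> 0" "EK \<noteq> 0" using F by auto
  let ?w = "\<lambda>E i. r * v (coeff E i) + i"
  have ex: "\<exists>e. coeff E e \<noteq> 0 \<and> (\<forall>i. coeff E i \<noteq> 0 \<longrightarrow> ?w E e \<le> ?w E i) \<and>
      (\<forall>i>e. coeff E i \<noteq> 0 \<longrightarrow> ?w E e < ?w E i)" if "E \<noteq> 0" for E
  proof -
    have "finite {i. coeff E i \<noteq> 0}" by (rule finite_subset[of _ "{..degree E}"]) (auto intro: le_degree)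
    moreover have "{i. coeff E i \<noteq> 0} \<noteq> {}" using that leading_coeff_neq_0 by blast
    ultimately show ?thesis using argmin_last[of "{i. coeff E i \<noteq> 0}" "?w E"] by auto
  qed
  obtain e where e: "coeff EG e \<noteq> 0" "\<And>i. coeff EG i \<noteq> 0 \<Longrightarrow> ?w EG e \<le> ?w EG i"
      "\<And>i. i > e \<Longrightarrow> coeff EG i \<noteq> 0 \<Longrightarrow> ?w EG e < ?w EG i"
    using ex[OF \<open>EG \<noteq> 0\<close>] by blast
  obtain f where f: "coeff EK f \<noteq> 0" "\<And>i. coeff EK i \<noteq> 0 \<Longrightarrow> ?w EK f \<le> ?w EK i"
      "\<And>i. i > f \<Longrightarrow> coeff EK i \<noteq> 0 \<Longrightarrow> ?w EK f < ?w EK i"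
    using ex[OF \<open>EK \<noteq> 0\<close>] by blast
  obtain Q R where QR: "\<And>i j. coeff EG i * coeff EK j = \<phi> * Q i j + R i j" "\<And>i j. degree (R i j) < degree \<phi>"
    and cF: "\<And>n. coeff EF n = (\<Sum>i\<le>degree EG. \<Sum>j\<le>degree EK.
       (if i + j = n then R i j else 0) + (if i + j + 1 = n then Q i j else 0))"
    using reduced_digits_mult[OF m d rG rK rF F] by blast
  have QRdvd: "[:p:] ^ k dvd Q i j \<and> [:p:] ^ k dvd R i j"
    if k: "coeff EG i \<noteq> 0 \<Longrightarrow> coeff EK j \<noteq> 0 \<Longrightarrow> k \<le> v (coeff EG i) + v (coeff EK j)" for i j k
  proof -
    have "[:p:] ^ k dvd coeff EG i * coeff EK j"
    proof (cases "coeff EG i = 0 \<or> coeff EK j = 0")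
      case False
      have "[:p:] ^ k dvd [:p:] ^ (v (coeff EG i) + v (coeff EK j))" using k False by (intro le_imp_power_dvd) auto
      also have "\<dots> dvd coeff EG i * coeff EK j"
        unfolding power_add v_def by (intro mult_dvd_mono multiplicity_dvd)
      finally show ?thesis .
    qed auto
    then show ?thesis using monic_division_const_dvd[OF m d QR(1) QR(2), of "p ^ k" i j] by (simp only: poly_const_pow)
  qed
  have "e = 0 \<and> f = 0"
  proof (rule ccontr)
    assume "\<not> (e = 0 \<and> f = 0)"
    then have n0: "e + f > 0" by auto
    define n where "n = e + f"
    define V where "V = v (coeff EG e) + v (coeff EK f)"
    have terms: "[:p:] ^ (V + 1) dvd (if i + j = n then R i j else 0) + (if i + j + 1 = n then Q i j else 0)"
      if ne: "(i, j) \<noteq> (e, f)" for i j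
    proof -
      have "[:p:] ^ (V + 1) dvd R i j" if ij: "i + j = n"
      proof -
        have "V + 1 \<le> v (coeff EG i) + v (coeff EK j)" if nz: "coeff EG i \<noteq> 0" "coeff EK j \<noteq> 0"
        proof -
          have "i > e \<or> j > f" using ne ij unfolding n_def by auto
          then have "?w EG e + ?w EK f < ?w EG i + ?w EK j"
            using e(2)[OF nz(1)] f(2)[OF nz(2)] e(3)[OF _ nz(1)] f(3)[OF _ nz(2)] by fastforce
          then have "r * V < r * (v (coeff EG i) + v (coeff EK j))"
            using ij unfolding V_def n_def by (simp add: algebra_simps)
          then show ?thesis using r by simp
        qed
        then show ?thesis using QRdvd by blast
      qed
      \<comment> \<open>A carry into place n comes from i + j = n - 1. With one less in the index,
        minimality of the weights alone, without the choice of the last index, forces a higher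
        valuation.\<close>
      moreover have "[:p:] ^ (V + 1) dvd Q i j" if ij: "i + j + 1 = n"
      proof -
        have "V + 1 \<le> v (coeff EG i) + v (coeff EK j)" if nz: "coeff EG i \<noteq> 0" "coeff EK j \<noteq> 0"
        proof -
          have "?w EG e + ?w EK f \<le> ?w EG i + ?w EK j"
            using e(2)[OF nz(1)] f(2)[OF nz(2)] by linarith
          then have "r * V < r * (v (coeff EG i) + v (coeff EK j))"
            using ij unfolding V_def n_def by (simp add: algebra_simps)
          then show ?thesis using r by simp
        qed
        then show ?thesis using QRdvd by blast
      qed
      ultimately show ?thesis by (auto intro!: dvd_add)
    qed
    have eG: "e \<le> degree EG" and fK: "f \<le> degree EK" using e f by (auto intro: le_degree)
    have nd: "\<not> [:p:] ^ (V + 1) dvd coeff EF n"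
    proof
      assume a: "[:p:] ^ (V + 1) dvd coeff EF n"
      let ?t = "\<lambda>(i, j). (if i + j = n then R i j else 0) + (if i + j + 1 = n then Q i j else 0)"
      let ?S = "{..degree EG} \<times> {..degree EK}"
      have "coeff EF n = sum ?t ?S" unfolding cF by (simp add: sum.cartesian_product)
      also have "\<dots> = ?t (e, f) + sum ?t (?S - {(e, f)})"
        using eG fK by (intro sum.remove) auto
      finally have "R e f = coeff EF n - sum ?t (?S - {(e, f)})" by (simp add: n_def)
      moreover have "[:p:] ^ (V + 1) dvd sum ?t (?S - {(e, f)})"
        using terms by (intro dvd_sum) auto
      ultimately have "[:p:] ^ (V + 1) dvd R e f" using a by (auto intro: dvd_diff)
      then show False
        using multiplicity_remainder[OF p m irr e(1) _ f(1) _ QR(1) QR(2)] rG rK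
        unfolding V_def v_def reduced_digits_def by blast
    qed
    then have nz: "coeff EF n \<noteq> 0" by auto
    have "v (coeff EF n) \<le> V" using nd dv[OF nz, of "V + 1"] by linarith
    then have 1: "r * v (coeff EF 0) < r * V + n"
      using min[OF _ nz] n0 mult_le_mono2[of "v (coeff EF n)" V r] unfolding n_def v_def by linarith
    have c0: "coeff EF 0 = R 0 0"
    proof -
      have "coeff EF 0 = (\<Sum>i\<le>degree EG. \<Sum>j\<le>degree EK. if i = 0 \<and> j = 0 then R i j else 0)"
        unfolding cF by (intro sum.cong) auto
      also have "\<dots> = (\<Sum>i\<le>degree EG. if i = 0 then R i 0 else 0)"
        by (intro sum.cong) (auto simp: sum.delta)
      also have "\<dots> = R 0 0" by (simp add: sum.delta)
      finally show ?thesis .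
    qed
    have nz0: "coeff EG 0 \<noteq> 0 \<and> coeff EK 0 \<noteq> 0"
    proof (rule ccontr)
      assume "\<not> ?thesis"
      then have "\<phi> * Q 0 0 + R 0 0 = \<phi> * 0 + 0" using QR(1)[of 0 0] by auto
      from monic_division_unique[OF m this QR(2)] d have "R 0 0 = 0" by simp
      then show False using c0 F0 by simp
    qed
    have "[:p:] ^ (v (coeff EG 0) + v (coeff EK 0)) dvd coeff EF 0"
      unfolding c0 using QRdvd[of 0 0] by blast
    then have "v (coeff EG 0) + v (coeff EK 0) \<le> v (coeff EF 0)" using dv[OF F0] by blast
    then have "r * (v (coeff EG 0) + v (coeff EK 0)) \<le> r * v (coeff EF 0)" by simp
    moreover have "r * V + n \<le> r * (v (coeff EG 0) + v (coeff EK 0))"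
      using e(2)[of 0] f(2)[of 0] nz0 unfolding V_def n_def by (simp add: algebra_simps)
    ultimately show False using 1 by linarith
  qed
  then show ?thesis using e(1) e(3)[OF _ i(2)] i(1) unfolding v_def by auto
qed

section \<open>Powers of \<phi> dividing a polynomial modulo p\<close>

lemma dvd_mod_dvd: "dvd_mod p B C \<Longrightarrow> A dvd B \<Longrightarrow> dvd_mod p A C"
proof -
  assume "dvd_mod p B C" "A dvd B"
  then obtain Q D where "[:p:] dvd C - B * Q" "B = A * D" by (auto simp: dvd_mod_def elim: dvdE)
  then have "[:p:] dvd C - A * (D * Q)" by (simp add: mult.assoc)
  then show ?thesis unfolding dvd_mod_def by blast
qed

lemma dvd_modE:
  assumes "dvd_mod p A B" obtains X Y where "B = A * X + [:p:] * Y"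
proof -
  from assms obtain X Y where "B - A * X = [:p:] * Y" by (auto simp: dvd_mod_def elim!: dvdE)
  then have "B = A * X + [:p:] * Y" by (simp add: algebra_simps)
  then show ?thesis by (rule that)
qed

lemma dvd_modI: "B = A * X + [:p:] * Y \<Longrightarrow> dvd_mod p A B"
  unfolding dvd_mod_def by (metis add_diff_cancel_left' dvd_triv_left)

text \<open>Induction on s: after \<phi>^s is cancelled, G times the remaining cofactor is divisible
  by \<phi> modulo p, and \<phi> is prime modulo p.\<close>

lemma dvd_mod_power_factor:
  assumes p: "prime p" and m: "monic \<phi>" and irr: "poly_mod.irreducible_m p \<phi>"
    and n: "\<not> dvd_mod p \<phi> G" and d: "dvd_mod p (\<phi> ^ s) (G * K)"
  shows "dvd_mod p (\<phi> ^ s) K"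
  using d
proof (induction s)
  case 0
  show ?case by (rule dvd_modI[of _ _ K _ 0]) simp
next
  case (Suc s)
  have "dvd_mod p (\<phi> ^ s) (G * K)"
    by (rule dvd_mod_dvd[OF Suc.prems]) simp
  then have "dvd_mod p (\<phi> ^ s) K" by (rule Suc.IH)
  then obtain K1 K2 where K: "K = \<phi> ^ s * K1 + [:p:] * K2" by (elim dvd_modE)
  from Suc.prems obtain U V where UV: "G * K = \<phi> ^ Suc s * U + [:p:] * V" by (elim dvd_modE)
  have "\<phi> ^ s * (G * K1 - \<phi> * U) = (G * K - [:p:] * (G * K2)) - \<phi> ^ Suc s * U"
    unfolding K by (simp add: algebra_simps)
  also have "\<dots> = [:p:] * (V - G * K2)" unfolding UV by (simp add: algebra_simps smult_diff_right)
  finally have "[:p:] dvd \<phi> ^ s * (G * K1 - \<phi> * U)" by (metis dvd_triv_left)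
  then have "[:p:] dvd G * K1 - \<phi> * U" by (rule monic_const_cancel[OF p monic_power[OF m]])
  then have "dvd_mod p \<phi> (G * K1)" by (auto simp: dvd_mod_def)
  then have "dvd_mod p \<phi> K1" using dvd_mod_mult[OF p m irr] n by blast
  then obtain X Y where "K1 = \<phi> * X + [:p:] * Y" by (elim dvd_modE)
  then have "K = \<phi> ^ Suc s * X + [:p:] * (\<phi> ^ s * Y + K2)" unfolding K by (simp add: algebra_simps smult_add_right)
  then show ?case by (rule dvd_modI)
qed

lemma dvd_mod_power_degree:
  assumes m: "monic \<phi>" and l: "\<not> p dvd lead_coeff A" and d: "dvd_mod p (\<phi> ^ s) A"
  shows "s * degree \<phi> \<le> degree A"
proof (rule ccontr)
  assume "\<not> ?thesis"
  moreover have "degree (\<phi> ^ s) = s * degree \<phi>" using m by (simp add: degree_power_eq mult.commute flip: leading_coeff_0_iff)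
  ultimately have "[:p:] dvd A" using d by (intro dvd_mod_small[OF monic_power[OF m], of A s]) auto
  then show False using l by (auto simp: const_poly_dvd_iff)
qed

lemma dvd_mod_power_max:
  assumes m: "monic \<phi>" and dg: "degree \<phi> > 0" and l: "\<not> p dvd lead_coeff A"
  obtains s X Y where "A = \<phi> ^ s * X + [:p:] * Y" "\<not> dvd_mod p \<phi> X" "s * degree \<phi> \<le> degree A"
proof -
  have b: "s \<le> degree A" if "dvd_mod p (\<phi> ^ s) A" for s
  proof -
    have "s * 1 \<le> s * degree \<phi>" using dg by (intro mult_le_mono) auto
    then show ?thesis using dvd_mod_power_degree[OF m l that] by linarith
  qed
  have 0: "dvd_mod p (\<phi> ^ 0) A" by (rule dvd_modI[of _ _ A _ 0]) simp
  obtain s where s: "dvd_mod p (\<phi> ^ s) A" "\<And>t. dvd_mod p (\<phi> ^ t) A \<Longrightarrow> t \<le> s"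
    using Nat.ex_has_greatest_nat[of "\<lambda>s. dvd_mod p (\<phi> ^ s) A" 0 "degree A"] 0 b by blast
  obtain X Y where XY: "A = \<phi> ^ s * X + [:p:] * Y" using s(1) by (elim dvd_modE)
  have "\<not> dvd_mod p \<phi> X"
  proof
    assume "dvd_mod p \<phi> X"
    then obtain X' Y' where "X = \<phi> * X' + [:p:] * Y'" by (elim dvd_modE)
    then have "A = \<phi> ^ Suc s * X' + [:p:] * (\<phi> ^ s * Y' + Y)" unfolding XY
      by (simp add: algebra_simps smult_add_right)
    then have "dvd_mod p (\<phi> ^ Suc s) A" by (rule dvd_modI)
    then show False using s(2)[of "Suc s"] by simp
  qed
  then show ?thesis using that XY dvd_mod_power_degree[OF m l s(1)] by blast
qed

text \<open>Modulo p the product is a nonzero constant times \<phi>^N, and \<phi> is prime there, so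
  the exact powers of \<phi> in G and K have exponents adding up to N. Leading coefficients prime to
  p keep the degrees, which leaves no room for other factors.\<close>

lemma factor_degree_dvd:
  assumes p: "prime p" and m: "monic \<phi>" and irr: "poly_mod.irreducible_m p \<phi>"
    and F: "G * K = [:c:] * \<phi> ^ N + [:p:] * Z" and c: "\<not> p dvd c"
    and l: "\<not> p dvd lead_coeff (G * K)" and dF: "degree (G * K) = N * degree \<phi>"
  shows "degree \<phi> dvd degree G"
proof -
  have dg: "degree \<phi> > 0" using not_unit_irreducible_m[OF irr m] .
  have lG: "\<not> p dvd lead_coeff G" and lK: "\<not> p dvd lead_coeff K" using l by (auto simp: lead_coeff_mult)
  then have "G \<noteq> 0" "K \<noteq> 0" by auto
  then have deg: "degree G + degree K = N * degree \<phi>" using dF by (simp add: degree_mult_eq)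
  obtain s G1 G2 where G: "G = \<phi> ^ s * G1 + [:p:] * G2" "\<not> dvd_mod p \<phi> G1" "s * degree \<phi> \<le> degree G"
    using dvd_mod_power_max[OF m dg lG] by blast
  obtain t K1 K2 where K: "K = \<phi> ^ t * K1 + [:p:] * K2" "\<not> dvd_mod p \<phi> K1" "t * degree \<phi> \<le> degree K"
    using dvd_mod_power_max[OF m dg lK] by blast
  have st: "s + t \<le> N"
  proof -
    have "(s + t) * degree \<phi> \<le> N * degree \<phi>" using G(3) K(3) deg by (simp add: add_mult_distrib)
    then show ?thesis using dg by simp
  qed
  define W where "W = \<phi> ^ s * G1 * K2 + \<phi> ^ t * K1 * G2 + [:p:] * (G2 * K2)"
  have GK: "G * K = \<phi> ^ (s + t) * (G1 * K1) + [:p:] * W"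
    unfolding W_def by (subst G(1), subst K(1)) (simp add: algebra_simps power_add smult_add_right)
  have "s + t = N"
  proof (rule ccontr)
    assume "s + t \<noteq> N"
    then obtain k where k: "N = s + t + Suc k" using st less_imp_Suc_add[of "s + t" N] by auto
    have "\<phi> ^ (s + t) * (G1 * K1 - [:c:] * \<phi> ^ Suc k) = (G * K - [:p:] * W) - [:c:] * \<phi> ^ N"
      unfolding GK k by (simp add: algebra_simps power_add)
    also have "\<dots> = [:p:] * (Z - W)" unfolding F by (simp add: algebra_simps smult_diff_right)
    finally have "[:p:] dvd \<phi> ^ (s + t) * (G1 * K1 - [:c:] * \<phi> ^ Suc k)" by (metis dvd_triv_left)
    then have "[:p:] dvd G1 * K1 - [:c:] * \<phi> ^ Suc k" by (rule monic_const_cancel[OF p monic_power[OF m]])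
    then have "[:p:] dvd G1 * K1 - \<phi> * ([:c:] * \<phi> ^ k)" by (simp add: mult_ac)
    then have "dvd_mod p \<phi> (G1 * K1)" unfolding dvd_mod_def by blast
    then show False using dvd_mod_mult[OF p m irr] G K by blast
  qed
  then have "s * degree \<phi> + t * degree \<phi> = degree G + degree K" using deg by (simp flip: add_mult_distrib)
  then have "degree G = s * degree \<phi>" using G(3) K(3) by linarith
  then show ?thesis by simp
qed

text \<open>Hypothesis \<open>min\<close> says that the slopes of the \<open>\<phi>\<close>-Newton polygon of \<open>F\<close> at \<open>p\<close> are below \<open>1 / r\<close>, and
  \<open>low\<close> forces \<open>\<phi>\<close> to divide \<open>G\<close> modulo \<open>p\<close>.\<close>

lemma no_factor_of_degree:
  assumes p: "prime p" and m: "monic \<phi>" and irr: "poly_mod.irreducible_m p \<phi>" and r: "r > 0" "r \<le> N"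
    and rF: "reduced_digits \<phi> EF" and F: "poly EF \<phi> = G * K" and dF: "degree (poly EF \<phi>) = N * degree \<phi>"
    and l: "\<not> p dvd lead_coeff (poly EF \<phi>)" and dG: "degree G = r * degree \<phi>"
    and F0: "coeff EF 0 \<noteq> 0"
    and min: "\<And>j. j > 0 \<Longrightarrow> coeff EF j \<noteq> 0 \<Longrightarrow>
      r * multiplicity [:p:] (coeff EF 0) < r * multiplicity [:p:] (coeff EF j) + j"
    and low: "\<And>j. j + r \<le> N \<Longrightarrow> [:p:] dvd coeff EF j"
  shows False
proof -
  have dg: "degree \<phi> > 0" using not_unit_irreducible_m[OF irr m] .
  have lG: "\<not> p dvd lead_coeff G" and lK: "\<not> p dvd lead_coeff K" using l F by (auto simp: lead_coeff_mult)
  then have "G \<noteq> 0" "K \<noteq> 0" by auto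
  then have "degree G + degree K = N * degree \<phi>" using dF F by (simp add: degree_mult_eq)
  then have dK: "degree K = (N - r) * degree \<phi>" using dG by (simp add: diff_mult_distrib)
  obtain EG where EG: "poly EG \<phi> = G" "reduced_digits \<phi> EG" using reduced_digits_exists[OF m dg] by blast
  obtain EK where EK: "poly EK \<phi> = K" "reduced_digits \<phi> EK" using reduced_digits_exists[OF m dg] by blast
  have "EG \<noteq> 0" using EG \<open>G \<noteq> 0\<close> by auto
  note D = reduced_digits_degree[OF m EG(2) this, unfolded EG(1)]
  have "r * degree \<phi> = degree EG * degree \<phi> + degree (lead_coeff EG)" using D dG by simp
  moreover have "degree (lead_coeff EG) < degree \<phi>" using EG(2) by (simp add: reduced_digits_def)
  ultimately have rr: "degree EG = r"
    by (metis div_mult_self3 div_less mult.commute add.commute nonzero_mult_div_cancel_right dg add.right_neutral neq0_conv)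
  have "\<not> [:p:] dvd coeff EG r" using lG D unfolding rr by (auto simp: const_poly_dvd_iff)
  then have v0: "multiplicity [:p:] (coeff EG r) = 0" "coeff EG r \<noteq> 0" by (auto simp: not_dvd_imp_multiplicity_0)
  \<comment> \<open>The leading digit of G, at index r, has valuation 0 and weight r, so digit 0 has
    valuation below r / r = 1.\<close>
  have "coeff EG 0 \<noteq> 0 \<and> r * multiplicity [:p:] (coeff EG 0) < r * multiplicity [:p:] (coeff EG r) + r"
    using F EG EK by (intro minimal_weight_factor[OF p m irr r(1) EG(2) EK(2) rF _ F0 min r(1) v0(2)]) auto
  then have c0: "coeff EG 0 \<noteq> 0" "multiplicity [:p:] (coeff EG 0) = 0" using v0 by auto
  then have nd: "\<not> [:p:] dvd coeff EG 0"
    using prime_const_power_dvd_iff[OF p c0(1), of 1] by simp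
  have ndG: "\<not> dvd_mod p \<phi> G"
  proof
    assume "dvd_mod p \<phi> G"
    then obtain X Y where XY: "G = \<phi> * X + [:p:] * Y" by (elim dvd_modE)
    obtain E' where E': "EG = pCons (coeff EG 0) E'" by (metis coeff_pCons_0 pCons_cases)
    have "G = coeff EG 0 + \<phi> * poly E' \<phi>" using EG(1) E' by (metis poly_pCons)
    then have "coeff EG 0 = \<phi> * (X - poly E' \<phi>) + [:p:] * Y" using XY by (simp add: algebra_simps)
    then have "dvd_mod p \<phi> (coeff EG 0)" by (rule dvd_modI)
    then show False using nd dvd_mod_small[OF m] EG(2) by (auto simp: reduced_digits_def)
  qed
  \<comment> \<open>Modulo p only powers of \<phi> above N - r survive in the product. G contributes
    no factor \<phi>, and K, of degree (N - r) deg \<phi>, has no room for all of them.\<close>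
  have "dvd_mod p (\<phi> ^ (N - r + 1)) (G * K)"
  proof -
    have "\<exists>X Y. coeff EF j * \<phi> ^ j = \<phi> ^ (N - r + 1) * X + [:p:] * Y" for j
    proof (cases "j + r \<le> N")
      case True
      then obtain Z where "coeff EF j = [:p:] * Z" using low by (meson dvdE)
      then show ?thesis by (intro exI[of _ 0] exI[of _ "Z * \<phi> ^ j"]) (simp add: mult_ac)
    next
      case False
      then have "j = (N - r + 1) + (j - (N - r + 1))" using r by linarith
      then have "\<phi> ^ j = \<phi> ^ (N - r + 1) * \<phi> ^ (j - (N - r + 1))" by (metis power_add)
      then show ?thesis
        by (intro exI[of _ "coeff EF j * \<phi> ^ (j - (N - r + 1))"] exI[of _ 0]) (simp add: mult_ac)
    qed
    then obtain X Y where XY: "\<And>j. coeff EF j * \<phi> ^ j = \<phi> ^ (N - r + 1) * X j + [:p:] * Y j" by metis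
    have "G * K = (\<Sum>j\<le>degree EF. coeff EF j * \<phi> ^ j)" using F by (simp add: poly_altdef)
    also have "\<dots> = \<phi> ^ (N - r + 1) * (\<Sum>j\<le>degree EF. X j) + [:p:] * (\<Sum>j\<le>degree EF. Y j)"
      unfolding XY by (simp only: sum.distrib sum_distrib_left)
    finally show ?thesis by (rule dvd_modI)
  qed
  then have "dvd_mod p (\<phi> ^ (N - r + 1)) K" by (rule dvd_mod_power_factor[OF p m irr ndG])
  then have "(N - r + 1) * degree \<phi> \<le> degree K" by (rule dvd_mod_power_degree[OF m lK])
  then show False using dK dg by simp
qed


section \<open>Products of consecutive odd numbers\<close>

lemma fact_double: "fact (2 * i) = 2 ^ i * fact i * (\<Prod>l<i. 2 * l + 1 :: nat)"
  by (induction i) (auto simp: algebra_simps)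

text \<open>By Legendre the exponent of 2 in j! is j minus the binary digit sum of j, which is at
  most log2 (j + 1). The induction halves j.\<close>

lemma fact_two_power_decomp:
  "\<exists>v w :: nat. fact j = 2 ^ v * w \<and> odd w \<and> 2 ^ j \<le> (j + 1) * 2 ^ v"
proof (induction j rule: less_induct)
  case (less j)
  define i where "i = j div 2"
  define q where "q = (\<Prod>l<i. 2 * l + 1 :: nat)"
  have q: "odd q" unfolding q_def by (induction i) auto
  show ?case
  proof (cases "j = 0")
    case True
    then show ?thesis by (auto intro!: exI[of _ 0])
  next
    case False
    then have "i < j" by (auto simp: i_def)
    from less[OF this] obtain v w :: nat where vw: "fact i = 2 ^ v * w" "odd w" "2 ^ i \<le> (i + 1) * 2 ^ v"
      by auto
    have f: "fact (2 * i) = 2 ^ (i + v) * (w * q)"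
      using fact_double[of i] vw by (simp add: q_def power_add algebra_simps)
    consider "j = 2 * i" | "j = Suc (2 * i)" unfolding i_def by linarith
    then show ?thesis
    proof cases
      case 1
      have "2 ^ j = 2 ^ i * (2 ^ i :: nat)" using 1 by (simp add: mult_2 power_add)
      also have "\<dots> \<le> 2 ^ i * ((i + 1) * 2 ^ v)" using vw by simp
      also have "\<dots> \<le> (j + 1) * 2 ^ (i + v)" using 1 by (simp add: power_add algebra_simps)
      finally show ?thesis using f 1 vw q by (intro exI[of _ "i + v"] exI[of _ "w * q"]) auto
    next
      case 2
      have "2 ^ j = 2 * 2 ^ i * (2 ^ i :: nat)" unfolding 2 by (simp add: mult_2 power_add distrib_right)
      also have "\<dots> \<le> 2 * 2 ^ i * ((i + 1) * 2 ^ v)" using vw by simp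
      also have "\<dots> = (j + 1) * 2 ^ (i + v)" using 2 by (simp add: power_add algebra_simps)
      finally have a: "2 ^ j \<le> (j + 1) * 2 ^ (i + v)" .
      have "fact j = 2 ^ (i + v) * (w * q * j)" using f 2 by (simp add: algebra_simps)
      then show ?thesis using a 2 vw q by (intro exI[of _ "i + v"] exI[of _ "w * q * j"]) auto
    qed
  qed
qed

text \<open>Leave out the number x + 2 i0 with the highest power of p. The power of p in any other
  one divides the difference of the two, hence \<open>g i\<close>, since p = 2 does not occur. The
  \<open>g i\<close> multiply to i0! (k - 1 - i0)!, a divisor of (k - 1)!.\<close>

lemma multiplicity_prod_odds_le:
  fixes p x k :: nat
  assumes p: "prime p" and x: "odd x" and k: "k \<ge> 1"
  shows "\<exists>e. p ^ e \<le> x + 2 * (k - 1) \<and>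
     multiplicity p (\<Prod>i<k. x + 2 * i) \<le> multiplicity p (fact (k - 1) :: nat) + e"
proof -
  let ?v = "\<lambda>i. multiplicity p (x + 2 * i)"
  have pos: "x > 0" using x by (cases x) auto
  obtain i0 where i0: "i0 < k" "\<And>i. i < k \<Longrightarrow> ?v i \<le> ?v i0"
  proof -
    have "Max (?v ` {..<k}) \<in> ?v ` {..<k}" using k by (intro Max_in) (auto simp: lessThan_empty_iff)
    then obtain i0 where "i0 < k" "?v i0 = Max (?v ` {..<k})" by auto
    then show ?thesis using that[of i0] by (auto intro!: Max_ge)
  qed
  define g where "g i = (if i < i0 then i0 - i else i - i0)" for i
  have g: "?v i \<le> multiplicity p (g i)" if i: "i < k" "i \<noteq> i0" for i
  proof (cases "p = 2")
    case True
    then have "\<not> p dvd x + 2 * i" using x by simp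
    then show ?thesis by (simp add: not_dvd_imp_multiplicity_0)
  next
    case False
    have d1: "p ^ ?v i dvd x + 2 * i" by (rule multiplicity_dvd)
    have d2: "p ^ ?v i dvd x + 2 * i0"
      using i0(2)[OF i(1)] by (rule multiplicity_dvd')
    have "p ^ ?v i dvd 2 * g i"
    proof (cases "i < i0")
      case True
      then have "2 * g i = (x + 2 * i0) - (x + 2 * i)" by (auto simp: g_def)
      then show ?thesis using d1 d2 dvd_diff_nat by metis
    next
      case False
      then have "2 * g i = (x + 2 * i) - (x + 2 * i0)" by (auto simp: g_def)
      then show ?thesis using d1 d2 dvd_diff_nat by metis
    qed
    moreover have "coprime (p ^ ?v i) 2"
      using primes_coprime[of p 2] p False by (simp add: coprime_power_left_iff)
    ultimately have "p ^ ?v i dvd g i" by (simp add: coprime_dvd_mult_right_iff)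
    moreover have "g i \<noteq> 0" using i by (auto simp: g_def)
    ultimately show ?thesis using p by (intro multiplicity_geI) auto
  qed
  have "(\<Prod>i\<in>{..<i0}. g i) = (\<Prod>i\<in>{1..i0}. i)"
    by (rule prod.reindex_bij_witness[of _ "\<lambda>i. i0 - i" "\<lambda>i. i0 - i"]) (auto simp: g_def)
  then have f1: "(\<Prod>i\<in>{..<i0}. g i) = fact i0" by (simp add: fact_prod)
  have "(\<Prod>i\<in>{i0<..<k}. g i) = (\<Prod>i\<in>{1..k - 1 - i0}. i)"
    by (rule prod.reindex_bij_witness[of _ "\<lambda>i. i + i0" "\<lambda>i. i - i0"]) (auto simp: g_def)
  then have f2: "(\<Prod>i\<in>{i0<..<k}. g i) = fact (k - 1 - i0)" by (simp add: fact_prod)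
  have split: "{..<k} - {i0} = {..<i0} \<union> {i0<..<k}" using i0 by auto
  have "(\<Prod>i\<in>{..<k} - {i0}. g i) = fact i0 * fact (k - 1 - i0)"
    unfolding split by (subst prod.union_disjoint) (auto simp: f1 f2)
  also have "\<dots> dvd fact (k - 1)" using fact_fact_dvd_fact[of i0 "k - 1 - i0"] i0 by simp
  finally have gd: "(\<Prod>i\<in>{..<k} - {i0}. g i) dvd fact (k - 1)" .
  have "multiplicity p (\<Prod>i<k. x + 2 * i) = (\<Sum>i<k. ?v i)"
    using p pos by (subst prime_elem_multiplicity_prod_distrib) auto
  also have "\<dots> = ?v i0 + (\<Sum>i\<in>{..<k} - {i0}. ?v i)"
    using i0 by (subst sum.remove[of _ i0]) auto
  also have "(\<Sum>i\<in>{..<k} - {i0}. ?v i) \<le> (\<Sum>i\<in>{..<k} - {i0}. multiplicity p (g i))"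
    using g by (intro sum_mono) auto
  also have "\<dots> = multiplicity p (\<Prod>i\<in>{..<k} - {i0}. g i)"
    using p by (subst prime_elem_multiplicity_prod_distrib) (auto simp: g_def split: if_splits)
  also have "\<dots> \<le> multiplicity p (fact (k - 1) :: nat)"
    using gd by (intro dvd_imp_multiplicity_le) auto
  finally have "multiplicity p (\<Prod>i<k. x + 2 * i) \<le> multiplicity p (fact (k - 1) :: nat) + ?v i0" by simp
  moreover have "p ^ ?v i0 \<le> x + 2 * (k - 1)"
  proof -
    have "p ^ ?v i0 \<le> x + 2 * i0" using pos by (intro dvd_imp_le multiplicity_dvd) auto
    also have "\<dots> \<le> x + 2 * (k - 1)" using i0 by simp
    finally show ?thesis .
  qed
  ultimately show ?thesis by blast
qed

lemma prod_odds_dvd: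
  fixes x k :: nat
  assumes x: "odd x" and k: "k \<ge> 1" and S: "finite S" "\<And>p. p \<in> S \<Longrightarrow> prime p"
    and dv: "\<And>p i. prime p \<Longrightarrow> i < k \<Longrightarrow> p dvd x + 2 * i \<Longrightarrow> p \<in> S"
  shows "\<exists>e. (\<forall>p\<in>S. p ^ e p \<le> x + 2 * (k - 1)) \<and>
    (\<Prod>i<k. x + 2 * i) dvd fact (k - 1) * (\<Prod>p\<in>S. p ^ e p)"
proof -
  have "\<forall>p. \<exists>e. prime p \<longrightarrow> p ^ e \<le> x + 2 * (k - 1) \<and>
     multiplicity p (\<Prod>i<k. x + 2 * i) \<le> multiplicity p (fact (k - 1) :: nat) + e"
    using multiplicity_prod_odds_le[OF _ x k] by blast
  then obtain e where e: "\<And>p. prime p \<Longrightarrow> p ^ e p \<le> x + 2 * (k - 1)"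
    "\<And>p. prime p \<Longrightarrow> multiplicity p (\<Prod>i<k. x + 2 * i) \<le> multiplicity p (fact (k - 1) :: nat) + e p"
    by metis
  have pos: "x > 0" using x by (cases x) auto
  have nz: "(\<Prod>p\<in>S. p ^ e p) \<noteq> 0" using S not_prime_0 by (metis S prod_zero_iff power_eq_0_iff)
  have "(\<Prod>i<k. x + 2 * i) dvd fact (k - 1) * (\<Prod>p\<in>S. p ^ e p)"
  proof (rule multiplicity_le_imp_dvd)
    show "(\<Prod>i<k. x + 2 * i) \<noteq> 0" using pos by auto
  next
    fix p :: nat assume p: "prime p"
    show "multiplicity p (\<Prod>i<k. x + 2 * i) \<le> multiplicity p (fact (k - 1) * (\<Prod>p\<in>S. p ^ e p))"
    proof (cases "p \<in> S")
      case True
      have "e p \<le> multiplicity p (\<Prod>p\<in>S. p ^ e p)"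
        using nz p True S(1) by (intro multiplicity_geI dvd_prodI) auto
      then show ?thesis using e(2)[OF p] p nz
        by (subst prime_elem_multiplicity_mult_distrib) auto
    next
      case False
      then have "\<not> p dvd (\<Prod>i<k. x + 2 * i)" using dv p by (auto simp: prime_dvd_prod_iff)
      then show ?thesis by (simp add: not_dvd_imp_multiplicity_0)
    qed
  qed
  then show ?thesis using e(1) S by blast
qed


section \<open>Counting and multiplying primes\<close>

definition odd_primes :: "nat \<Rightarrow> nat set" where
  "odd_primes n = {p. prime p \<and> odd p \<and> p \<le> n}"

lemma finite_odd_primes [simp]: "finite (odd_primes n)"
  by (rule finite_subset[of _ "{..n}"]) (auto simp: odd_primes_def)

definition coprime_210 :: "nat \<Rightarrow> bool" where
  "coprime_210 j \<longleftrightarrow> j mod 2 \<noteq> 0 \<and> j mod 3 \<noteq> 0 \<and> j mod 5 \<noteq> 0 \<and> j mod 7 \<noteq> 0"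

lemma coprime_210_add: "coprime_210 (j + 210) = coprime_210 j"
proof -
  have "(j + 210) mod 2 = j mod 2" "(j + 210) mod 3 = j mod 3"
    "(j + 210) mod 5 = j mod 5" "(j + 210) mod 7 = j mod 7"
    using mod_mult_self2[of j 2 105] mod_mult_self2[of j 3 70] mod_mult_self2[of j 5 42] mod_mult_self2[of j 7 30]
    by simp_all
  then show ?thesis by (simp add: coprime_210_def)
qed

text \<open>Moving the window by one trades n + 1 for the congruent n + 211, so only the first
  window needs counting; 48 is Euler's totient of 210.\<close>

lemma card_coprime_210: "card {j \<in> {n<..n + 210}. coprime_210 j} = 48"
proof (induction n)
  case 0
  have "{j \<in> {0<..0 + 210}. coprime_210 j} = set (filter coprime_210 [1..<211])" by auto
  also have "card \<dots> = length (filter coprime_210 [1..<211])"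
    by (intro distinct_card) auto
  also have "\<dots> = 48" by code_simp
  finally show ?case .
next
  case (Suc n)
  let ?W = "\<lambda>n. {j \<in> {n<..n + 210}. coprime_210 j}"
  show ?case
  proof (cases "coprime_210 (Suc n)")
    case True
    then have "?W n = insert (Suc n) (?W (Suc n) - {Suc n + 210})"
      "Suc n + 210 \<in> ?W (Suc n)"
      using coprime_210_add[of "Suc n"] by (auto simp: less_Suc_eq_le order.strict_iff_order)
    then show ?thesis using Suc by (simp add: card_insert_if card_Diff_singleton)
  next
    case False
    have "j \<in> ?W n \<longleftrightarrow> j \<in> ?W (Suc n)" for j
      using False coprime_210_add[of "Suc n"] by (cases "j = Suc n"; cases "j = Suc n + 210") auto
    then have "?W n = ?W (Suc n)" by blast
    then show ?thesis using Suc by simp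
  qed
qed

lemma prime_not_dvd: "prime (p::nat) \<Longrightarrow> q > 1 \<Longrightarrow> q \<noteq> p \<Longrightarrow> p mod q \<noteq> 0"
  using prime_nat_iff by (auto simp: mod_eq_0_iff_dvd)

text \<open>Passing the sieve is necessary for primality, which is all that upper bounds need; the
  case \<open>j = q\<close> lets the moduli themselves pass.\<close>

definition sieve :: "int list \<Rightarrow> int \<Rightarrow> bool" where
  "sieve qs j = list_all (\<lambda>q. j = q \<or> j mod q \<noteq> 0) qs"

lemma sieve_prime:
  assumes p: "prime (p :: nat)" and qs: "list_all (\<lambda>q. q > 1) qs"
  shows "sieve qs (int p)"
  unfolding sieve_def list_all_iff
proof
  fix q assume "q \<in> set qs"
  then have q: "q > 1" using qs by (auto simp: list_all_iff)
  have "int p = q" if "q dvd int p"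
  proof -
    have "0 \<le> q" using q by simp
    then obtain d where d: "q = int d" by (rule nonneg_int_cases)
    then have "d dvd p" "d \<noteq> 1" using that q by auto
    then have "d = p" using p unfolding prime_nat_iff by blast
    then show ?thesis by (simp add: d)
  qed
  then show "int p = q \<or> int p mod q \<noteq> 0" by (auto simp: mod_eq_0_iff_dvd)
qed

lemma card_odd_primes_step: "n \<ge> 7 \<Longrightarrow> card (odd_primes (n + 210)) \<le> card (odd_primes n) + 48"
proof -
  assume n: "n \<ge> 7"
  have "odd_primes (n + 210) \<subseteq> odd_primes n \<union> {j \<in> {n<..n + 210}. coprime_210 j}"
    using n prime_not_dvd by (auto simp: odd_primes_def coprime_210_def odd_iff_mod_2_eq_one)
  then have "card (odd_primes (n + 210)) \<le> card (odd_primes n \<union> {j \<in> {n<..n + 210}. coprime_210 j})"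
    by (intro card_mono) auto
  also have "\<dots> \<le> card (odd_primes n) + card {j \<in> {n<..n + 210}. coprime_210 j}" by (rule card_Un_le)
  finally show ?thesis by (simp only: card_coprime_210)
qed

text \<open>\<open>c\<close> stands for an upper bound on the number of odd primes up to 2k + 1, and
  2k + 3 is the next candidate.\<close>

fun sieve_count_ok :: "nat \<Rightarrow> int \<Rightarrow> int \<Rightarrow> bool" where
  "sieve_count_ok 0 k c \<longleftrightarrow> 2 * c \<le> k + 5"
| "sieve_count_ok (Suc n) k c \<longleftrightarrow> 2 * c \<le> k + 5 \<and>
     sieve_count_ok n (k + 1) (if sieve [3, 5, 7] (2 * k + 3)
       then c + 1 else c)"

lemma sieve_count_okD:
  "sieve_count_ok n (int k) c \<Longrightarrow> int (card (odd_primes (2 * k + 1))) \<le> c \<Longrightarrow> j \<le> n \<Longrightarrow>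
     2 * card (odd_primes (2 * (k + j) + 1)) \<le> k + j + 5"
proof (induction n arbitrary: k c j)
  case 0
  then show ?case by auto
next
  case (Suc n)
  show ?case
  proof (cases j)
    case 0
    then show ?thesis using Suc.prems by auto
  next
    case (Suc i)
    let ?t = "sieve [3, 5, 7] (2 * int k + 3)"
    let ?c = "if ?t then c + 1 else c"
    have "odd_primes (2 * (k + 1) + 1) \<subseteq> insert (2 * k + 3) (odd_primes (2 * k + 1))"
    proof
      fix p assume "p \<in> odd_primes (2 * (k + 1) + 1)"
      then have "p = 2 * k + 3 \<or> p = 2 * k + 2 \<or> p \<in> odd_primes (2 * k + 1)" "odd p"
        by (auto simp: odd_primes_def)
      then show "p \<in> insert (2 * k + 3) (odd_primes (2 * k + 1))" by auto
    qed
    then have "card (odd_primes (2 * (k + 1) + 1)) \<le> card (insert (2 * k + 3) (odd_primes (2 * k + 1)))"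
      by (intro card_mono) auto
    then have 1: "card (odd_primes (2 * (k + 1) + 1)) \<le> card (odd_primes (2 * k + 1)) + 1"
      by (simp add: card_insert_if split: if_splits)
    have 2: "\<not> ?t \<Longrightarrow> \<not> prime (2 * k + 3)"
      using sieve_prime[of "2 * k + 3" "[3, 5, 7]"] by auto
    have "int (card (odd_primes (2 * (k + 1) + 1))) \<le> ?c"
    proof (cases ?t)
      case True
      then show ?thesis using 1 Suc.prems by simp
    next
      case False
      have "odd_primes (2 * (k + 1) + 1) \<subseteq> odd_primes (2 * k + 1)"
      proof
        fix p assume p: "p \<in> odd_primes (2 * (k + 1) + 1)"
        then have "p = 2 * k + 3 \<or> p = 2 * k + 2 \<or> p \<in> odd_primes (2 * k + 1)" "odd p" "prime p"
          by (auto simp: odd_primes_def)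
        then show "p \<in> odd_primes (2 * k + 1)" using 2[OF False] by auto
      qed
      then have "card (odd_primes (2 * (k + 1) + 1)) \<le> card (odd_primes (2 * k + 1))"
        by (intro card_mono) auto
      then show ?thesis using False Suc.prems by simp
    qed
    moreover have "sieve_count_ok n (int (k + 1)) ?c"
      using Suc.prems(1) by (simp add: add.commute)
    ultimately have "2 * card (odd_primes (2 * (k + 1 + i) + 1)) \<le> k + 1 + i + 5"
      using Suc.prems Suc by (intro Suc.IH) auto
    then show ?thesis using Suc by simp
  qed
qed

lemma odd_primes_1: "odd_primes (Suc 0) = {}"
  by (auto simp: odd_primes_def prime_nat_iff)

text \<open>A period of 210 is 105 steps of k and adds at most 48 primes, where the bound allows 105
  / 2. The summand 5 is attained at k = 9, by the seven odd primes up to 19.\<close>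

lemma card_odd_primes_le: "2 * card (odd_primes (2 * k + 1)) \<le> k + 5"
proof (induction k rule: less_induct)
  case (less k)
  show ?case
  proof (cases "k \<le> 108")
    case True
    have "sieve_count_ok 108 (int 0) 0" by code_simp
    from sieve_count_okD[OF this, of k] True show ?thesis by (simp add: odd_primes_1)
  next
    case False
    have a: "2 * card (odd_primes (2 * (k - 105) + 1)) \<le> k - 105 + 5" using False by (intro less) auto
    have "card (odd_primes (2 * (k - 105) + 1 + 210)) \<le> card (odd_primes (2 * (k - 105) + 1)) + 48"
      using False by (intro card_odd_primes_step) auto
    moreover have "2 * (k - 105) + 1 + 210 = 2 * k + 1" using False by auto
    ultimately have "card (odd_primes (2 * k + 1)) \<le> card (odd_primes (2 * (k - 105) + 1)) + 48" by metis
    with a show ?thesis using False by simp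
  qed
qed

section \<open>A Chebyshev bound for the product of the primes up to n\<close>

definition primorial :: "nat \<Rightarrow> nat" where "primorial n = (\<Prod>p | prime p \<and> p \<le> n. p)"

lemma finite_primes_le [simp]: "finite {p::nat. prime p \<and> p \<le> n}"
  by (rule finite_subset[of _ "{..n}"]) auto

lemma primorial_mono: "m \<le> n \<Longrightarrow> primorial m \<le> primorial n"
  unfolding primorial_def
  by (rule dvd_imp_le[OF prod_dvd_prod_subset]) (auto intro!: prod_pos prime_gt_0_nat)

lemma primorial_Suc: "primorial (Suc n) = (if prime (Suc n) then Suc n * primorial n else primorial n)"
proof -
  have "{p. prime p \<and> p \<le> Suc n} = (if prime (Suc n) then insert (Suc n) {p. prime p \<and> p \<le> n} else {p. prime p \<and> p \<le> n})"
    by (auto simp: le_Suc_eq)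
  then show ?thesis by (simp add: primorial_def)
qed

text \<open>In \<open>sieve_prod_ok n m r\<close> the number \<open>r / 10\<^sup>9\<close> is an upper bound, rounded up in each step to keep the
  numerals small, for \<open>primorial m / (17/5)\<^sup>m\<close>.\<close>

fun sieve_prod_ok :: "nat \<Rightarrow> int \<Rightarrow> int \<Rightarrow> bool" where
  "sieve_prod_ok 0 m r \<longleftrightarrow> r \<le> 1000000000"
| "sieve_prod_ok (Suc n) m r \<longleftrightarrow> r \<le> 1000000000 \<and>
     sieve_prod_ok n (m + 1) (((if sieve [2, 3, 5, 7, 11, 13, 17, 19, 23] (m + 1)
       then (m + 1) * r else r) * 5) div 17 + 1)"

lemma sieve_prod_okD:
  "sieve_prod_ok n (int m) r \<Longrightarrow> 1000000000 * 5 ^ m * int (primorial m) \<le> r * 17 ^ m \<Longrightarrow> j \<le> n \<Longrightarrow>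
     5 ^ (m + j) * int (primorial (m + j)) \<le> 17 ^ (m + j)"
proof (induction n arbitrary: m r j)
  case 0
  have "r * 17 ^ m \<le> 1000000000 * 17 ^ m" using 0 by (intro mult_right_mono) auto
  then have "1000000000 * (5 ^ m * int (primorial m)) \<le> 1000000000 * 17 ^ m"
    using 0(2) by (simp only: mult.assoc)
  then show ?case using 0 by simp
next
  case (Suc n)
  show ?case
  proof (cases j)
    case 0
    have "r * 17 ^ m \<le> 1000000000 * 17 ^ m" using Suc.prems by (intro mult_right_mono) auto
    then have "1000000000 * (5 ^ m * int (primorial m)) \<le> 1000000000 * 17 ^ m"
      using Suc.prems(2) by (simp only: mult.assoc)
    then show ?thesis using 0 by simp
  next
    case (Suc i)
    let ?t = "sieve [2, 3, 5, 7, 11, 13, 17, 19, 23] (int m + 1)"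
    let ?s = "if ?t then (int m + 1) * r else r"
    have 2: "prime (Suc m) \<Longrightarrow> ?t"
      using sieve_prime[of "Suc m" "[2, 3, 5, 7, 11, 13, 17, 19, 23]"] by (simp add: add.commute)
    have le17: "y \<le> (y div 17 + 1) * 17" for y :: int by presburger
    have pos: "0 \<le> 1000000000 * 5 ^ m * int (primorial m)" by simp
    have r0: "r \<ge> 0"
    proof (rule ccontr)
      assume "\<not> r \<ge> 0"
      then have "r * 17 ^ m < 0" by (simp add: mult_neg_pos)
      then show False using Suc.prems(2) pos by linarith
    qed
    have "1000000000 * 5 ^ m * int (primorial (Suc m)) \<le> ?s * 17 ^ m"
    proof (cases "prime (Suc m)")
      case True
      have "1000000000 * 5 ^ m * int (primorial (Suc m)) = (int m + 1) * (1000000000 * 5 ^ m * int (primorial m))"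
        using True by (simp add: primorial_Suc algebra_simps)
      also have "\<dots> \<le> (int m + 1) * (r * 17 ^ m)" using Suc.prems(2) by (intro mult_left_mono) auto
      finally show ?thesis using 2[OF True] by (simp add: mult_ac)
    next
      case False
      have "1 * r \<le> (int m + 1) * r" using r0 by (intro mult_right_mono) auto
      then have "r \<le> ?s" by simp
      then have "r * 17 ^ m \<le> ?s * 17 ^ m" by (intro mult_right_mono) auto
      then show ?thesis using Suc.prems(2) False by (simp only: primorial_Suc if_False)
    qed
    then have "5 * (1000000000 * 5 ^ m * int (primorial (Suc m))) \<le> 5 * (?s * 17 ^ m)"
      by (rule mult_left_mono) simp
    then have "1000000000 * 5 ^ Suc m * int (primorial (Suc m)) \<le> (?s * 5) * 17 ^ m"
      by (simp only: power_Suc mult_ac)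
    also have "\<dots> \<le> ((?s * 5 div 17 + 1) * 17) * 17 ^ m"
    proof (intro mult_right_mono)
      show "?s * 5 \<le> (?s * 5 div 17 + 1) * 17"
        by (rule le17)
    qed auto
    finally have "1000000000 * 5 ^ Suc m * int (primorial (Suc m)) \<le> (?s * 5 div 17 + 1) * 17 ^ Suc m"
      by (simp only: power_Suc mult_ac)
    moreover have "sieve_prod_ok n (int (Suc m)) (?s * 5 div 17 + 1)"
      using Suc.prems(1) by (simp add: add.commute)
    ultimately have "5 ^ (Suc m + i) * int (primorial (Suc m + i)) \<le> 17 ^ (Suc m + i)"
      using Suc.prems Suc by (intro Suc.IH) auto
    then show ?thesis using Suc by simp
  qed
qed

lemma primorial_0: "primorial 0 = 1"
  unfolding primorial_def by (rule prod.neutral) auto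

lemma primorial_le_base: "m \<le> 732 \<Longrightarrow> 5 ^ m * int (primorial m) \<le> 17 ^ m"
proof -
  assume m: "m \<le> 732"
  have "sieve_prod_ok 732 (int 0) 1000000000" by code_simp
  from sieve_prod_okD[OF this, of m] m show ?thesis by (simp add: primorial_0)
qed

text \<open>The multiple t of p is among the factors a - b + 1, ..., a, whose product is b! times
  the binomial coefficient, and p > b does not divide b!.\<close>

lemma prime_dvd_binomial:
  assumes p: "prime (p :: nat)" "p > b" and b: "b \<le> a" and t: "p dvd t" "a - b < t" "t \<le> a"
  shows "p dvd a choose b"
proof -
  have "fact b * fact (a - b) * (a choose b) = fact a" by (rule binomial_fact_lemma[OF b])
  also have "fact a = fact (a - b) * \<Prod>{Suc (a - b)..a}"
    by (subst fact_eq_fact_times[of "a - b" a]) auto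
  finally have "fact b * (a choose b) = \<Prod>{Suc (a - b)..a}" by (simp add: mult_ac)
  moreover have "t dvd \<Prod>{Suc (a - b)..a}" using t by (intro dvd_prodI[where f = "\<lambda>x. x"]) auto
  ultimately have "p dvd fact b * (a choose b)" using t by (metis dvd_trans)
  then show ?thesis using p by (auto simp: prime_dvd_mult_iff prime_dvd_fact_iff)
qed

lemma prod_primes_dvd:
  assumes "finite A" "\<And>p. p \<in> A \<Longrightarrow> prime (p :: nat) \<and> p dvd n"
  shows "\<Prod>A dvd n"
  using assms
proof (induction A rule: finite_induct)
  case (insert p A)
  have "coprime p (\<Prod>A)"
  proof (intro prod_coprime_right)
    fix q assume "q \<in> A"
    then show "coprime p q" using insert.prems[of p] insert.prems[of q] insert.hyps
      by (intro primes_coprime) auto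
  qed
  then show ?case using insert by (simp add: divides_mult)
qed auto

text \<open>Every prime in \<open>(n, 6n]\<close> divides the multinomial coefficient \<open>(6n)! / ((3n)! (2n)! n!)\<close>, which is at most
  \<open>(6\<^sup>6 / (3\<^sup>3 2\<^sup>2))\<^sup>n = 432\<^sup>n\<close>.\<close>

lemma primorial_6_le: "primorial (6 * n) \<le> 432 ^ n * primorial n"
proof (cases "n = 0")
  case False
  define M where "M = ((6 * n) choose (3 * n)) * ((3 * n) choose n)"
  have "fact (3 * n) * fact (6 * n - 3 * n) * ((6 * n) choose (3 * n)) = fact (6 * n)"
    "fact n * fact (3 * n - n) * ((3 * n) choose n) = fact (3 * n)"
    "fact (2 * n) * fact (6 * n - 2 * n) * ((6 * n) choose (2 * n)) = fact (6 * n)"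
    "fact n * fact (4 * n - n) * ((4 * n) choose n) = fact (4 * n)"
    by (rule binomial_fact_lemma; simp)+
  moreover have "6 * n - 3 * n = 3 * n" "3 * n - n = 2 * n" "6 * n - 2 * n = 4 * n" "4 * n - n = 3 * n"
    by auto
  ultimately have b: "fact (3 * n) * fact (3 * n) * ((6 * n) choose (3 * n)) = fact (6 * n)"
    "fact n * fact (2 * n) * ((3 * n) choose n) = fact (3 * n)"
    "fact (2 * n) * fact (4 * n) * ((6 * n) choose (2 * n)) = fact (6 * n)"
    "fact n * fact (3 * n) * ((4 * n) choose n) = fact (4 * n)"
    by simp_all
  \<comment> \<open>The same multinomial coefficient, split in another order. By
    \<open>prime_dvd_binomial\<close> the factors of \<open>M\<close> do not reach the primes
    between 3n/2 and 2n; for those, 2p lies in (3n, 4n], the range of the second factor of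
    \<open>N\<close>.\<close>
  define N where "N = ((6 * n) choose (2 * n)) * ((4 * n) choose n)"
  have "fact (3 * n) * (fact n * fact (2 * n) * ((3 * n) choose n)) * ((6 * n) choose (3 * n)) = (fact (6 * n) :: nat)"
    unfolding b(2) by (rule b(1))
  moreover have "fact (2 * n) * (fact n * fact (3 * n) * ((4 * n) choose n)) * ((6 * n) choose (2 * n)) = (fact (6 * n) :: nat)"
    unfolding b(4) by (rule b(3))
  ultimately have "(fact n * fact (2 * n) * fact (3 * n)) * M = (fact n * fact (2 * n) * fact (3 * n)) * N"
    unfolding M_def N_def by (simp only: mult_ac)
  then have "M = N" by (subst (asm) mult_cancel_left) auto
  note M2 = this[unfolded N_def]
  have dv: "p dvd M" if p: "prime p" "n < p" "p \<le> 6 * n" for p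
  proof -
    consider "2 * p \<le> 3 * n" | "3 * n < 2 * p" "p \<le> 2 * n" | "2 * n < p" "p \<le> 3 * n"
      | "3 * n < p" "p \<le> 4 * n" | "4 * n < p" by linarith
    then show ?thesis
    proof cases
      case 1
      then show ?thesis unfolding M_def using p
        by (intro dvd_mult prime_dvd_binomial[where t = "2 * p"]) auto
    next
      case 2
      then show ?thesis unfolding M2 using p
        by (intro dvd_mult prime_dvd_binomial[where t = "2 * p"]) auto
    next
      case 3
      then show ?thesis unfolding M_def using p
        by (intro dvd_mult prime_dvd_binomial[where t = p]) auto
    next
      case 4
      then show ?thesis unfolding M2 using p
        by (intro dvd_mult prime_dvd_binomial[where t = p]) auto
    next
      case 5
      then show ?thesis unfolding M2 using p
        by (intro dvd_mult2 prime_dvd_binomial[where t = p]) auto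
    qed
  qed
  have "4 ^ n * M \<le> 4 ^ n * 432 ^ n"
  proof -
    have "((3 * n) choose n) * 4 ^ n \<le> (\<Sum>k\<le>3 * n. ((3 * n) choose k) * 1 ^ k * 2 ^ (3 * n - k))"
    proof -
      have "((3 * n) choose n) * 4 ^ n = ((3 * n) choose n) * 1 ^ n * 2 ^ (3 * n - n)"
        by (simp add: power_mult flip: mult_2)
      also have "\<dots> \<le> (\<Sum>k\<le>3 * n. ((3 * n) choose k) * 1 ^ k * 2 ^ (3 * n - k))"
        by (rule member_le_sum) auto
      finally show ?thesis .
    qed
    also have "\<dots> = (1 + 2) ^ (3 * n)" using binomial[of 1 2 "3 * n"] by simp
    also have "(1 + 2) ^ (3 * n) = ((3 :: nat) ^ 3) ^ n" by (simp only: power_mult one_plus_numeral add_num_simps)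
    also have "\<dots> = 27 ^ n" by simp
    finally have 1: "((3 * n) choose n) * 4 ^ n \<le> 27 ^ n" .
    have 2: "(6 * n) choose (3 * n) \<le> 64 ^ n"
      using binomial_le_pow2[of "6 * n" "3 * n"] by (simp add: power_mult)
    have "4 ^ n * M = ((6 * n) choose (3 * n)) * (((3 * n) choose n) * 4 ^ n)" by (simp add: M_def mult_ac)
    also have "\<dots> \<le> 64 ^ n * 27 ^ n" by (intro mult_mono 1 2) auto
    also have "\<dots> = 4 ^ n * 432 ^ n" by (simp flip: power_mult_distrib)
    finally show ?thesis .
  qed
  then have M: "M \<le> 432 ^ n" by simp
  have "M > 0" unfolding M_def by simp
  have "\<Prod>{p. prime p \<and> n < p \<and> p \<le> 6 * n} dvd M"
    using dv by (intro prod_primes_dvd) (auto intro: finite_subset[of _ "{..6 * n}"])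
  then have "\<Prod>{p. prime p \<and> n < p \<and> p \<le> 6 * n} \<le> M" using \<open>M > 0\<close> by (intro dvd_imp_le)
  moreover have "primorial (6 * n) = primorial n * \<Prod>{p. prime p \<and> n < p \<and> p \<le> 6 * n}"
  proof -
    have "{p. prime p \<and> p \<le> 6 * n} = {p. prime p \<and> p \<le> n} \<union> {p. prime p \<and> n < p \<and> p \<le> 6 * n}" by auto
    moreover have "finite {p. prime p \<and> n < p \<and> p \<le> 6 * n}" by (rule finite_subset[of _ "{..6 * n}"]) auto
    ultimately show ?thesis unfolding primorial_def
      by (simp only:) (subst prod.union_disjoint, auto)
  qed
  ultimately have "primorial (6 * n) \<le> primorial n * 432 ^ n"
  proof -
    assume a: "\<Prod>{p. prime p \<and> n < p \<and> p \<le> 6 * n} \<le> M"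
      and b: "primorial (6 * n) = primorial n * \<Prod>{p. prime p \<and> n < p \<and> p \<le> 6 * n}"
    from a M have "\<Prod>{p. prime p \<and> n < p \<and> p \<le> 6 * n} \<le> 432 ^ n" by (rule order_trans)
    then show ?thesis unfolding b by (rule mult_le_mono2)
  qed
  then show ?thesis by (simp add: mult_ac)
qed (simp add: primorial_0)

text \<open>The base \<open>17/5\<close> exceeds \<open>432\<^bsup>1/5\<^esup>\<close>, as the recursion requires, but stays below \<open>4\<close>, which
  the comparison with \<open>16\<^sup>k\<close> below requires.\<close>

lemma primorial_le: "real (primorial m) \<le> (17 / 5) ^ m"
proof (induction m rule: less_induct)
  case (less m)
  let ?r = "17 / 5 :: real"
  show ?case
  proof (cases "m \<le> 732")
    case True
    then have "real_of_int (5 ^ m * int (primorial m)) \<le> real_of_int (17 ^ m)"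
      using primorial_le_base of_int_le_iff by blast
    then show ?thesis by (simp add: power_divide field_simps)
  next
    case False
    define n where "n = (m + 5) div 6"
    have n: "m \<le> 6 * n" "6 * n \<le> m + 5" "n \<ge> 122" "n < m" using False unfolding n_def by auto
    \<comment> \<open>Rounding m up to a multiple of 6 costs at most five factors 17/5. Each unit of
      n gains (17/5)^5 / 432 > 1.0517, which repays them from n = 122 on; hence the range up to 732
      = 6 * 122 that is checked directly.\<close>
    have aux: "432 ^ n * ?r ^ 5 \<le> ?r ^ (5 * n)" if "n \<ge> 122" for n
      using that
    proof (induction n rule: dec_induct)
      case base
      have *: "c ^ 122 * R \<le> R ^ 122" if "0 \<le> c" "0 \<le> a" "c * a \<le> R" "R \<le> (a ^ 10) ^ 12 * a ^ 2"
        for a c R :: real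
      proof -
        have "(a ^ 10) ^ 12 * a ^ 2 = a ^ 122" by (simp flip: power_mult power_add)
        then have "c ^ 122 * R \<le> c ^ 122 * a ^ 122" using that by (intro mult_left_mono) auto
        also have "\<dots> = (c * a) ^ 122" by (simp add: power_mult_distrib)
        also have "\<dots> \<le> R ^ 122" using that by (intro power_mono) auto
        finally show ?thesis .
      qed
      have "?r ^ 5 \<le> (1655 / 1000) ^ 12 * (11 / 10)" by (simp add: power_divide)
      moreover have "(1655 / 1000) ^ 12 \<le> (((10517 / 10000) ^ 10) ^ 12 :: real)"
        by (rule power_mono) (simp_all add: power_divide)
      moreover have "(11 / 10 :: real) \<le> (10517 / 10000) ^ 2" by (simp add: power_divide)
      moreover have "x * y \<le> x' * y'" if "x \<le> x'" "y \<le> y'" "0 \<le> y" "0 \<le> x'" for x y x' y' :: real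
        using that by (intro mult_mono)
      moreover have "0 \<le> ((z :: real) ^ 10) ^ 12" for z by simp
      ultimately have h: "?r ^ 5 \<le> ((10517 / 10000) ^ 10) ^ 12 * (10517 / 10000) ^ 2"
        by (meson order_trans zero_le_numeral divide_nonneg_nonneg)
      have c: "432 * (10517 / 10000) \<le> ?r ^ 5" by (simp add: power_divide)
      have "432 ^ 122 * ?r ^ 5 \<le> (?r ^ 5) ^ 122"
        by (rule *[OF zero_le_numeral _ c h]) simp
      then show ?case by (simp only: power_mult)
    next
      case (step n)
      have "432 ^ Suc n * ?r ^ 5 \<le> 432 * ?r ^ (5 * n)" using step by simp
      also have "\<dots> \<le> ?r ^ 5 * ?r ^ (5 * n)" by (intro mult_right_mono) (auto simp: power_divide)
      finally show ?case by (simp add: power_add)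
    qed
    have "?r ^ 5 * ?r ^ m \<ge> ?r ^ (6 * n)"
      using n by (subst power_add[symmetric]) (intro power_increasing, auto)
    also have "?r ^ (6 * n) = ?r ^ (5 * n) * ?r ^ n" by (simp flip: power_add)
    finally have "?r ^ (5 * n) * ?r ^ n \<le> ?r ^ 5 * ?r ^ m" .
    moreover have "432 ^ n * ?r ^ 5 * ?r ^ n \<le> ?r ^ (5 * n) * ?r ^ n"
      using aux[OF n(3)] by (intro mult_right_mono) auto
    ultimately have "?r ^ 5 * (432 ^ n * ?r ^ n) \<le> ?r ^ 5 * ?r ^ m" by (simp only: mult_ac)
    then have a: "432 ^ n * ?r ^ n \<le> ?r ^ m" by (subst (asm) mult_le_cancel_left_pos) auto
    have "real (primorial m) \<le> real (432 ^ n * primorial n)"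
      using primorial_mono[OF n(1)] primorial_6_le[of n] by (simp only: of_nat_le_iff)
    also have "\<dots> = 432 ^ n * real (primorial n)" by simp
    also have "\<dots> \<le> 432 ^ n * ?r ^ n" using less[OF n(4)] by (intro mult_left_mono) auto
    finally show ?thesis using a by linarith
  qed
qed


section \<open>Windows of few odd numbers and of small odd numbers\<close>

lemma power_of_only_prime:
  assumes "n > 0" and "\<And>p. prime p \<Longrightarrow> p dvd n \<Longrightarrow> p = (q :: nat)"
  shows "\<exists>e. n = q ^ e"
proof (cases "n = 1")
  case True
  then show ?thesis by (intro exI[of _ 0]) simp
next
  case False
  then obtain p where "prime p" "p dvd n" using prime_factor_nat by blast
  then have q: "prime q" using assms by auto
  obtain m where m: "n = q ^ multiplicity q n * m" "\<not> q dvd m"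
    using multiplicity_decompose'[of n q] assms q by (metis not_prime_unit neq0_conv)
  have "m = 1"
  proof (rule ccontr)
    assume "m \<noteq> 1"
    then obtain p where "prime p" "p dvd m" using prime_factor_nat by blast
    moreover from this have "p dvd n" using m by (metis dvd_mult)
    ultimately show False using assms m by auto
  qed
  then show ?thesis using m by auto
qed

lemma power_mod_period:
  fixes q M :: int
  assumes "q ^ L mod M = 1"
  shows "q ^ a mod M = q ^ (a mod L) mod M"
proof -
  have "q ^ a = (q ^ L) ^ (a div L) * q ^ (a mod L)"
    by (simp flip: power_mult power_add)
  also have "\<dots> mod M = ((q ^ L) mod M) ^ (a div L) * q ^ (a mod L) mod M"
    by (metis mod_mult_left_eq power_mod)
  finally show ?thesis using assms by simp
qed

lemma mod_refine_5:
  fixes a L r :: nat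
  assumes "a mod L = r" and "L > 0"
  shows "a mod (5 * L) \<in> {r, r + L, r + 2 * L, r + 3 * L, r + 4 * L}"
proof -
  define q where "q = a mod (5 * L) div L"
  have "a mod (5 * L) mod L = r" using assms(1) by (simp add: mod_mod_cancel)
  then have e: "a mod (5 * L) = q * L + r" unfolding q_def by (metis div_mult_mod_eq)
  have "a mod (5 * L) < 5 * L" using assms(2) by simp
  then have "q < 5" unfolding q_def by (simp add: less_mult_imp_div_less)
  then have "q = 0 \<or> q = 1 \<or> q = 2 \<or> q = 3 \<or> q = 4" by linarith
  then show ?thesis unfolding e by auto
qed

text \<open>Modulo \<open>125\<close> the equation forces \<open>a \<equiv> 43\<close> modulo \<open>100\<close>, which is impossible modulo \<open>251\<close>.\<close>

lemma pow3_eq_pow5_plus_2: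
  assumes e: "(3::int) ^ a = 5 ^ b + 2"
  shows "b \<le> 2"
proof (rule ccontr)
  assume "\<not> b \<le> 2"
  then obtain d where "b = 3 + d" using le_Suc_ex[of 3 b] by auto
  then have "(5::int) ^ b = 125 * 5 ^ d" by (simp add: power_add)
  then have "(3::int) ^ a mod 125 = 2" using e by simp
  have g25: "(3::int) ^ 25 mod 251 = 113" by simp
  from \<open>(3::int) ^ a mod 125 = 2\<close> have "(3::int) ^ a mod 125 = 2" .
  moreover have "(3::int) ^ 100 mod 125 = 1" by simp
  ultimately have "(3::int) ^ (a mod 100) mod 125 = 2" by (metis power_mod_period)
  \<comment> \<open>The exponent is lifted from modulus 4 to 20 to 100, which are periods of the
    powers of 3 modulo 5, 25 and 125.\<close>
  moreover have "a mod 100 \<in> {3, 23, 43, 63, 83}"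
  proof -
    have "(3::int) ^ a mod 25 = 3 ^ a mod 125 mod 25" by (rule mod_mod_cancel[symmetric]) simp
    then have m25: "(3::int) ^ a mod 25 = 2" using \<open>(3::int) ^ a mod 125 = 2\<close> by simp
    have "(3::int) ^ a mod 5 = 3 ^ a mod 25 mod 5" by (rule mod_mod_cancel[symmetric]) simp
    then have "(3::int) ^ a mod 5 = 2" using m25 by simp
    moreover have "(3::int) ^ 4 mod 5 = 1" by simp
    ultimately have "(3::int) ^ (a mod 4) mod 5 = 2" by (metis power_mod_period)
    moreover have "a mod 4 \<in> {0, 1, 2, 3}" by (simp, presburger)
    ultimately have "a mod 4 = 3" by auto
    from mod_refine_5[OF this] have "a mod 20 \<in> {3, 7, 11, 15, 19}" by simp
    moreover have "(3::int) ^ 20 mod 25 = 1" by simp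
    then have "(3::int) ^ (a mod 20) mod 25 = 2" using m25 by (metis power_mod_period)
    ultimately have "a mod 20 = 3" by auto
    from mod_refine_5[OF this] show ?thesis by simp
  qed
  ultimately have "a mod 100 = 43" by auto
  moreover have "a mod 100 mod 25 = a mod 25" by (rule mod_mod_cancel) simp
  ultimately have "a mod 25 = 18" by simp
  define t where "t = a div 25"
  have "a = 18 + 25 * t" using \<open>a mod 25 = 18\<close> div_mult_mod_eq[of a 25] unfolding t_def by linarith
  then have "(3::int) ^ a mod 251 = 3 ^ 18 * (3 ^ 25) ^ t mod 251" by (simp add: power_add power_mult)
  also have "\<dots> = 3 ^ 18 * (113 ^ t mod 251) mod 251"
    using power_mod[of "3 ^ 25 :: int" 251 t] by (metis (no_types, lifting) mod_mult_right_eq g25)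
  also have "(113::int) ^ t mod 251 = 113 ^ (t mod 5) mod 251" by (rule power_mod_period) simp
  finally have "(3::int) ^ a mod 251 = 3 ^ 18 * (113 ^ (t mod 5) mod 251) mod 251" .
  moreover have "t mod 5 = 0 \<or> t mod 5 = 1 \<or> t mod 5 = 2 \<or> t mod 5 = 3 \<or> t mod 5 = 4" by presburger
  ultimately have v: "(3::int) ^ a mod 251 \<in> {232, 112, 106, 181, 122}" by auto
  \<comment> \<open>As 5^25 is 1 modulo 251, the 25th power of 3^a - 2 must be 1; none of the five
    residues left by a mod 25 = 18 satisfies this.\<close>
  have "((3::int) ^ a mod 251 - 2) ^ 25 mod 251 = (5 ^ b) ^ 25 mod 251"
    using e by (metis add_diff_cancel_right' mod_diff_left_eq power_mod)
  also have "\<dots> = (5 ^ 25) ^ b mod (251::int)" by (metis power_mult mult.commute)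
  also have "\<dots> = (5 ^ 25 mod 251) ^ b mod (251::int)" by (rule power_mod[symmetric])
  also have "\<dots> = 1" by simp
  finally have "((((3::int) ^ a mod 251 - 2) ^ 5 mod 251) ^ 5) mod 251 = 1"
    by (simp add: power_mod flip: power_mult)
  then show False using v by auto
qed

text \<open>Modulo 9 the equation gives b mod 6 = 5, then modulo 7 it gives a mod 6 = 0, and modulo
  4 it becomes 1 = 3. The solution 5 = 3 + 2 is excluded by a \<ge> 2, which makes the modulus 9
  available.\<close>

lemma pow5_neq_pow3_plus_2: "a \<ge> 2 \<Longrightarrow> (5::int) ^ b \<noteq> 3 ^ a + 2"
proof
  assume a: "a \<ge> 2" and e: "(5::int) ^ b = 3 ^ a + 2"
  obtain d where "a = 2 + d" using le_Suc_ex[OF a] by auto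
  then have "(3::int) ^ a = 9 * 3 ^ d" by (simp add: power_add)
  then have "(5::int) ^ b mod 9 = 2" using e by simp
  moreover have "(5::int) ^ 6 mod 9 = 1" by simp
  ultimately have b1: "(5::int) ^ (b mod 6) mod 9 = 2" by (metis power_mod_period)
  have "b mod 6 \<in> {0,1,2,3,4,5}" by (simp, presburger)
  then have b: "b mod 6 = 5" using b1 by auto
  have "(5::int) ^ 6 mod 7 = 1" "(3::int) ^ 6 mod 7 = 1" "(3::int) ^ 2 mod 4 = 1" "(5::int) ^ 1 mod 4 = 1" by simp_all
  from this[THEN power_mod_period] have m: "(5::int) ^ b mod 7 = 5 ^ (b mod 6) mod 7" "(3::int) ^ a mod 7 = 3 ^ (a mod 6) mod 7"
    "(3::int) ^ a mod 4 = 3 ^ (a mod 2) mod 4" "(5::int) ^ b mod 4 = 5 ^ (b mod 1) mod 4" by blast+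
  have "(5::int) ^ b mod 7 = 3" using m(1) b by simp
  then have "(3 ^ a + 2) mod 7 = (3::int)" using e by simp
  then have "(3::int) ^ a mod 7 = 1" by presburger
  moreover have "a mod 6 \<in> {0,1,2,3,4,5}" by (simp, presburger)
  ultimately have a6: "a mod 6 = 0" using m(2) by auto
  then have "a mod 2 = 0" by presburger
  then have "(3::int) ^ a mod 4 = 1" using m(3) by simp
  moreover have "(5::int) ^ b mod 4 = 1" using m(4) by simp
  ultimately show False using e by presburger
qed

text \<open>Neighbouring odd numbers share no prime, so one of them is a power of 3 and the other a
  power of 5; the two exponential equations leave only 25 and 27.\<close>

lemma primes_3_5:
  fixes x :: nat
  assumes x: "odd x" "x \<ge> 7" and d: "\<And>p. prime p \<Longrightarrow> p dvd x \<or> p dvd x + 2 \<Longrightarrow> p = 3 \<or> p = 5"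
  shows "x = 25"
proof (cases "3 dvd x")
  case True
  then have n3: "\<not> 3 dvd x + 2" by presburger
  note nd = this
  have "\<exists>b. x + 2 = 5 ^ b"
    by (rule power_of_only_prime) (use x in linarith, use d nd in blast)
  then obtain b where b: "x + 2 = 5 ^ b" by blast
  then have "b \<noteq> 0" using x by (intro notI) auto
  then have "5 dvd x + 2" unfolding b by simp
  then have "\<not> 5 dvd x" by presburger
  note nd = this
  have "\<exists>a. x = 3 ^ a"
    by (rule power_of_only_prime) (use x in linarith, use d x nd in blast)
  then obtain a where a: "x = 3 ^ a" by blast
  have "a \<ge> 2"
  proof (rule ccontr)
    assume "\<not> a \<ge> 2"
    then have "a = 0 \<or> a = 1" by auto
    then show False using a x by auto
  qed
  moreover have "(5::int) ^ b = 3 ^ a + 2" using arg_cong[OF b, of int] a by simp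
  ultimately show ?thesis using pow5_neq_pow3_plus_2 by blast
next
  case False
  note nd = this
  have "\<exists>b. x = 5 ^ b"
    by (rule power_of_only_prime) (use x in linarith, use d x nd in blast)
  then obtain b where b: "x = 5 ^ b" by blast
  then have "b \<noteq> 0" using x by (intro notI) auto
  then have "5 dvd x" unfolding b by simp
  then have "\<not> 5 dvd x + 2" by presburger
  note nd = this
  have "\<exists>a. x + 2 = 3 ^ a"
    by (rule power_of_only_prime) (use x in linarith, use d x nd in blast)
  then obtain a where a: "x + 2 = 3 ^ a" by blast
  then have "(3::int) ^ a = 5 ^ b + 2" using arg_cong[OF a, of int] b by simp
  then have "b \<le> 2" by (rule pow3_eq_pow5_plus_2)
  then have "b = 0 \<or> b = 1 \<or> b = 2" by auto
  then show ?thesis using b x by auto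
qed

text \<open>If 7 does not divide the middle number, two neighbours avoid it and must be 25 and 27,
  and the third number is the prime 23 or 29. Otherwise the middle number is a power of 7, which
  fails modulo 3 if 3 divides x, and modulo 25 if x is a power of 5.\<close>

lemma primes_3_5_7:
  fixes x :: nat
  assumes x: "odd x" "x \<ge> 9"
    and d: "\<And>p. prime p \<Longrightarrow> p dvd x \<or> p dvd x + 2 \<or> p dvd x + 4 \<Longrightarrow> p = 3 \<or> p = 5 \<or> p = 7"
  shows False
proof -
  have x4: "x + 2 + 2 = x + 4" by simp
  consider "\<not> 7 dvd x" "\<not> 7 dvd x + 2" | "\<not> 7 dvd x + 2" "\<not> 7 dvd x + 4" | "7 dvd x + 2"
  proof -
    have "7 dvd x \<Longrightarrow> \<not> 7 dvd x + 4" by presburger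
    then show ?thesis using that by blast
  qed
  then show False
  proof cases
    case 1
    then have "x = 25" using x d by (intro primes_3_5) auto
    moreover have "prime (29::nat)" by simp
    ultimately show False using d[of 29] by simp
  next
    case 2
    then have "x + 2 = 25" using x d unfolding x4[symmetric] by (intro primes_3_5) auto
    moreover have "prime (23::nat)" by simp
    ultimately show False using d[of 23] by simp
  next
    case 3
    then have n7: "\<not> 7 dvd x" "\<not> 7 dvd x + 4" by presburger+
    show False
    proof (cases "3 dvd x")
      case True
      then have "\<not> 3 dvd x + 4" "\<not> 3 dvd x + 2" by presburger+
      note nd = this
      have "\<exists>b. x + 4 = 5 ^ b"
        by (rule power_of_only_prime) (use x in linarith, use d n7 nd in blast)
      then obtain b where b: "x + 4 = 5 ^ b" by blast
      then have "b \<noteq> 0" using x by (intro notI) auto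
      then have "5 dvd x + 4" unfolding b by simp
      then have "\<not> 5 dvd x + 2" by presburger
      note nd = this
      have "\<exists>c. x + 2 = 7 ^ c"
        by (rule power_of_only_prime) (use x in linarith, use d \<open>\<not> 3 dvd x + 2\<close> nd in blast)
      then obtain c where c: "x + 2 = 7 ^ c" by blast
      have "(7::int) ^ 1 mod 3 = 1" by simp
      from power_mod_period[OF this, of c] have "(7::int) ^ c mod 3 = 1" by simp
      then have "int (x + 2) mod 3 = 1" using c by simp
      then show False using True by presburger
    next
      case False
      note nd = this
      have "\<exists>b. x = 5 ^ b"
        by (rule power_of_only_prime) (use x in linarith, use d x n7 nd in blast)
      then obtain b where b: "x = 5 ^ b" by blast
      have "b \<ge> 2"
      proof (rule ccontr)
        assume "\<not> b \<ge> 2"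
        then have "b = 0 \<or> b = 1" by auto
        then show False using b x by auto
      qed
      then obtain d where "b = 2 + d" using le_Suc_ex[of 2 b] by auto
      then have x25: "x = 25 * 5 ^ d" using b by (simp add: power_add)
      then have "\<not> 5 dvd x + 4" "\<not> 5 dvd x + 2" by presburger+
      note nd = this
      have "\<exists>a. x + 4 = 3 ^ a"
        by (rule power_of_only_prime) (use x in linarith, use d n7 nd in blast)
      then obtain a where "x + 4 = 3 ^ a" by blast
      then have "a \<noteq> 0" using x by (intro notI) auto
      then have "3 dvd x + 4" unfolding \<open>x + 4 = 3 ^ a\<close> by simp
      then have "\<not> 3 dvd x + 2" by presburger
      note nd = this
      have "\<exists>c. x + 2 = 7 ^ c"
        by (rule power_of_only_prime) (use x in linarith, use d \<open>\<not> 5 dvd x + 2\<close> nd in blast)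
      then obtain c where c: "x + 2 = 7 ^ c" by blast
      have "(7::int) ^ 4 mod 25 = 1" by simp
      from power_mod_period[OF this, of c] have "(7::int) ^ c mod 25 = 7 ^ (c mod 4) mod 25" .
      moreover have "c mod 4 \<in> {0,1,2,3}" by (simp, presburger)
      ultimately have "(7::int) ^ c mod 25 \<noteq> 2" by auto
      moreover have "(7::int) ^ c = 2 + 25 * 5 ^ d" using arg_cong[OF c, of int] x25 by simp
      ultimately show False by simp
    qed
  qed
qed

section \<open>Primes in windows of small odd numbers\<close>

lemma successively_bracket:
  fixes x :: "'a :: linorder"
  assumes "successively R ps" "ps \<noteq> []" "hd ps < x" "x \<le> last ps"
  shows "\<exists>q q'. R q q' \<and> q < x \<and> x \<le> q' \<and> q \<in> set ps \<and> q' \<in> set ps"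
  using assms
proof (induction ps rule: induct_list012)
  case (3 q q' ps)
  show ?case
  proof (cases "x \<le> q'")
    case True
    then show ?thesis using 3 by auto
  next
    case False
    then show ?thesis using 3 by fastforce
  qed
qed auto

definition trial_primes :: "int list" where
  "trial_primes = [2, 3, 5, 7, 11, 13, 17, 19, 23, 29, 31, 37, 41, 43, 47, 53, 59, 61, 67, 71, 73, 79, 83, 89, 97, 101, 103, 107, 109, 113, 127]"

lemma trial_primes_dvd: "2 \<le> d \<Longrightarrow> d \<le> 130 \<Longrightarrow> \<exists>q\<in>set trial_primes. 1 < q \<and> q dvd d"
proof -
  assume "2 \<le> d" "d \<le> 130"
  then have "d \<in> set [2..130]" by (simp only: set_upto atLeastAtMost_iff)
  moreover have "list_all (\<lambda>d. list_ex (\<lambda>q. 1 < q \<and> d mod q = 0) trial_primes) [2..130]" by code_simp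
  ultimately have "list_ex (\<lambda>q. 1 < q \<and> d mod q = 0) trial_primes" unfolding list_all_iff by blast
  then show ?thesis by (auto simp only: list_ex_iff mod_eq_0_iff_dvd)
qed

text \<open>17161 = 131^2, so a composite n has a divisor at most 130 and hence one in the
  list.\<close>

lemma prime_trial_division:
  fixes n :: int
  assumes n: "1 < n" "n < 17161" and t: "\<And>q. q \<in> set trial_primes \<Longrightarrow> n mod q \<noteq> 0 \<or> q = n"
  shows "prime n"
proof (rule ccontr)
  assume "\<not> prime n"
  then obtain d where d: "d dvd n" "1 < d" "d < n" using n
  proof -
    obtain m where m: "m dvd n" "0 \<le> m" "m \<noteq> 1" "m \<noteq> n"
      using \<open>\<not> prime n\<close> n unfolding prime_int_iff by blast
    then have "m \<noteq> 0" "m \<le> n" using n by (auto intro: zdvd_imp_le)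
    then show ?thesis using that[of m] m by auto
  qed
  then obtain e where e: "n = d * e" by (elim dvdE)
  have no: False if "2 \<le> x" "x \<le> 130" "x dvd n" "x < n" for x
  proof -
    obtain q where q: "q \<in> set trial_primes" "1 < q" "q dvd x" using trial_primes_dvd \<open>2 \<le> x\<close> \<open>x \<le> 130\<close> by blast
    have "q \<le> x" using q that by (intro zdvd_imp_le) auto
    moreover have "n mod q = 0" using q that by (metis dvd_trans mod_eq_0_iff_dvd)
    ultimately show False using t[OF q(1)] that by auto
  qed
  show False
  proof (cases "d \<le> 130")
    case True
    then show ?thesis using no[of d] d by auto
  next
    case False
    have "e \<le> 130"
    proof (rule ccontr)
      assume "\<not> e \<le> 130"
      then have "131 * 131 \<le> d * e" using False by (intro mult_mono) auto
      then show False using n e by simp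
    qed
    moreover have "e > 1"
    proof (rule ccontr)
      assume "\<not> e > 1"
      then have "d * e \<le> d * 1" using d by (intro mult_left_mono) auto
      then show False using e d by simp
    qed
    moreover from this have "e < n" using e d by simp
    ultimately show ?thesis using no[of e] e by auto
  qed
qed

text \<open>Consecutive entries \<open>q < q'\<close> satisfy \<open>q' - q \<le> 52\<close> or \<open>q' - q \<le> 4 sqrt(q + 2)\<close>, so that \<open>k \<ge> 26\<close> consecutive
  odd numbers starting at some \<open>x < k\<^sup>2 / 4\<close> include an entry.\<close>

definition prime_chain :: "int list" where
  "prime_chain = [53, 103, 151, 199, 251, 313, 383, 461, 547, 631, 727, 829, 941, 1063, 1193, 1327, 1471, 1621,
     1777, 1933, 2099, 2281, 2467, 2663, 2861, 3067, 3271, 3499, 3733, 3967, 4219, 4463, 4729, 5003, 5281, 5569,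
     5867, 6173, 6481, 6803, 7129, 7459, 7793, 8123, 8467, 8831, 9203, 9551, 9941, 10337, 10739, 11149, 11551,
     11971, 12401, 12841, 13291, 13751, 14207, 14683, 15161, 15649, 16141, 16649]"

lemma prime_chain: "q \<in> set prime_chain \<Longrightarrow> prime q"
proof -
  assume q: "q \<in> set prime_chain"
  have "list_all (\<lambda>n. 1 < n \<and> n < 17161 \<and> list_all (\<lambda>q. n mod q \<noteq> 0 \<or> q = n) trial_primes) prime_chain"
    by code_simp
  then have "1 < q \<and> q < 17161 \<and> (\<forall>d\<in>set trial_primes. q mod d \<noteq> 0 \<or> d = q)"
    unfolding list_all_iff by (rule bspec[OF _ q])
  then show ?thesis by (auto intro!: prime_trial_division)
qed

lemma prime_in_window:
  fixes x k :: nat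
  assumes x: "odd x" "53 < x" "x \<le> 16649" and k: "26 \<le> k" "4 * x < k ^ 2"
  shows "\<exists>p. prime p \<and> x \<le> p \<and> p \<le> x + 2 * (k - 1)"
proof -
  define R :: "int \<Rightarrow> int \<Rightarrow> bool" where "R q q' \<longleftrightarrow> odd q \<and> odd q' \<and> (q' - q \<le> 52 \<or> (q' - q) ^ 2 \<le> 16 * (q + 2))" for q q'
  have "successively (\<lambda>q q'. odd q \<and> odd q' \<and> (q' - q \<le> 52 \<or> (q' - q) ^ 2 \<le> 16 * (q + 2))) prime_chain"
    unfolding prime_chain_def by simp
  then have "successively R prime_chain" unfolding R_def .
  then obtain q q' where q: "R q q'" "q < int x" "int x \<le> q'" "q' \<in> set prime_chain"
  proof -
    have "prime_chain \<noteq> []" "hd prime_chain = 53" "last prime_chain = 16649"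
      by (simp_all add: prime_chain_def)
    then show ?thesis using \<open>successively R prime_chain\<close> successively_bracket[of R prime_chain "int x"] x that by auto
  qed
  have "odd q" "odd (int x)" using q(1) x by (auto simp: R_def)
  then have q2: "q + 2 \<le> int x" using q(2) by presburger
  have "q' - q \<le> 2 * int k"
  proof (rule ccontr)
    assume "\<not> q' - q \<le> 2 * int k"
    then have "q' - q > 52" and g: "q' - q \<ge> 2 * int k" using k by auto
    then have "(q' - q) ^ 2 \<le> 16 * (q + 2)" using q(1) by (auto simp: R_def)
    also have "\<dots> \<le> 16 * int x" using q2 by simp
    also have "\<dots> < 4 * (int k) ^ 2" using k(2) by (simp flip: of_nat_less_iff[where 'a = int])
    also have "\<dots> = (2 * int k) ^ 2" by (simp add: power_mult_distrib)
    also have "\<dots> \<le> (q' - q) ^ 2" using g by (intro power_mono) auto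
    finally show False by simp
  qed
  then have b: "q' \<le> int x + 2 * (int k - 1)" using q q2 by auto
  have "0 \<le> q'" using q(3) by linarith
  then obtain p where p: "q' = int p" by (rule nonneg_int_cases)
  have "prime (int p)" using q(4) prime_chain unfolding p by blast
  then have "prime p" by simp
  moreover have "x \<le> p" using q(3) unfolding p by simp
  moreover have "int (p + 2) \<le> int (x + 2 * k)" using b unfolding p by simp
  then have "p + 2 \<le> x + 2 * k" by (simp only: of_nat_le_iff)
  then have "p \<le> x + 2 * (k - 1)" using k by simp
  ultimately show ?thesis by blast
qed

text \<open>From 7 to 113 the gaps between primes are at most 8, so four consecutive odd numbers
  suffice; the gap after 113 is 14.\<close>

lemma small_prime_in_window:
  fixes x :: nat
  assumes x: "odd x" "7 < x" "x \<le> 113"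
  shows "\<exists>p. prime p \<and> x \<le> p \<and> p \<le> x + 6"
proof -
  define ps where "ps = [7, 11, 13, 17, 19, 23, 29, 31, 37, 41, 43, 47, 53, 59, 61, 67, 71, 73, 79, 83, 89, 97, 101,
    103, 107, 109, 113 :: nat]"
  have "successively (\<lambda>q q'. odd q \<and> q' \<le> q + 8) ps" "ps \<noteq> []" "hd ps = 7" "last ps = 113"
    by (simp_all add: ps_def)
  then obtain q q' where q: "odd q" "q' \<le> q + 8" "q < x" "x \<le> q'" "q' \<in> set ps"
    using successively_bracket[of "\<lambda>q q'. odd q \<and> q' \<le> q + 8" ps x] x by auto
  have "\<forall>p\<in>set ps. prime p" by (simp add: ps_def)
  then have "prime q'" using q by blast
  moreover have "q + 2 \<le> x" using q x by presburger
  ultimately show ?thesis using q by (intro exI[of _ q']) auto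
qed


section \<open>Large prime factors of consecutive odd numbers\<close>

text \<open>A counterexample to Schur's theorem, up to the size condition 2k + 3 \<le> x; it is
  excluded range by range.\<close>

definition smooth_window :: "nat \<Rightarrow> nat \<Rightarrow> bool" where
  "smooth_window x k \<longleftrightarrow> odd x \<and> k \<ge> 1 \<and> (\<forall>p i. prime p \<longrightarrow> i < k \<longrightarrow> p dvd x + 2 * i \<longrightarrow> p \<le> 2 * k + 1)"

text \<open>\<open>w\<close> is the odd part of (k - 1)!. The product is odd, so the power of 2 in
  the factorial can be discarded, which saves a factor of at least 2^(k - 1) / k.\<close>

lemma smooth_window_le:
  assumes "smooth_window x k"
  shows "\<exists>w e. 2 ^ (k - 1) * w \<le> fact k \<and> (\<forall>p\<in>odd_primes (2 * k + 1). p ^ e p \<le> x + 2 * (k - 1)) \<and>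
    (\<Prod>i<k. x + 2 * i) \<le> w * (\<Prod>p\<in>odd_primes (2 * k + 1). p ^ e p)"
proof -
  have x: "odd x" and k: "k \<ge> 1" using assms by (auto simp: smooth_window_def)
  have "p \<in> odd_primes (2 * k + 1)" if "prime p" "i < k" "p dvd x + 2 * i" for p i
  proof -
    have "odd p"
    proof
      assume "even p"
      then have "even (x + 2 * i)" using that(3) by (rule dvd_trans)
      then show False using x by simp
    qed
    then show ?thesis using that assms by (auto simp: odd_primes_def smooth_window_def)
  qed
  then obtain e where e: "\<And>p. p \<in> odd_primes (2 * k + 1) \<Longrightarrow> p ^ e p \<le> x + 2 * (k - 1)"
    and d: "(\<Prod>i<k. x + 2 * i) dvd fact (k - 1) * (\<Prod>p\<in>odd_primes (2 * k + 1). p ^ e p)"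
  proof -
    have "prime p" if "p \<in> odd_primes (2 * k + 1)" for p using that by (simp add: odd_primes_def)
    from prod_odds_dvd[OF x k finite_odd_primes this] that
    show ?thesis using \<open>\<And>p i. prime p \<Longrightarrow> i < k \<Longrightarrow> p dvd x + 2 * i \<Longrightarrow> p \<in> odd_primes (2 * k + 1)\<close> by blast
  qed
  obtain v w :: nat where vw: "fact (k - 1) = 2 ^ v * w" "odd w" "2 ^ (k - 1) \<le> (k - 1 + 1) * 2 ^ v"
    using fact_two_power_decomp by blast
  have "odd (\<Prod>i<k. x + 2 * i)" using x by (induction k) auto
  then have "coprime (\<Prod>i<k. x + 2 * i) (2 ^ v)" by simp
  moreover have "(\<Prod>i<k. x + 2 * i) dvd 2 ^ v * (w * (\<Prod>p\<in>odd_primes (2 * k + 1). p ^ e p))"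
    using d vw by (simp add: mult.assoc)
  ultimately have "(\<Prod>i<k. x + 2 * i) dvd w * (\<Prod>p\<in>odd_primes (2 * k + 1). p ^ e p)"
    by (simp add: coprime_dvd_mult_right_iff)
  moreover have "w * (\<Prod>p\<in>odd_primes (2 * k + 1). p ^ e p) > 0"
    using vw(2) by (auto simp: odd_primes_def intro!: Nat.gr0I)
  ultimately have "(\<Prod>i<k. x + 2 * i) \<le> w * (\<Prod>p\<in>odd_primes (2 * k + 1). p ^ e p)" by (rule dvd_imp_le)
  moreover have "2 ^ (k - 1) * w \<le> fact k"
  proof -
    have "2 ^ (k - 1) * w \<le> k * 2 ^ v * w" using vw(3) k by (intro mult_le_mono) auto
    also have "\<dots> = k * fact (k - 1)" unfolding vw(1) by simp
    also have "\<dots> = fact k" using k by (simp add: fact_reduce)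
    finally show ?thesis .
  qed
  ultimately show ?thesis using e by blast
qed

lemma prod_odds_square_ge:
  "(x * (x + 2 * (k - 1))) ^ k \<le> (\<Prod>i<k. x + 2 * i :: nat) ^ 2"
proof -
  have "(\<Prod>i<k. x + 2 * i) = (\<Prod>i<k. x + 2 * (k - Suc i))"
    by (rule prod.nat_diff_reindex[symmetric])
  then have "(\<Prod>i<k. x + 2 * i) ^ 2 = (\<Prod>i<k. (x + 2 * i) * (x + 2 * (k - Suc i)))"
    by (simp add: power2_eq_square prod.distrib)
  also have "\<dots> \<ge> (\<Prod>i<k. x * (x + 2 * (k - 1)))"
  proof (intro prod_mono conjI)
    fix i assume i: "i \<in> {..<k}"
    define j where "j = k - Suc i"
    have "k - 1 = i + j" using i by (simp add: j_def)
    then show "x * (x + 2 * (k - 1)) \<le> (x + 2 * i) * (x + 2 * (k - Suc i))"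
      unfolding j_def[symmetric] by (simp add: algebra_simps)
  qed auto
  finally show ?thesis by simp
qed

text \<open>Every prime is charged the largest number N. Squaring turns the bound on twice the
  number of primes into the exponent k + c of N, and pairing first and last numbers bounds the
  squared product below by x^k N^k, so N^k cancels.\<close>

lemma smooth_window_power_le:
  assumes s: "smooth_window x k" and c: "2 * card (odd_primes (2 * k + 1)) \<le> k + c"
  shows "4 ^ (k - 1) * x ^ k \<le> (fact k) ^ 2 * (x + 2 * (k - 1)) ^ c"
proof -
  let ?N = "x + 2 * (k - 1)"
  have x: "x > 0" using s by (cases x) (auto simp: smooth_window_def)
  obtain w e where w: "2 ^ (k - 1) * w \<le> fact k" and e: "\<And>p. p \<in> odd_primes (2 * k + 1) \<Longrightarrow> p ^ e p \<le> ?N"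
    and P: "(\<Prod>i<k. x + 2 * i) \<le> w * (\<Prod>p\<in>odd_primes (2 * k + 1). p ^ e p)"
    using smooth_window_le[OF s] by blast
  have "(\<Prod>p\<in>odd_primes (2 * k + 1). p ^ e p) \<le> (\<Prod>p\<in>odd_primes (2 * k + 1). ?N)"
    using e by (intro prod_mono) auto
  then have "(\<Prod>i<k. x + 2 * i) \<le> w * ?N ^ card (odd_primes (2 * k + 1))"
    using P by (simp add: order_trans[OF _ mult_le_mono2])
  then have "(\<Prod>i<k. x + 2 * i) ^ 2 \<le> (w * ?N ^ card (odd_primes (2 * k + 1))) ^ 2" by (rule power_mono) simp
  also have "\<dots> = w ^ 2 * ?N ^ (2 * card (odd_primes (2 * k + 1)))"
    by (simp add: power_mult_distrib power_even_eq)
  also have "\<dots> \<le> w ^ 2 * ?N ^ (k + c)" using c x by (intro mult_le_mono2 power_increasing) auto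
  finally have "(x * ?N) ^ k \<le> w ^ 2 * ?N ^ (k + c)"
    using prod_odds_square_ge[of x k] by (rule order_trans[rotated])
  then have "?N ^ k * x ^ k \<le> ?N ^ k * (w ^ 2 * ?N ^ c)"
    by (simp add: power_mult_distrib power_add mult_ac)
  then have "x ^ k \<le> w ^ 2 * ?N ^ c" using x by (subst (asm) mult_le_cancel1) auto
  then have "4 ^ (k - 1) * x ^ k \<le> 4 ^ (k - 1) * (w ^ 2 * ?N ^ c)" by (rule mult_le_mono2)
  also have "\<dots> = (2 ^ (k - 1) * w) ^ 2 * ?N ^ c"
  proof -
    have "(4::nat) ^ (k - 1) = (2 ^ (k - 1)) ^ 2"
      by (metis power2_eq_square power_mult_distrib mult_2 numeral_Bit0 one_add_one mult_2_right)
    then show ?thesis by (simp only: power_mult_distrib mult.assoc)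
  qed
  also have "\<dots> \<le> (fact k) ^ 2 * ?N ^ c" using w by (intro mult_le_mono1 power_mono) auto
  finally show ?thesis .
qed

text \<open>As N is at most (D / C) x, the powers x^c and N^c cancel up to a constant, and a bound
  on x^k remains; it suffices to refute it at the least admissible value X.\<close>

lemma power_scale_contradiction:
  fixes x N A B C D k c :: nat
  assumes le: "A * x ^ (k + c) \<le> B * N ^ c" and N: "C * N \<le> D * x" and x: "X \<le> x" "0 < X" "0 < C"
    and gt: "B * D ^ c < A * C ^ c * X ^ k"
  shows False
proof -
  have "A * C ^ c * X ^ k * x ^ c \<le> A * C ^ c * x ^ k * x ^ c"
    using x by (intro mult_le_mono power_mono) auto
  also have "\<dots> = C ^ c * (A * x ^ (k + c))" by (simp add: power_add mult_ac)
  also have "\<dots> \<le> C ^ c * (B * N ^ c)" using le by (rule mult_le_mono2)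
  also have "\<dots> = B * (C * N) ^ c" by (simp add: power_mult_distrib mult_ac)
  also have "\<dots> \<le> B * (D * x) ^ c" using N by (intro mult_le_mono2 power_mono) auto
  also have "\<dots> = B * D ^ c * x ^ c" by (simp add: power_mult_distrib mult_ac)
  finally show False using gt x by (subst (asm) mult_le_cancel2) auto
qed

lemma odd_primes_small: "odd_primes 9 = {3, 5, 7}" "odd_primes 11 = {3, 5, 7, 11}"
proof -
  have "p \<in> odd_primes 11 \<longleftrightarrow> p \<in> {3, 5, 7, 11}" for p
  proof
    assume a: "p \<in> odd_primes 11"
    then have "odd p" "p \<le> 11" by (simp_all add: odd_primes_def)
    then have "p \<in> {1,3,5,7,9,11}" unfolding insert_iff empty_iff by presburger
    then show "p \<in> {3, 5, 7, 11}" using a by (auto simp: odd_primes_def)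
  qed (auto simp: odd_primes_def)
  then show b: "odd_primes 11 = {3, 5, 7, 11}" by blast
  have "odd_primes 9 = odd_primes 11 - {11}"
  proof -
    have "p \<le> 9 \<longleftrightarrow> p \<le> 11 \<and> p \<noteq> 11" if "odd p" for p :: nat using that by presburger
    then show ?thesis unfolding odd_primes_def by blast
  qed
  also have "odd_primes 11 - {11} = {3, 5, 7}"
    unfolding b by (simp add: insert_Diff_if)
  finally show "odd_primes 9 = {3, 5, 7}" .
qed

lemma not_smooth_small_k:
  assumes s: "smooth_window x k" and k: "4 \<le> k" "k \<le> 25" and x: "2 * k + 3 \<le> x"
  shows False
proof (cases "x \<le> 113")
  case True
  have "odd x" using s by (simp add: smooth_window_def)
  then obtain p where p: "prime p" "x \<le> p" "p \<le> x + 6" using small_prime_in_window[of x] x k True by auto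
  define i where "i = (p - x) div 2"
  have "odd p" using p x k prime_odd_nat[of p] by simp
  then have "p = x + 2 * i" using \<open>odd x\<close> p unfolding i_def by presburger
  moreover from this have "i < k" using p k by simp
  ultimately have "p \<le> 2 * k + 1" using s p unfolding smooth_window_def by (metis dvd_refl)
  then show False using p x by simp
next
  case False
  then have x115: "115 \<le> x" using s by (auto simp: smooth_window_def elim!: oddE)
  have N: "115 * (x + 2 * (k - 1)) \<le> (113 + 2 * k) * x"
  proof -
    obtain j where j: "k = Suc j" using k by (cases k) auto
    obtain y where "x = 115 + y" using le_Suc_ex[OF x115] by blast
    then show ?thesis unfolding j by (simp add: algebra_simps)
  qed
  have key: "\<not> (fact k) ^ 2 * (113 + 2 * k) ^ c < 4 ^ (k - 1) * 115 ^ c * 115 ^ (k - c)"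
    if c: "2 * card (odd_primes (2 * k + 1)) \<le> k + c" "c \<le> k" for c
  proof
    assume a: "(fact k) ^ 2 * (113 + 2 * k) ^ c < 4 ^ (k - 1) * 115 ^ c * 115 ^ (k - c)"
    have "4 ^ (k - 1) * x ^ (k - c + c) \<le> (fact k) ^ 2 * (x + 2 * (k - 1)) ^ c"
      using smooth_window_power_le[OF s c(1)] c(2) by simp
    from power_scale_contradiction[OF this N x115 _ _ a] show False by simp
  qed
  \<comment> \<open>For k = 4, 5, 6 the general c = 5 is too weak. The exact counts give 2 and 3,
    and for k = 6 parity improves 5 to 4.\<close>
  consider "k = 4" | "k = 5" | "k = 6" | "7 \<le> k" using k by linarith
  then show False
  proof cases
    case 1
    have "2 * card (odd_primes (2 * 4 + 1)) \<le> 4 + (2::nat)" by (simp add: odd_primes_small)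
    from key[unfolded 1, OF this] show False by (simp add: fact_numeral)
  next
    case 2
    have "2 * card (odd_primes (2 * 5 + 1)) \<le> 5 + (3::nat)" by (simp add: odd_primes_small)
    from key[unfolded 2, OF this] show False by (simp add: fact_numeral)
  next
    case 3
    have "2 * card (odd_primes (2 * 6 + 1)) \<le> 6 + (4::nat)" using card_odd_primes_le[of 6] by simp
    from key[unfolded 3, OF this] show False by (simp add: fact_numeral)
  next
    case 4
    have "k \<in> {7, 8, 9, 10, 11, 12, 13, 14, 15, 16, 17, 18, 19, 20, 21, 22, 23, 24, 25}"
      using 4 k(2) unfolding insert_iff empty_iff by presburger
    then have "(fact k) ^ 2 * (113 + 2 * k) ^ 5 < (4 ^ (k - 1) * 115 ^ 5 * 115 ^ (k - 5) :: nat)"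
      by (elim insertE emptyE) (simp_all add: fact_numeral)
    then show False using key[OF card_odd_primes_le] 4 by simp
  qed
qed

lemma fact_times_power_less: "k \<ge> 26 \<Longrightarrow> fact k * k ^ 5 < 8 * k ^ k"
proof (induction k rule: dec_induct)
  case base
  show ?case by (simp add: fact_numeral)
next
  case (step k)
  have k0: "k > 0" using step by simp
  have "k ^ k * Suc k ^ 5 = k ^ 5 * (k ^ (k - 5) * Suc k ^ 5)"
    using step by (simp add: mult.assoc[symmetric] flip: power_add)
  also have "\<dots> \<le> k ^ 5 * (Suc k ^ (k - 5) * Suc k ^ 5)" by (intro mult_le_mono power_mono) auto
  also have "\<dots> = k ^ 5 * Suc k ^ k" using step by (simp del: power_Suc flip: power_add)
  finally have a: "k ^ k * Suc k ^ 5 \<le> k ^ 5 * Suc k ^ k" .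
  have "k ^ 5 * (fact (Suc k) * Suc k ^ 5) = (fact k * k ^ 5) * (Suc k * Suc k ^ 5)" by (simp only: fact_Suc of_nat_id mult_ac)
  also have "\<dots> < (8 * k ^ k) * (Suc k * Suc k ^ 5)" using step by (intro mult_strict_right_mono) auto
  also have "\<dots> = 8 * Suc k * (k ^ k * Suc k ^ 5)" by (simp only: mult_ac)
  also have "\<dots> \<le> 8 * Suc k * (k ^ 5 * Suc k ^ k)" using a by (intro mult_le_mono2)
  also have "\<dots> = k ^ 5 * (8 * Suc k ^ Suc k)" by (simp only: power_Suc mult_ac)
  finally show ?case using k0 by (subst (asm) mult_less_cancel1) auto
qed

lemma not_smooth_large_x:
  assumes s: "smooth_window x k" and k: "26 \<le> k" and x: "k ^ 2 \<le> 4 * x"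
  shows False
proof -
  have "4 ^ (k - 1) * x ^ (k - 5 + 5) \<le> (fact k) ^ 2 * (x + 2 * (k - 1)) ^ 5"
    using smooth_window_power_le[OF s card_odd_primes_le] k by simp
  then have "(4 ^ 5 * 4 ^ (k - 5)) * (4 ^ (k - 1) * x ^ (k - 5 + 5)) \<le> (4 ^ 5 * 4 ^ (k - 5)) * ((fact k) ^ 2 * (x + 2 * (k - 1)) ^ 5)"
    by (rule mult_le_mono2)
  then have le: "4 ^ (k - 1) * (4 * x) ^ (k - 5 + 5) \<le> ((fact k) ^ 2 * 4 ^ (k - 5)) * (4 * (x + 2 * (k - 1))) ^ 5"
    by (simp only: power_mult_distrib power_add mult_ac)
  \<comment> \<open>Since 26 k \<le> k^2 \<le> 4x, the increment 8k is at most (8/26) 4x, and 34 =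
    26 + 8.\<close>
  have N: "26 * (4 * (x + 2 * (k - 1))) \<le> 34 * (4 * x)"
  proof -
    have "26 * k \<le> k ^ 2" using k by (simp add: power2_eq_square)
    then show ?thesis using x k by simp
  qed
  have f: "fact k * k ^ 5 < 8 * k ^ k" using fact_times_power_less[OF k] .
  have k5: "k ^ k = k ^ 5 * k ^ (k - 5)" using k by (simp flip: power_add)
  have f2: "fact k < 8 * k ^ (k - 5)"
  proof -
    have "k ^ 5 * fact k < k ^ 5 * (8 * k ^ (k - 5))" using f unfolding k5 by (simp only: mult_ac)
    then show ?thesis using k by (subst (asm) mult_less_cancel1) auto
  qed
  have "(fact k) ^ 2 * 4 ^ (k - 5) * 34 ^ 5 < (8 * k ^ (k - 5)) ^ 2 * 4 ^ (k - 5) * 34 ^ 5"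
    using f2 by (intro mult_strict_right_mono power_strict_mono) auto
  also have "\<dots> = (64 * 34 ^ 5) * 4 ^ (k - 5) * (k ^ 2) ^ (k - 5)"
    by (simp add: power_mult_distrib flip: power_mult add: mult.commute)
  also have "\<dots> \<le> (4 ^ 4 * 26 ^ 5) * 4 ^ (k - 5) * (k ^ 2) ^ (k - 5)" by (intro mult_le_mono1) simp
  also have "\<dots> = (4 ^ 4 * 4 ^ (k - 5)) * 26 ^ 5 * (k ^ 2) ^ (k - 5)" by (simp only: mult_ac)
  also have "4 ^ 4 * 4 ^ (k - 5) = (4 ^ (k - 1) :: nat)"
    using k by (subst power_add[symmetric]) (rule arg_cong[where f = "\<lambda>n. 4 ^ n"], simp)
  finally have gt: "(fact k) ^ 2 * 4 ^ (k - 5) * 34 ^ 5 < 4 ^ (k - 1) * 26 ^ 5 * (k ^ 2) ^ (k - 5)" .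
  show False by (rule power_scale_contradiction[OF le N x _ _ gt]) (use k in auto)
qed

section \<open>Logarithmic estimates for windows with k at least 256\<close>

lemma ln_chord:
  fixes \<nu> V :: real
  assumes "1 \<le> \<nu>" "\<nu> \<le> V" "1 < V"
  shows "(\<nu> - 1) * ln V \<le> (V - 1) * ln \<nu>"
proof -
  define t where "t = (\<nu> - 1) / (V - 1)"
  have t: "0 \<le> t" "t \<le> 1" using assms by (auto simp: t_def field_simps)
  have "(1 - t) *\<^sub>R 1 + t *\<^sub>R V = 1 + t * (V - 1)" by (simp add: algebra_simps)
  also have "\<dots> = \<nu>" using assms by (simp add: t_def)
  finally have "(1 - t) * ln 1 + t * ln V \<le> ln \<nu>"
    using concave_onD[OF ln_concave t, of 1 V] assms by simp
  then show ?thesis using assms by (simp add: t_def field_simps)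
qed

lemma ln2_bounds: "ln 2 \<le> (7 / 10 :: real)" "(6 / 10 :: real) \<le> ln 2"
proof -
  have "(2 :: real) \<le> (1 + 7/40 + (7/40)\<^sup>2 / 2) ^ 4" by (simp add: power2_eq_square power4_eq_xxxx)
  also have "\<dots> \<le> exp (7/40) ^ 4" by (intro power_mono exp_lower_Taylor_quadratic) auto
  also have "\<dots> = exp (7/10)" by (simp flip: exp_of_nat_mult)
  finally show "ln 2 \<le> (7 / 10 :: real)" using ln_le_cancel_iff[of 2 "exp (7/10 :: real)"] by simp
next
  have "exp (6/10) = exp (3/10 :: real) ^ 2" by (simp flip: exp_of_nat_mult)
  also have "\<dots> \<le> (1 + 3/10 + (3/10)\<^sup>2) ^ 2" by (intro power_mono exp_bound) auto
  also have "\<dots> \<le> 2" by (simp add: power2_eq_square)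
  finally show "(6 / 10 :: real) \<le> ln 2" using ln_ge_iff[of 2 "6/10 :: real"] by simp
qed

lemma ln_ratio_bound: "(32 / 100 :: real) \<le> ln (16 / (17 / 5) ^ 2)"
proof -
  have "exp (32/100) = exp (2/100 :: real) ^ 16" by (simp flip: exp_of_nat_mult)
  also have "\<dots> \<le> (1 + 2/100 + (2/100)\<^sup>2) ^ 16" by (intro power_mono exp_bound) auto
  also have "\<dots> \<le> 16 / (17 / 5) ^ 2" by (simp add: power_divide power2_eq_square)
  finally show ?thesis using ln_ge_iff[of "16 / (17 / 5) ^ 2 :: real" "32/100"] by simp
qed

text \<open>Used with \<open>y\<^sup>2 = k\<close> and \<open>4 k \<nu>\<^sup>2 = N - 1\<close> for the largest number \<open>N\<close>; the right-hand side is concave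
  in \<open>\<nu>\<close> and is bounded below by a chord.\<close>

lemma growth_inequality:
  fixes y \<nu> :: real
  assumes y: "16 \<le> y" and \<nu>: "1 \<le> \<nu>" "\<nu> \<le> 254 / 1000 * y"
  shows "ln (34 / 5) + 2 * ln y + (50025 / 100000 * y * \<nu> + 5 / 2) * (34 / 100 + 2 * ln y + 2 * ln \<nu>)
    < y ^ 2 * (32 / 100 + 2 * ln \<nu>)"
proof -
  define t where "t = ln \<nu>"
  define l where "l = ln y"
  define L where "L = 34 / 100 + 2 * l"
  have t0: "0 \<le> t" using \<nu> by (simp add: t_def)
  have ln16: "ln 16 = 4 * ln (2::real)" using ln_realpow[of 2 4] by simp
  have l16: "24 / 10 \<le> l"
  proof -
    have "ln 16 \<le> l" using y unfolding l_def by simp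
    then show ?thesis using ln16 ln2_bounds by linarith
  qed
  have L0: "0 \<le> L" using l16 by (simp add: L_def)
  have lup: "l \<le> 28 / 10 + (y / 16 - 1)"
  proof -
    have "l = ln 16 + ln (y / 16)" using y unfolding l_def by (simp add: ln_div)
    moreover have "ln (y / 16) \<le> y / 16 - 1" using y by (intro ln_le_minus_one) auto
    ultimately show ?thesis using ln16 ln2_bounds by linarith
  qed
  then have Lup: "L \<le> 394 / 100 + y / 8" by (simp add: L_def)
  have c: "ln (34 / 5 :: real) \<le> 21 / 10"
  proof -
    have "ln (34 / 5) \<le> ln (8 :: real)" by simp
    also have "ln (8 :: real) = 3 * ln 2" using ln_realpow[of 2 3] by simp
    finally show ?thesis using ln2_bounds by linarith
  qed
  define V where "V = 254 / 1000 * y"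
  have V: "4 \<le> V" "\<nu> \<le> V" using y \<nu> by (auto simp: V_def)
  have lnV: "l - 14 / 10 \<le> ln V"
  proof -
    have "ln (y / 4) \<le> ln V" using y unfolding V_def by simp
    moreover have "ln (y / 4) = l - 2 * ln 2" using y ln_realpow[of 2 2] unfolding l_def by (simp add: ln_div)
    ultimately show ?thesis using ln2_bounds by linarith
  qed
  have chord: "(\<nu> - 1) * ln V \<le> V * t"
  proof -
    have "(\<nu> - 1) * ln V \<le> (V - 1) * t" unfolding t_def using V \<nu> by (intro ln_chord) auto
    also have "\<dots> \<le> V * t" using t0 by (intro mult_right_mono) auto
    finally show ?thesis .
  qed
  \<comment> \<open>Of the 2 y^2 t on the right, 1.726 y^2 t pays for the terms with \<nu> - 1, by
    the chord of ln from 1 to V, and 0.274 y^2 t for the terms with t. The constant 0.1271 is 0.254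
    * 0.50025 rounded up.\<close>
  have main: "50025 / 100000 * y * (\<nu> - 1) * L \<le> 1726 / 1000 * y ^ 2 * t"
  proof -
    have "1271 / 10000 * L \<le> 1726 / 1000 * ln V" using lnV l16 by (simp add: L_def)
    then have "(\<nu> - 1) * (1271 / 10000 * L) \<le> (\<nu> - 1) * (1726 / 1000 * ln V)"
      using \<nu> by (intro mult_left_mono) auto
    also have "\<dots> = 1726 / 1000 * ((\<nu> - 1) * ln V)" by simp
    also have "\<dots> \<le> 1726 / 1000 * (V * t)" using chord by (intro mult_left_mono) auto
    also have "\<dots> = 254 / 1000 * (1726 / 1000 * y * t)" by (simp add: V_def)
    finally have "1271 / 10000 * ((\<nu> - 1) * L) \<le> 254 / 1000 * (1726 / 1000 * (y * t))"
      by (simp only: mult_ac)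
    moreover have "0 \<le> (\<nu> - 1) * L" "0 \<le> y * t" using \<nu> L0 t0 y by (auto intro: mult_nonneg_nonneg)
    ultimately have "50025 / 100000 * ((\<nu> - 1) * L) \<le> 1726 / 1000 * (y * t)" by linarith
    then have "50025 / 100000 * (\<nu> - 1) * L \<le> 1726 / 1000 * y * t" by (simp only: mult.assoc)
    then have "y * (50025 / 100000 * (\<nu> - 1) * L) \<le> y * (1726 / 1000 * y * t)"
      using y by (intro mult_left_mono) auto
    then show ?thesis by (simp add: power2_eq_square mult_ac)
  qed
  have tt: "(10005 / 10000 * y * \<nu> + 5) * t \<le> 274 / 1000 * y ^ 2 * t"
  proof (intro mult_right_mono t0)
    have "y * \<nu> \<le> y * (254 / 1000 * y)" using \<nu> y by (intro mult_left_mono) auto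
    then have "10005 / 10000 * y * \<nu> \<le> 2542 / 10000 * y ^ 2" using y by (simp add: power2_eq_square)
    moreover have "(16::real) ^ 2 \<le> y ^ 2" using y by (intro power_mono) auto
    ultimately show "10005 / 10000 * y * \<nu> + 5 \<le> 274 / 1000 * y ^ 2" by simp
  qed
  \<comment> \<open>This is the value at \<nu> = 1, where t = 0. It becomes quadratic in y when ln y
    is replaced by its tangent at 16.\<close>
  have base: "21 / 10 + 2 * l + (50025 / 100000 * y + 5 / 2) * L < 32 / 100 * y ^ 2"
  proof -
    have "21 / 10 + 2 * l + (50025 / 100000 * y + 5 / 2) * L = 176 / 100 + (50025 / 100000 * y + 7 / 2) * L"
      by (simp add: L_def algebra_simps)
    also have "\<dots> \<le> 176 / 100 + (50025 / 100000 * y + 7 / 2) * (394 / 100 + y / 8)"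
      using Lup y by (intro add_left_mono mult_left_mono) auto
    also have "\<dots> < 32 / 100 * y ^ 2"
    proof -
      obtain z where z: "y = 16 + z" "0 \<le> z" using y by (metis add.commute diff_add_cancel diff_ge_0_iff_ge)
      have "32 / 100 * (16 + z) ^ 2 - (176 / 100 + (50025 / 100000 * (16 + z) + 7 / 2) * (394 / 100 + (16 + z) / 8))
        = 1182624 / 100000 + 5830515 / 1000000 * z + 25746875 / 100000000 * z ^ 2"
        by (simp add: field_simps power2_eq_square)
      moreover have "0 \<le> 5830515 / 1000000 * z + 25746875 / 100000000 * z ^ 2" using z(2) by simp
      ultimately show ?thesis unfolding z(1) by linarith
    qed
    finally show ?thesis .
  qed
  have "ln (34 / 5) + 2 * l + (50025 / 100000 * y * \<nu> + 5 / 2) * (L + 2 * t)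
     = ln (34 / 5) + 2 * l + (50025 / 100000 * y + 5 / 2) * L + 50025 / 100000 * y * (\<nu> - 1) * L
       + (10005 / 10000 * y * \<nu> + 5) * t" by (simp add: field_simps)
  also have "\<dots> < 32 / 100 * y ^ 2 + 1726 / 1000 * y ^ 2 * t + 274 / 1000 * y ^ 2 * t"
    using base main tt c by linarith
  also have "\<dots> = y ^ 2 * (32 / 100 + 2 * t)" by (simp add: algebra_simps)
  finally show ?thesis unfolding t_def l_def L_def by (simp add: add.assoc)
qed

lemma prod_odd_primes: "2 * \<Prod>(odd_primes (2 * k + 1)) = primorial (2 * k + 1)" if "k \<ge> 1"
proof -
  have "p = 2" if "prime p" "even p" for p :: nat using that primes_dvd_imp_eq two_is_prime_nat by blast
  then have "{p. prime p \<and> p \<le> 2 * k + 1} = insert 2 (odd_primes (2 * k + 1))"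
    using that by (auto simp: odd_primes_def)
  then show ?thesis by (simp add: primorial_def odd_primes_def)
qed

text \<open>A prime above sqrt N has exponent at most 1 and costs only p, as in the primorial. A
  smaller one costs at most N \<le> p * (N / 3), because p \<ge> 3; c counts these. The division by
  2 removes the even prime.\<close>

lemma prod_prime_powers_le:
  fixes N k :: nat
  assumes e: "\<And>p. p \<in> odd_primes (2 * k + 1) \<Longrightarrow> p ^ e p \<le> N" and N: "N \<ge> 3" and k: "k \<ge> 1"
  shows "\<exists>c. real c \<le> (sqrt (real N) + 10) / 4 \<and>
    real (\<Prod>p\<in>odd_primes (2 * k + 1). p ^ e p) \<le> (17 / 5) ^ (2 * k + 1) / 2 * (real N / 3) ^ c"
proof (intro exI conjI)
  let ?O = "odd_primes (2 * k + 1)"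
  define A where "A = {p \<in> ?O. p ^ 2 \<le> N}"
  define s where "s = nat \<lfloor>sqrt (real N)\<rfloor>"
  have s: "real s \<le> sqrt (real N)" unfolding s_def by simp
  have "A \<subseteq> odd_primes (2 * (s div 2) + 1)"
  proof
    fix p assume p: "p \<in> A"
    then have "real (p ^ 2) \<le> real N" unfolding A_def by (simp only: of_nat_le_iff) auto
    then have "real p \<le> sqrt (real N)" by (intro real_le_rsqrt) simp
    then have "p \<le> s" unfolding s_def by (simp add: le_nat_floor)
    then have "p \<le> 2 * (s div 2) + 1" by linarith
    then show "p \<in> odd_primes (2 * (s div 2) + 1)" using p by (auto simp: A_def odd_primes_def)
  qed
  then have "card A \<le> card (odd_primes (2 * (s div 2) + 1))" by (intro card_mono) auto
  then have "2 * card A \<le> s div 2 + 5" using card_odd_primes_le[of "s div 2"] by linarith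
  then have "4 * card A \<le> s + 10" by linarith
  then have "real (4 * card A) \<le> real (s + 10)" by (simp only: of_nat_le_iff)
  then show "real (card A) \<le> (sqrt (real N) + 10) / 4" using s by simp
  have pw: "real (p ^ e p) \<le> real p * (if p \<in> A then real N / 3 else 1)" if p: "p \<in> ?O" for p
  proof (cases "p \<in> A")
    case True
    have "p \<ge> 2" "odd p" using p by (auto simp: odd_primes_def prime_ge_2_nat)
    then have "p \<ge> 3" by presburger
    then have "3 * real N \<le> real p * real N" by (intro mult_right_mono) auto
    moreover have "real (p ^ e p) \<le> real N" using e[OF p] by (simp only: of_nat_le_iff)
    ultimately have "real (p ^ e p) \<le> real p * real N / 3" by linarith
    then show ?thesis using True by (simp only: if_True times_divide_eq_right)
  next
    case False
    then have "N < p ^ 2" using p by (simp add: A_def)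
    then have lt: "p ^ e p < p ^ 2" using e[OF p] by simp
    have "prime p" using p by (simp add: odd_primes_def)
    then have "p > 1" by (rule prime_gt_1_nat)
    then have "e p < 2" by (rule power_less_imp_less_exp[OF _ lt])
    then have "p ^ e p \<le> p ^ 1" using \<open>p > 1\<close> by (intro power_increasing) auto
    then have "real (p ^ e p) \<le> real p" by (simp only: power_one_right of_nat_le_iff)
    then show ?thesis using False by simp
  qed
  have "real (\<Prod>p\<in>?O. p ^ e p) = (\<Prod>p\<in>?O. real (p ^ e p))" by (rule of_nat_prod)
  also have "\<dots> \<le> (\<Prod>p\<in>?O. real p * (if p \<in> A then real N / 3 else 1))"
    using pw by (intro prod_mono) auto
  also have "\<dots> = (\<Prod>p\<in>?O. real p) * (\<Prod>p\<in>?O. if p \<in> A then real N / 3 else 1)" by (rule prod.distrib)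
  also have "(\<Prod>p\<in>?O. if p \<in> A then real N / 3 else 1) = (real N / 3) ^ card A"
  proof -
    have "?O \<inter> A = A" by (auto simp: A_def)
    then show ?thesis by (subst prod.inter_restrict[symmetric]) auto
  qed
  also have "(\<Prod>p\<in>?O. real p) = real (primorial (2 * k + 1)) / 2"
    using prod_odd_primes[OF k] by (simp flip: of_nat_prod)
  also have "real (primorial (2 * k + 1)) / 2 * (real N / 3) ^ card A \<le> (17 / 5) ^ (2 * k + 1) / 2 * (real N / 3) ^ card A"
    using primorial_le[of "2 * k + 1"] by (intro mult_right_mono divide_right_mono) auto
  finally show "real (\<Prod>p\<in>?O. p ^ e p) \<le> (17 / 5) ^ (2 * k + 1) / 2 * (real N / 3) ^ card A" .
qed

text \<open>The numbers are compared with 2 \<mu> times k + 1, ..., 2k, whose product is k! times a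
  central binomial coefficient. Here 4 k \<mu> is one less than the largest number; with this 1
  subtracted, 2k + 3 \<le> x makes the quotient of corresponding terms smallest at the last
  one.\<close>

lemma prod_odds_ge:
  fixes x k :: nat
  assumes x: "2 * k + 3 \<le> x" and k: "k \<ge> 1"
  defines "\<mu> \<equiv> (real x + 2 * real k - 3) / (4 * real k)"
  shows "8 ^ k * \<mu> ^ k * fact k / (2 * real k) \<le> real (\<Prod>i<k. x + 2 * i)"
proof -
  have k0: "real k > 0" using k by simp
  have mu0: "0 \<le> \<mu>" using x unfolding \<mu>_def by simp
  have "8 ^ k * \<mu> ^ k * fact k / (2 * real k) = (2 * \<mu>) ^ k * fact k * (4 ^ k / (2 * real k))"
    by (simp add: power_mult_distrib flip: power_mult_distrib[of 2 4])
  also have "\<dots> \<le> (2 * \<mu>) ^ k * fact k * real ((2 * k) choose k)"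
    using mu0 k by (intro mult_left_mono central_binomial_lower_bound) auto
  also have "\<dots> = (2 * \<mu>) ^ k * (\<Prod>i<k. real k + 1 + real i)"
  proof -
    have "fact k * fact (2 * k - k) * ((2 * k) choose k) = (fact (2 * k) :: nat)" by (intro binomial_fact_lemma) simp
    moreover have "(fact (2 * k) :: nat) = fact k * \<Prod>{Suc k..2 * k}" by (subst fact_eq_fact_times[of k "2 * k"]) auto
    moreover have "\<Prod>{Suc k..2 * k} = (\<Prod>i<k. k + 1 + i)"
      by (rule prod.reindex_bij_witness[of _ "\<lambda>i. k + 1 + i" "\<lambda>i. i - k - 1"]) auto
    ultimately have "fact k * ((2 * k) choose k) = (\<Prod>i<k. k + 1 + i)" by simp
    then have "real (fact k * ((2 * k) choose k)) = real (\<Prod>i<k. k + 1 + i)" by (rule arg_cong)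
    then have "fact k * real ((2 * k) choose k) = (\<Prod>i<k. real k + 1 + real i)" by (simp add: add_ac)
    then show ?thesis by (simp only: mult.assoc)
  qed
  also have "\<dots> = (\<Prod>i<k. 2 * \<mu> * (real k + 1 + real i))" by (simp add: prod.distrib)
  also have "\<dots> \<le> (\<Prod>i<k. real (x + 2 * i))"
  proof (intro prod_mono conjI)
    fix i assume "i \<in> {..<k}"
    then have i: "real i + 1 \<le> real k" by simp
    show "0 \<le> 2 * \<mu> * (real k + 1 + real i)" using mu0 by simp
    have "0 \<le> (real k - 1 - real i) * (real x - 2 * real k - 3)"
      using i x by (intro mult_nonneg_nonneg) auto
    then have "(real k + 1 + real i) * (real x + 2 * real k - 3) \<le> 2 * real k * (real x - 1 + 2 * real i)"
      by (simp add: algebra_simps)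
    also have "\<dots> \<le> 2 * real k * (real x + 2 * real i)" by (intro mult_left_mono) auto
    finally show "2 * \<mu> * (real k + 1 + real i) \<le> real (x + 2 * i)"
      using k0 unfolding \<mu>_def by (simp add: field_simps)
  qed
  also have "\<dots> = real (\<Prod>i<k. x + 2 * i)" by (rule of_nat_prod[symmetric])
  finally show ?thesis .
qed

lemma not_smooth_medium_x:
  assumes s: "smooth_window x k" and k: "256 \<le> k" and x: "2 * k + 3 \<le> x" "4 * x < k ^ 2"
  shows False
proof -
  have k1: "k \<ge> 1" using k by simp
  define N where "N = x + 2 * (k - 1)"
  define \<mu> where "\<mu> = (real x + 2 * real k - 3) / (4 * real k)"
  define y where "y = sqrt (real k)"
  define \<nu> where "\<nu> = sqrt \<mu>"
  have kk: "real k \<ge> 256" using k by simp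
  have y2: "y ^ 2 = real k" by (simp add: y_def)
  have y16: "y \<ge> 16" unfolding y_def using kk by (intro real_le_rsqrt) simp
  have mu1: "\<mu> \<ge> 1" using x(1) kk unfolding \<mu>_def by (simp add: field_simps)
  have nu2: "\<nu> ^ 2 = \<mu>" using mu1 by (simp add: \<nu>_def)
  have nu1: "\<nu> \<ge> 1" unfolding \<nu>_def using mu1 by (intro real_le_rsqrt) simp
  have RN: "real N = 4 * real k * \<mu> + 1" using kk k1 unfolding N_def \<mu>_def by (simp add: of_nat_diff)
  \<comment> \<open>From 4x < k^2 and k \<ge> 256, \<mu> is below k/16 + 1/2 \<le> (1/16 + 1/512) k,
    and 0.254^2 is slightly larger than this factor.\<close>
  have nuy: "\<nu> \<le> 254 / 1000 * y"
  proof -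
    have "real (4 * x) \<le> real (k ^ 2)" using x(2) by (simp only: of_nat_le_iff)
    then have "4 * real x \<le> real k * real k" by (simp add: power2_eq_square)
    moreover have "256 * real k \<le> real k * real k" using kk by (intro mult_right_mono) auto
    ultimately have "real x + 2 * real k - 3 \<le> (254 / 1000) ^ 2 * 4 * (real k * real k)"
      by (simp add: power2_eq_square)
    then have "\<mu> \<le> (254 / 1000) ^ 2 * real k" using kk unfolding \<mu>_def by (simp add: field_simps)
    then have "\<nu> ^ 2 \<le> (254 / 1000 * y) ^ 2" unfolding nu2 power_mult_distrib y2 .
    then show ?thesis by (rule power2_le_imp_le) (use y16 in simp)
  qed
  obtain w e where w: "2 ^ (k - 1) * w \<le> fact k" and e: "\<And>p. p \<in> odd_primes (2 * k + 1) \<Longrightarrow> p ^ e p \<le> N"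
    and P: "(\<Prod>i<k. x + 2 * i) \<le> w * (\<Prod>p\<in>odd_primes (2 * k + 1). p ^ e p)"
    using smooth_window_le[OF s] unfolding N_def by blast
  have N3: "N \<ge> 3" using x by (simp add: N_def)
  obtain c where c: "real c \<le> (sqrt (real N) + 10) / 4"
    and \<Pi>: "real (\<Prod>p\<in>odd_primes (2 * k + 1). p ^ e p) \<le> (17 / 5) ^ (2 * k + 1) / 2 * (real N / 3) ^ c"
    using prod_prime_powers_le[OF e N3 k1] by blast
  let ?Q = "(17 / 5) ^ (2 * k + 1) / 2 * (real N / 3) ^ c"
  have "2 ^ (k - 1) * (8 ^ k * \<mu> ^ k * fact k / (2 * real k)) \<le> 2 ^ (k - 1) * real (w * (\<Prod>p\<in>odd_primes (2 * k + 1). p ^ e p))"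
    using order_trans[OF prod_odds_ge[OF x(1) k1] of_nat_mono[OF P]] unfolding \<mu>_def by (rule mult_left_mono) simp
  also have "\<dots> = real (2 ^ (k - 1) * w) * real (\<Prod>p\<in>odd_primes (2 * k + 1). p ^ e p)" by simp
  also have "\<dots> \<le> real (fact k) * ?Q" 
  proof (rule mult_mono)
    show "real (2 ^ (k - 1) * w) \<le> real (fact k)" using w by (simp only: of_nat_le_iff)
    show "real (\<Prod>p\<in>odd_primes (2 * k + 1). p ^ e p) \<le> ?Q" by (rule \<Pi>)
    show "0 \<le> real (\<Prod>p\<in>odd_primes (2 * k + 1). p ^ e p)" by (rule of_nat_0_le_iff)
  qed simp
  finally have "fact k * (2 ^ (k - 1) * (8 ^ k * \<mu> ^ k / (2 * real k))) \<le> fact k * ?Q" by (simp add: mult_ac)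
  then have "2 ^ (k - 1) * (8 ^ k * \<mu> ^ k / (2 * real k)) \<le> ?Q" by (subst (asm) mult_le_cancel_left_pos) auto
  then have "2 ^ (k - 1) * 8 ^ k * \<mu> ^ k \<le> ?Q * (2 * real k)" using kk by (simp add: field_simps)
  then have "2 * (2 ^ (k - 1) * 8 ^ k * \<mu> ^ k) \<le> 2 * (?Q * (2 * real k))"
    by (rule mult_left_mono) simp
  also have "2 * (2 ^ (k - 1) * 8 ^ k * \<mu> ^ k) = 16 ^ k * \<mu> ^ k"
  proof -
    have "2 * (2 ^ (k - 1) * 8 ^ k * \<mu> ^ k) = 2 ^ Suc (k - 1) * 8 ^ k * \<mu> ^ k" by simp
    also have "Suc (k - 1) = k" using k1 by simp
    also have "2 ^ k * 8 ^ k = (2 * 8 :: real) ^ k" by (rule power_mult_distrib[symmetric])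
    also have "\<dots> = 16 ^ k" by simp
    finally show ?thesis .
  qed
  also have "2 * (?Q * (2 * real k)) = 34 / 5 * real k * ((17 / 5) ^ 2) ^ k * (real N / 3) ^ c"
  proof -
    have e: "(17 / 5 :: real) ^ (2 * k + 1) = 17 / 5 * ((17 / 5) ^ 2) ^ k"
      by (simp only: power_Suc power_mult flip: Suc_eq_plus1)
    have "2 * (17 / 5 * r / 2 * z * (2 * K)) = 34 / 5 * K * r * z" for r z K :: real by simp
    then show ?thesis unfolding e .
  qed
  finally have le: "16 ^ k * \<mu> ^ k \<le> 34 / 5 * real k * ((17 / 5) ^ 2) ^ k * (real N / 3) ^ c" .
  have N3': "real N / 3 \<ge> 1" using N3 by simp
  have "ln (16 ^ k * \<mu> ^ k) \<le> ln (34 / 5 * real k * ((17 / 5) ^ 2) ^ k * (real N / 3) ^ c)"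
    using le mu1 kk N3' by (subst ln_le_cancel_iff) auto
  moreover have "ln (16 ^ k * \<mu> ^ k) = real k * ln 16 + real k * ln \<mu>"
    using mu1 by (simp add: ln_mult ln_realpow)
  moreover have "ln (34 / 5 * real k * ((17 / 5) ^ 2) ^ k * (real N / 3) ^ c)
     = ln (34 / 5) + ln (real k) + real k * ln ((17 / 5) ^ 2) + real c * ln (real N / 3)"
  proof -
    have "ln (a * K * r ^ k * z ^ c) = ln a + ln K + real k * ln r + real c * ln z"
      if "0 < a" "0 < K" "0 < r" "0 < z" for a K r z :: real
      using that by (simp add: ln_mult ln_realpow)
    moreover have "0 < (34 / 5 :: real)" "0 < real k" "0 < ((17 / 5) ^ 2 :: real)" "0 < real N / 3" using kk N3' by simp_all
    ultimately show ?thesis by blast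
  qed
  ultimately have "real k * ln 16 + real k * ln \<mu>
     \<le> ln (34 / 5) + ln (real k) + real k * ln ((17 / 5) ^ 2) + real c * ln (real N / 3)" by simp
  moreover have "ln (a / b) = ln a - ln b" if "0 < a" "0 < b" for a b :: real using that by (simp add: ln_div)
  then have "ln (16 / (17 / 5) ^ 2) = ln 16 - ln ((17 / 5) ^ 2 :: real)" by (metis zero_less_numeral zero_less_power zero_less_divide_iff)
  then have "real k * (32 / 100) \<le> real k * (ln 16 - ln ((17 / 5) ^ 2))"
    using ln_ratio_bound by (intro mult_left_mono) auto
  moreover have "ln (real k) = 2 * ln y" "ln \<mu> = 2 * ln \<nu>"
    using y16 nu1 by (simp_all flip: y2 nu2 add: ln_realpow)
  ultimately have A: "y ^ 2 * (32 / 100 + 2 * ln \<nu>) \<le> ln (34 / 5) + 2 * ln y + real c * ln (real N / 3)"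
    unfolding y2 by (simp add: algebra_simps)
  \<comment> \<open>N = 4 k \<mu> + 1 and k \<mu> \<ge> 256 give 4.004; its root is at most 2.001, a
    quarter of which is the 0.50025 in the bound on c.\<close>
  have Nle: "real N \<le> 4004 / 1000 * (y * \<nu>) ^ 2"
  proof -
    have "1 * 256 \<le> \<mu> * real k" using mu1 kk by (intro mult_mono) auto
    then show ?thesis unfolding RN power_mult_distrib y2 nu2 by (simp add: mult_ac)
  qed
  have yn: "y * \<nu> \<ge> 1" using y16 nu1 mult_mono[of 1 y 1 \<nu>] by simp
  have "real c \<le> 50025 / 100000 * y * \<nu> + 5 / 2"
  proof -
    have "real N \<le> (2001 / 1000 * (y * \<nu>)) ^ 2"
      using Nle by (simp add: power_mult_distrib power2_eq_square)
    then have "sqrt (real N) \<le> 2001 / 1000 * (y * \<nu>)" using yn by (intro real_le_lsqrt) auto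
    then show ?thesis using c by simp
  qed
  moreover have "ln (real N / 3) \<le> 34 / 100 + 2 * ln y + 2 * ln \<nu>"
  proof -
    have "real N / 3 \<le> 134 / 100 * (y * \<nu>) ^ 2" using Nle by simp
    then have "ln (real N / 3) \<le> ln (134 / 100 * (y * \<nu>) ^ 2)" using N3' yn by (subst ln_le_cancel_iff) auto
    also have "\<dots> = ln (134 / 100) + 2 * (ln y + ln \<nu>)"
    proof -
      have "ln (r * (s * t) ^ 2) = ln r + 2 * (ln s + ln t)" if "0 < r" "0 < s" "0 < t" for r s t :: real
        using that by (simp add: ln_mult ln_realpow)
      moreover have "(0 :: real) < 134 / 100" "0 < y" "0 < \<nu>" using y16 nu1 by simp_all
      ultimately show ?thesis by blast
    qed
    also have "ln (134 / 100 :: real) \<le> 134 / 100 - 1" by (rule ln_le_minus_one) simp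
    finally show ?thesis by simp
  qed
  ultimately have "real c * ln (real N / 3) \<le> (50025 / 100000 * y * \<nu> + 5 / 2) * (34 / 100 + 2 * ln y + 2 * ln \<nu>)"
    using N3' y16 nu1 by (intro mult_mono) auto
  with A growth_inequality[OF y16 nu1 nuy] show False by linarith
qed

lemma not_smooth_window:
  assumes s: "smooth_window x k" and x: "2 * k + 3 \<le> x"
    and e1: "\<not> (k = 1 \<and> (\<exists>u. x = 3 ^ u))" and e2: "\<not> (k = 2 \<and> x = 25)"
  shows False
proof -
  have ox: "odd x" and k1: "k \<ge> 1"
    and sm: "\<And>p i. prime p \<Longrightarrow> i < k \<Longrightarrow> p dvd x + 2 * i \<Longrightarrow> p \<le> 2 * k + 1"
    using s by (auto simp: smooth_window_def)
  have op: "odd p" if "p dvd x + 2 * i" for p i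
  proof
    assume "even p"
    then have "even (x + 2 * i)" using that by (rule dvd_trans)
    then show False using ox by simp
  qed
  have o1: "\<not> prime (1 :: nat)" by simp
  consider "k = 1" | "k = 2" | "k = 3" | "4 \<le> k" "k \<le> 25" | "26 \<le> k" "k ^ 2 \<le> 4 * x"
    | "26 \<le> k" "k < 256" "4 * x < k ^ 2" | "256 \<le> k" "4 * x < k ^ 2" using k1 by linarith
  then show False
  proof cases
    case 1
    have "p = 3" if p: "prime p" "p dvd x" for p
    proof -
      have "p \<le> 3" "odd p" using sm[of p 0] op[of p 0] p 1 by auto
      then have "p = 1 \<or> p = 3" by presburger
      then show ?thesis using p o1 by blast
    qed
    then have "\<exists>u. x = 3 ^ u" using x by (intro power_of_only_prime) auto
    then show False using e1 1 by blast
  next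
    case 2
    have "p = 3 \<or> p = 5" if p: "prime p" "p dvd x \<or> p dvd x + 2" for p
    proof -
      have "p \<le> 5" "odd p" using sm[of p 0] sm[of p 1] op[of p 0] op[of p 1] p 2 by auto
      then have "p = 1 \<or> p = 3 \<or> p = 5" by presburger
      then show ?thesis using p o1 by blast
    qed
    then have "x = 25" using x 2 ox by (intro primes_3_5) auto
    then show False using e2 2 by blast
  next
    case 3
    have "p = 3 \<or> p = 5 \<or> p = 7" if p: "prime p" "p dvd x \<or> p dvd x + 2 \<or> p dvd x + 4" for p
    proof -
      have "p \<le> 7" "odd p" using sm[of p 0] sm[of p 1] sm[of p 2] op[of p 0] op[of p 1] op[of p 2] p 3 by auto
      then have "p = 1 \<or> p = 3 \<or> p = 5 \<or> p = 7" by presburger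
      then show ?thesis using p o1 by blast
    qed
    then show False using x 3 ox by (intro primes_3_5_7[of x]) auto
  next
    case 4
    then show False using not_smooth_small_k[OF s _ _ x] by blast
  next
    case 5
    then show False using not_smooth_large_x[OF s] by blast
  next
    case 6
    have "k ^ 2 \<le> 256 ^ 2" using 6 by (intro power_mono) auto
    then have "x \<le> 16649" using 6 by simp
    then obtain p where p: "prime p" "x \<le> p" "p \<le> x + 2 * (k - 1)"
      using prime_in_window[of x k] 6 x ox by auto
    define i where "i = (p - x) div 2"
    have "odd p" using p x prime_odd_nat[of p] 6 by simp
    then have i: "p = x + 2 * i" using ox p unfolding i_def by presburger
    moreover have "i < k" using p k1 unfolding i by simp
    ultimately have "p \<le> 2 * k + 1" using sm[of p i] p by simp
    then show False using p x by simp
  next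
    case 7
    then show False using not_smooth_medium_x[OF s _ x] by blast
  qed
qed

text \<open>Schur's analogue of Sylvester's theorem; powers of \<open>3\<close> and \<open>25 * 27\<close> are genuine exceptions.\<close>

lemma consecutive_odd_prime_factor:
  fixes x k :: nat
  assumes "odd x" "k \<ge> 1" "2 * k + 3 \<le> x"
    and "\<not> (k = 1 \<and> (\<exists>u. x = 3 ^ u))" "\<not> (k = 2 \<and> x = 25)"
  shows "\<exists>p i. prime p \<and> i < k \<and> p dvd x + 2 * i \<and> 2 * k + 1 < p"
  using not_smooth_window[of x k] assms unfolding smooth_window_def by (meson not_le)

text \<open>Asking only for p > 2k removes the exceptions: 3 > 2, and 5 > 4 divides 25. If x is 2k -
  1 or 2k + 1, the sharp theorem is applied to the k - 1 numbers from 2k + 1 on; it gives p > 2k -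
  1, and p is odd.\<close>

lemma consecutive_odd_prime_factor_weak:
  fixes x k :: nat
  assumes x: "odd x" and k: "k \<ge> 1" and xk: "2 * k \<le> x + 1" "3 \<le> x + 2 * (k - 1)"
  shows "\<exists>p i. prime p \<and> i < k \<and> p dvd x + 2 * i \<and> 2 * k < p"
proof -
  have odd_dvd: "odd p" if "p dvd x + 2 * i" for p i
  proof
    assume "even p"
    then have "even (x + 2 * i)" using that by (rule dvd_trans)
    then show False using x by simp
  qed
  consider "k = 1" | "k \<ge> 2" "2 * k + 3 \<le> x" | "k \<ge> 2" "x = 2 * k + 1 \<or> x + 1 = 2 * k"
  proof -
    have "2 * k + 3 \<le> x \<or> x = 2 * k + 1 \<or> x + 1 = 2 * k" using x xk(1) by presburger
    then show ?thesis using that k by (cases "k = 1") auto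
  qed
  then show ?thesis
  proof cases
    case 1
    then obtain p where p: "prime p" "p dvd x" using xk prime_factor_nat[of x] by auto
    then have "odd p" using odd_dvd[of p 0] by simp
    moreover have "p \<noteq> 1" "p \<noteq> 0" using p by auto
    ultimately have "2 < p" by presburger
    then show ?thesis using p 1 by (intro exI[of _ p] exI[of _ 0]) auto
  next
    case 2
    show ?thesis
    proof (cases "k = 2 \<and> x = 25")
      case True
      then show ?thesis by (intro exI[of _ 5] exI[of _ 0]) auto
    next
      case False
      then obtain p i where "prime p" "i < k" "p dvd x + 2 * i" "2 * k + 1 < p"
        using consecutive_odd_prime_factor[OF x k 2(2)] 2(1) by auto
      then show ?thesis by (intro exI[of _ p] exI[of _ i]) auto
    qed
  next
    case 3
    define d where "d = (2 * k + 1 - x) div 2"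
    have d: "2 * k + 1 = x + 2 * d" "d \<le> 1" using 3 unfolding d_def by presburger+
    have "\<not> (k - 1 = 1 \<and> (\<exists>u. 2 * k + 1 = 3 ^ u))"
    proof
      assume a: "k - 1 = 1 \<and> (\<exists>u. 2 * k + 1 = 3 ^ u)"
      then have "k - 1 = 1" by blast
      then have "k = 2" by arith
      with a obtain u where "5 = (3::nat) ^ u" by auto
      moreover have "u = 0 \<or> u = 1 \<or> (3::nat) ^ 2 \<le> 3 ^ u" using power_increasing[of 2 u "3 :: nat"] by (cases "u \<ge> 2") auto
      ultimately show False by auto
    qed
    note exc = this
    have "odd (2 * k + 1)" "k - 1 \<ge> 1" "2 * (k - 1) + 3 \<le> 2 * k + 1" "\<not> (k - 1 = 2 \<and> 2 * k + 1 = 25)"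
      using 3(1) by (simp, arith+)
    from consecutive_odd_prime_factor[OF this(1-3) exc this(4)] obtain p i where p: "prime p" "i < k - 1" "p dvd (2 * k + 1) + 2 * i" "2 * (k - 1) + 1 < p"
      by blast
    have "p dvd x + 2 * (i + d)" using p(3) unfolding d(1) by (simp add: algebra_simps)
    moreover from this have "odd p" by (rule odd_dvd)
    then have "2 * k < p" using p(4) 3(1) by presburger
    moreover have "i + d < k" using p(2) d(2) by simp
    ultimately show ?thesis using p(1) by blast
  qed
qed


section \<open>The coefficients of \<open>H\<^sub>m\<close>\<close>

lemma multiplicity_fact_div:
  assumes p: "prime (p :: nat)"
  shows "multiplicity p (fact n :: nat) = n div p + multiplicity p (fact (n div p) :: nat)"
proof (induction n)
  case (Suc n)
  have p1: "p > 1" using p by (rule prime_gt_1_nat)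
  have m: "multiplicity p (fact (Suc j) :: nat) = multiplicity p (Suc j) + multiplicity p (fact j :: nat)" for j
    using p by (subst fact_Suc, subst of_nat_id, subst prime_elem_multiplicity_mult_distrib) auto
  show ?case
  proof (cases "p dvd Suc n")
    case True
    then obtain t where t: "Suc n = p * t" by (elim dvdE)
    then obtain s where s: "t = Suc s" by (cases t) auto
    have d1: "Suc n div p = Suc s" using t s p1 by simp
    have d2: "n div p = s"
    proof -
      have "n + 1 = p * s + p" using t unfolding s by simp
      then show ?thesis using p1 by (intro div_nat_eqI) auto
    qed
    have "multiplicity p (Suc n) = Suc (multiplicity p (Suc s))"
      unfolding t s using p1 p by (subst multiplicity_times_same) auto
    then show ?thesis unfolding m[of n] Suc.IH d1 d2 m[of s] by simp
  next
    case False
    then have "Suc n mod p \<noteq> 0" by (simp add: mod_eq_0_iff_dvd)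
    then have "Suc n div p = n div p" by (simp add: div_Suc)
    moreover have "multiplicity p (Suc n) = 0" using False by (rule not_dvd_imp_multiplicity_0)
    ultimately show ?thesis unfolding m[of n] Suc.IH by simp
  qed
qed simp

text \<open>In Legendre's formula the left side is n minus the base-p digit sum of n, which is
  positive. The induction passes from n! to (n div p)!.\<close>

lemma multiplicity_fact_less:
  assumes p: "prime (p :: nat)" and n: "n \<ge> 1"
  shows "multiplicity p (fact n :: nat) * (p - 1) < n"
  using n
proof (induction n rule: less_induct)
  case (less n)
  have p1: "p > 1" using p by (rule prime_gt_1_nat)
  define q where "q = n div p"
  have v: "multiplicity p (fact n :: nat) = q + multiplicity p (fact q :: nat)"
    unfolding q_def by (rule multiplicity_fact_div[OF p])
  show ?case
  proof (cases "q = 0")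
    case True
    then show ?thesis using v less.prems by simp
  next
    case False
    have "q < n" unfolding q_def using p1 less.prems by simp
    then have "multiplicity p (fact q :: nat) * (p - 1) < q" using False by (intro less.IH) auto
    then have "(q + multiplicity p (fact q :: nat)) * (p - 1) < q * (p - 1) + q" by (simp add: add_mult_distrib)
    also have "\<dots> = q * p" using p1 by (cases p) auto
    also have "\<dots> \<le> n" unfolding q_def by (rule div_times_less_eq_dividend)
    finally show ?thesis unfolding v .
  qed
qed

text \<open>With \<open>d = m mod 2\<close> and \<open>n = m div 2\<close>, \<open>odd_product d i\<close> is the paper's \<open>u\<^bsub>2i\<^esub>\<close> for even \<open>m\<close> and
  \<open>u\<^bsub>2i+2\<^esub>\<close> for odd \<open>m\<close>, and \<open>digit_weight d n i\<close> is the factor of \<open>a\<^sub>i(x)\<close> in \<open>H\<^sub>m\<close>.\<close>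

definition odd_product :: "nat \<Rightarrow> nat \<Rightarrow> nat" where
  "odd_product d i = (\<Prod>l<i. 2 * l + 1 + 2 * d)"

definition digit_weight :: "nat \<Rightarrow> nat \<Rightarrow> nat \<Rightarrow> nat" where
  "digit_weight d n i = (n choose i) * (\<Prod>l\<in>{i..<n}. 2 * l + 1 + 2 * d)"

lemma odd_product_pos [simp]: "odd_product d i > 0"
  unfolding odd_product_def by (rule prod_pos) simp

lemma fact_odd_product: "d \<le> 1 \<Longrightarrow> fact (2 * i + d) = 2 ^ i * fact i * odd_product d i"
proof (induction i)
  case 0
  then show ?case by (cases d) (auto simp: odd_product_def)
next
  case (Suc i)
  have "2 * Suc i + d = Suc (Suc (2 * i + d))" by simp
  then have "fact (2 * Suc i + d) = (2 * i + d + 2) * ((2 * i + d + 1) * fact (2 * i + d))"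
    by (simp only: fact_Suc of_nat_id add_2_eq_Suc' Suc_eq_plus1[symmetric])
  also have "\<dots> = ((2 * i + d + 2) * (2 * i + d + 1)) * (2 ^ i * fact i * odd_product d i)"
    unfolding Suc.IH[OF Suc.prems] by (simp only: mult.assoc)
  also have "(2 * i + d + 2) * (2 * i + d + 1) = 2 * Suc i * (2 * i + 1 + 2 * d)"
    using Suc.prems by (cases d) (auto simp: algebra_simps)
  finally show ?case by (simp add: odd_product_def algebra_simps)
qed

lemma u_odd_product: "u (2 * j) = int (odd_product 0 j)"
proof (induction j)
  case 0
  have "{k :: nat. k \<le> 2 * 0 \<and> odd k} = {}" using odd_pos by auto
  then have "u (2 * 0) = 1" unfolding u_def by (simp only: prod.empty)
  then show ?case by (simp add: odd_product_def)
next
  case (Suc j)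
  have "k \<le> 2 * Suc j \<and> odd k \<longleftrightarrow> k = 2 * j + 1 \<or> k \<le> 2 * j \<and> odd k" for k by presburger
  then have "{k. k \<le> 2 * Suc j \<and> odd k} = insert (2 * j + 1) {k. k \<le> 2 * j \<and> odd k}" by blast
  moreover have "finite {k. k \<le> 2 * j \<and> odd k}" by (rule finite_subset[of _ "{..2 * j}"]) auto
  ultimately have "u (2 * Suc j) = int (2 * j + 1) * u (2 * j)" by (simp add: u_def)
  then show ?case using Suc by (simp add: odd_product_def algebra_simps)
qed

lemma digit_weight_times_odd_product:
  assumes "i \<le> n"
  shows "digit_weight d n i * odd_product d i = (n choose i) * odd_product d n"
proof -
  have "odd_product d n = odd_product d i * (\<Prod>l\<in>{i..<n}. 2 * l + 1 + 2 * d)"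
    unfolding odd_product_def lessThan_atLeast0
    by (rule prod.atLeastLessThan_concat[symmetric]) (use assms in simp_all)
  then show ?thesis by (simp add: digit_weight_def)
qed

text \<open>Each factorial (2t + d)! splits into 2^t t! and a product of odd numbers; the powers of
  2 cancel, and the factorials leave n choose i.\<close>

lemma binomial_times_u:
  assumes d: "d \<le> 1" and i: "i \<le> n"
  shows "int ((2 * n + d) choose (2 * (n - i))) * u (2 * (n - i)) = int (digit_weight d n i)"
proof -
  define j where "j = n - i"
  have n: "n = i + j" using i by (simp add: j_def)
  have e: "2 * n + d - 2 * j = 2 * i + d" using n by simp
  have f0: "fact (2 * j) = 2 ^ j * fact j * odd_product 0 j" using fact_odd_product[of 0 j] by simp
  have "fact (2 * j) * fact (2 * i + d) * ((2 * n + d) choose (2 * j)) = fact (2 * n + d)"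
    using binomial_fact_lemma[of "2 * j" "2 * n + d"] n e by simp
  then have "(2 ^ n * (fact i * fact j)) * (((2 * n + d) choose (2 * j)) * odd_product 0 j * odd_product d i)
     = 2 ^ n * fact n * odd_product d n"
    unfolding f0 fact_odd_product[OF d] n power_add by (simp only: mult_ac)
  also have "fact n = fact i * fact j * (n choose i)"
    using binomial_fact_lemma[OF i] unfolding j_def by simp
  finally have "(2 ^ n * (fact i * fact j)) * (((2 * n + d) choose (2 * j)) * odd_product 0 j * odd_product d i)
     = (2 ^ n * (fact i * fact j)) * ((n choose i) * odd_product d n)" by (simp only: mult_ac)
  then have "((2 * n + d) choose (2 * j)) * odd_product 0 j * odd_product d i = (n choose i) * odd_product d n"
    by (subst (asm) mult_cancel1) auto
  also have "\<dots> = digit_weight d n i * odd_product d i" using digit_weight_times_odd_product[OF i] by simp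
  finally have "((2 * n + d) choose (2 * j)) * odd_product 0 j = digit_weight d n i"
    by (subst (asm) mult_cancel2) (use odd_product_pos[of d i] in linarith)
  then show ?thesis unfolding u_odd_product j_def[symmetric] by (simp flip: of_nat_mult)
qed

text \<open>The product divides (2i + d)!, so its valuation v satisfies v (p - 1) < 2i + d. For d =
  1 the surplus 1 is offset by the v on the left, unless v = 0; this is why p must exceed r +
  d.\<close>

lemma multiplicity_odd_product:
  assumes p: "prime p" "r + 1 + d \<le> p" and d: "d \<le> 1" and i: "i \<ge> 1"
  shows "r * multiplicity p (odd_product d i) < 2 * i"
proof -
  define v where "v = multiplicity p (odd_product d i)"
  have "odd_product d i dvd fact (2 * i + d)" unfolding fact_odd_product[OF d] by simp
  then have "v \<le> multiplicity p (fact (2 * i + d) :: nat)" unfolding v_def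
    by (intro dvd_imp_multiplicity_le) auto
  then have "v * (p - 1) \<le> multiplicity p (fact (2 * i + d) :: nat) * (p - 1)" by (rule mult_le_mono1)
  also have "\<dots> < 2 * i + d" using p i by (intro multiplicity_fact_less) auto
  finally have lt: "v * (p - 1) < 2 * i + d" .
  have "v * (r + d) \<le> v * (p - 1)" using p(2) by (intro mult_le_mono2) simp
  then have "v * r + v * d < 2 * i + d" using lt by (simp add: add_mult_distrib2)
  then have "v * r < 2 * i" using d i by (cases "v = 0"; cases d) auto
  then show ?thesis by (simp add: v_def mult.commute)
qed

text \<open>The window of the last s = (r + 1) div 2 odd numbers is the longest that
  \<open>2 * n \<le> 2 * l + r + 1\<close> allows.\<close>

lemma exists_suitable_prime:
  fixes n r d :: nat
  assumes d: "d \<le> 1" and m: "2 * n + d \<ge> 3" and r: "1 \<le> r" "r \<le> n"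
    and ex: "d = 1 \<Longrightarrow> \<forall>k\<ge>2. 2 * n + d \<noteq> 3 ^ k"
  shows "\<exists>p l. prime p \<and> r + 1 + d \<le> p \<and> p \<le> 2 * n + d \<and> l < n \<and> 2 * n \<le> 2 * l + r + 1 \<and> p dvd 2 * l + 1 + 2 * d"
proof -
  define s where "s = (r + 1) div 2"
  have s: "s \<ge> 1" "r \<le> 2 * s" "2 * s \<le> r + 1" "s \<le> n" using r unfolding s_def by presburger+
  define x where "x = 2 * (n - s) + 1 + 2 * d"
  have "odd x" by (simp add: x_def)
  have "\<exists>p i. prime p \<and> i < s \<and> p dvd x + 2 * i \<and> r + d < p"
  \<comment> \<open>The condition 2s \<le> n is the size condition of the sharp theorem. If it fails
    for d = 1, then r \<le> n < 2s forces 2s = r + 1, and p > 2s is already enough.\<close>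
  proof (cases "d = 1 \<and> 2 * s \<le> n")
    case True
    have "\<not> (s = 1 \<and> (\<exists>u. x = 3 ^ u))"
    proof
      assume a: "s = 1 \<and> (\<exists>u. x = 3 ^ u)"
      then have s1: "s = 1" by blast
      from a obtain u where u: "x = 3 ^ u" by blast
      have "x = 2 * n + d" "5 \<le> x" using True s1 by (auto simp: x_def)
      have "u \<ge> 2"
      proof (rule ccontr)
        assume "\<not> u \<ge> 2"
        then have "u = 0 \<or> u = 1" by arith
        then show False using u \<open>5 \<le> x\<close> by auto
      qed
      then show False using ex[THEN spec, THEN mp, of u] u \<open>x = 2 * n + d\<close> True by simp
    qed
    moreover have "\<not> (s = 2 \<and> x = 25)"
    proof
      assume "s = 2 \<and> x = 25"
      then have "s = 2" "x = 25" by blast+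
      then have "2 * (n - s) + 1 + 2 * d = 25" unfolding x_def by blast
      then have "2 * n + d = 27" using \<open>s = 2\<close> True s by arith
      then have "2 * n + d = 3 ^ 3" by simp
      moreover have "\<forall>k\<ge>2. 2 * n + d \<noteq> 3 ^ k" using ex True by blast
      moreover have "(2 :: nat) \<le> 3" by simp
      ultimately show False by blast
    qed
    moreover have "2 * s + 3 \<le> x" unfolding x_def using True s by arith
    ultimately obtain p i where "prime p" "i < s" "p dvd x + 2 * i" "2 * s + 1 < p"
      using consecutive_odd_prime_factor[OF \<open>odd x\<close> s(1)] by blast
    then show ?thesis using s d by (intro exI[of _ p] exI[of _ i]) auto
  next
    case False
    have "2 * s \<le> x + 1" using False s r d by (auto simp: x_def)
    moreover have "3 \<le> x + 2 * (s - 1)"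
    proof -
      obtain e where e: "n = s + e" using le_Suc_ex[OF s(4)] by blast
      obtain t where t: "s = Suc t" using s(1) by (cases s) auto
      have "3 \<le> 2 * (t + e) + 2 + d" using m unfolding e t by simp
      then have "1 \<le> t + e + d" by presburger
      then show ?thesis unfolding x_def e t by simp
    qed
    ultimately obtain p i where p: "prime p" "i < s" "p dvd x + 2 * i" "2 * s < p"
      using consecutive_odd_prime_factor_weak[OF \<open>odd x\<close> s(1)] by blast
    have "r + d < p"
    proof (cases "d = 0")
      case True
      then show ?thesis using p s by simp
    next
      case nz: False
      then have "d = 1" using d by simp
      then have "2 * s = r + 1" using False s r by simp
      then show ?thesis using p \<open>d = 1\<close> by simp
    qed
    then show ?thesis using p by blast
  qed
  then obtain p i where p: "prime p" "i < s" "p dvd x + 2 * i" "r + d < p" by blast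
  define l where "l = n - s + i"
  have l: "x + 2 * i = 2 * l + 1 + 2 * d" by (simp add: x_def l_def)
  have "l < n" using p s by (simp add: l_def)
  have "p \<le> 2 * l + 1 + 2 * d" using p(3) unfolding l by (intro dvd_imp_le) auto
  also have "\<dots> \<le> 2 * n + d" using \<open>l < n\<close> d by simp
  finally have "p \<le> 2 * n + d" .
  moreover have "2 * n \<le> 2 * l + r + 1" using s by (simp add: l_def)
  ultimately show ?thesis using p l \<open>l < n\<close> by (intro exI[of _ p] exI[of _ l]) auto
qed

section \<open>Irreducibility of the digit sum over Z\<close>

lemma const_poly_dvd_smult_iff:
  assumes p: "prime (p :: int)" and A: "\<not> p dvd content A" and V: "V \<noteq> 0"
  shows "[:p:] ^ k dvd smult V A \<longleftrightarrow> p ^ k dvd V"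
proof
  assume "p ^ k dvd V"
  then obtain W where W: "V = p ^ k * W" by (elim dvdE)
  have "smult V A = [:p:] ^ k * smult W A" unfolding W poly_const_pow by (simp add: mult.commute)
  then show "[:p:] ^ k dvd smult V A" by (rule dvdI)
next
  assume a: "[:p:] ^ k dvd smult V A"
  have "p ^ k dvd content (smult V A)"
    using a unfolding poly_const_pow const_poly_dvd_iff_dvd_content .
  then have "p ^ k dvd sgn V * (\<bar>V\<bar> * content A)" by (simp add: content_smult dvd_mult)
  then have "p ^ k dvd V * content A" by (simp only: mult.assoc[symmetric] sgn_mult_abs)
  moreover have "algebraic_semidom_class.coprime (p ^ k) (content A)"
    using prime_imp_coprime[OF p A] by simp
  ultimately show "p ^ k dvd V" by (simp add: coprime_dvd_mult_left_iff)
qed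

lemma degree_smult_power_sum:
  fixes \<phi> :: "int poly"
  assumes m: "monic \<phi>" and dg: "degree \<phi> > 0" and b: "b n = 1" "A n = [:c:]" and c: "c \<noteq> 0"
    and A: "\<And>i. i < n \<Longrightarrow> degree (A i) < degree \<phi>"
  defines "E \<equiv> \<Sum>i\<le>n. monom (smult (b i) (A i)) (2 * i)"
  shows "poly E \<phi> = (\<Sum>i\<le>n. smult (b i) (A i) * \<phi> ^ (2 * i))"
    and "coeff E j = (if even j \<and> j div 2 \<le> n then smult (b (j div 2)) (A (j div 2)) else 0)"
    and "reduced_digits \<phi> E"
    and "degree (poly E \<phi>) = (2 * n) * degree \<phi>" and "lead_coeff (poly E \<phi>) = c"
proof -
  show "poly E \<phi> = (\<Sum>i\<le>n. smult (b i) (A i) * \<phi> ^ (2 * i))"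
    unfolding E_def by (simp add: poly_sum poly_monom)
  have cE: "coeff E j = (if even j \<and> j div 2 \<le> n then smult (b (j div 2)) (A (j div 2)) else 0)" for j
  proof -
    have "coeff E j = (\<Sum>i\<le>n. if 2 * i = j then smult (b i) (A i) else 0)"
      unfolding E_def by (simp add: coeff_sum)
    also have "\<dots> = (\<Sum>i\<le>n. if i = j div 2 then (if even j then smult (b i) (A i) else 0) else 0)"
      by (intro sum.cong refl) auto
    also have "\<dots> = (if even j \<and> j div 2 \<le> n then smult (b (j div 2)) (A (j div 2)) else 0)"
      by (simp add: sum.delta)
    finally show ?thesis .
  qed
  then show "coeff E j = (if even j \<and> j div 2 \<le> n then smult (b (j div 2)) (A (j div 2)) else 0)" .
  have An: "degree (A i) < degree \<phi>" if "i \<le> n" for i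
    using A[of i] that b dg by (cases "i = n") auto
  have sm: "degree (smult x B) < degree \<phi>" if "degree B < degree \<phi>" for x B
    using that by (rule le_less_trans[OF degree_smult_le])
  show r: "reduced_digits \<phi> E" unfolding reduced_digits_def cE
    using An sm dg by auto
  have cn: "coeff E (2 * n) = [:c:]" unfolding cE using b by simp
  have dE: "degree E = 2 * n"
  proof (rule antisym)
    show "degree E \<le> 2 * n" by (rule degree_le) (auto simp: cE)
    show "2 * n \<le> degree E" by (rule le_degree) (use cn c in simp)
  qed
  have "E \<noteq> 0" using cn c by auto
  note R = reduced_digits_degree[OF m r this]
  show "degree (poly E \<phi>) = (2 * n) * degree \<phi>" using R unfolding dE cn by simp
  have "lead_coeff (lead_coeff E) = c" by (simp add: dE cn)
  then show "lead_coeff (poly E \<phi>) = c" by (rule trans[OF conjunct2[OF conjunct2[OF R]]])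
qed

text \<open>\<open>irreducible\<^sub>d\<close> only forbids factors of positive degree: the content
  of the sum may contain primes above m, so irreducibility in the ring Z[x] can fail.\<close>

lemma irreducible_digit_sum:
  fixes \<phi> :: "int poly" and A :: "nat \<Rightarrow> int poly"
  assumes d: "d \<le> 1" and m3: "2 * n + d \<ge> 3" and m: "monic \<phi>"
    and irr: "\<And>p::nat. prime p \<Longrightarrow> p \<le> 2 * n + d \<Longrightarrow> poly_mod.irreducible_m (int p) \<phi>"
    and An: "A n = [:c:]" and A: "\<And>i. i < n \<Longrightarrow> degree (A i) < degree \<phi>"
    and ct: "\<And>p::nat. prime p \<Longrightarrow> p \<le> 2 * n + d \<Longrightarrow> \<not> int p dvd c \<and> \<not> int p dvd content (A 0)"
    and ex: "d = 1 \<Longrightarrow> \<forall>k\<ge>2. 2 * n + d \<noteq> 3 ^ k"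
  shows "irreducible\<^sub>d (\<Sum>i\<le>n. smult (int (digit_weight d n i)) (A i) * \<phi> ^ (2 * i))"
proof -
  have p2: "prime (2 :: nat)" "2 \<le> 2 * n + d" using m3 by simp_all
  have dg: "degree \<phi> > 0" using not_unit_irreducible_m[OF irr[OF p2] m] .
  have c0: "c \<noteq> 0" using ct[OF p2] by auto
  have n1: "n \<ge> 1" using m3 d by simp
  define b where "b i = int (digit_weight d n i)" for i
  define E where "E = (\<Sum>i\<le>n. monom (smult (b i) (A i)) (2 * i))"
  have bn: "b n = 1" by (simp add: b_def digit_weight_def)
  note E = degree_smult_power_sum[where b = b and n = n and A = A, OF m dg bn An c0 A, folded E_def]
  have E1: "poly E \<phi> = (\<Sum>i\<le>n. smult (int (digit_weight d n i)) (A i) * \<phi> ^ (2 * i))"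
    using E(1) by (simp only: b_def)
  have E2: "coeff E j = (if even j \<and> j div 2 \<le> n then smult (b (j div 2)) (A (j div 2)) else 0)" for j
    using E(2)[of j] by (simp only:)
  have cE: "coeff E (2 * i) = smult (int (digit_weight d n i)) (A i)" if "i \<le> n" for i
    using that unfolding E2 by (simp add: b_def)
  have cE0: "coeff E j = 0 \<or> (\<exists>i. j = 2 * i \<and> i \<le> n)" for j
    unfolding E2 by (cases "even j \<and> j div 2 \<le> n") (auto elim!: evenE)
  have wdvd: "p dvd digit_weight d n i" if "p dvd 2 * l + 1 + 2 * d" "i \<le> l" "l < n" for p l i
    unfolding digit_weight_def using that by (intro dvd_mult dvd_prodI[THEN dvd_trans[rotated]]) auto
  have step: False if GK: "poly E \<phi> = G * K" and dG0: "degree G > 0" and dGK: "degree G \<le> degree K" for G K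
  proof -
    have nz: "G \<noteq> 0" "K \<noteq> 0" using GK E(5) c0 by auto
    then have deg: "degree G + degree K = 2 * n * degree \<phi>" using E(4) GK by (simp add: degree_mult_eq)
    have "2 * (n - 1) + 1 + 2 * d \<noteq> 1" using m3 n1 d by arith
    then obtain q where q: "prime q" "q dvd 2 * (n - 1) + 1 + 2 * d" using prime_factor_nat by blast
    have qm: "q \<le> 2 * n + d"
    proof -
      have "q \<le> 2 * (n - 1) + 1 + 2 * d" using q(2) by (intro dvd_imp_le) auto
      then show ?thesis using n1 d by simp
    qed
    have "\<exists>Z. smult (int (digit_weight d n i)) (A i) * \<phi> ^ (2 * i) = [:int q:] * Z" if "i < n" for i
    proof -
      have "q dvd digit_weight d n i" using wdvd[OF q(2)] that n1 by simp
      then obtain y where "digit_weight d n i = q * y" by (elim dvdE)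
      then have "smult (int (digit_weight d n i)) (A i) * \<phi> ^ (2 * i) = [:int q:] * (smult (int y) (A i) * \<phi> ^ (2 * i))"
        by (simp add: mult.commute)
      then show ?thesis by blast
    qed
    then obtain Z where Z: "\<And>i. i < n \<Longrightarrow> smult (int (digit_weight d n i)) (A i) * \<phi> ^ (2 * i) = [:int q:] * Z i"
      by metis
    have "G * K = (\<Sum>i\<le>n. smult (int (digit_weight d n i)) (A i) * \<phi> ^ (2 * i))" using GK E1 by simp
    also have "{..n} = insert n {..<n}" by auto
    also have "(\<Sum>i\<in>insert n {..<n}. smult (int (digit_weight d n i)) (A i) * \<phi> ^ (2 * i))
       = [:c:] * \<phi> ^ (2 * n) + (\<Sum>i<n. [:int q:] * Z i)"
      using bn An Z by (simp add: b_def)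
    also have "(\<Sum>i<n. [:int q:] * Z i) = [:int q:] * (\<Sum>i<n. Z i)" by (rule sum_distrib_left[symmetric])
    finally have F: "G * K = [:c:] * \<phi> ^ (2 * n) + [:int q:] * (\<Sum>i<n. Z i)" .
    have pq: "prime (int q)" using q by simp
    have "\<not> int q dvd c" using ct[OF q(1) qm] by blast
    then have "degree \<phi> dvd degree G" using E(4,5) GK
      by (intro factor_degree_dvd[OF pq m irr[OF q(1) qm] F]) auto
    then obtain r where r: "degree G = r * degree \<phi>" by (metis dvdE mult.commute)
    have r1: "1 \<le> r" using dG0 r by (cases r) auto
    have "2 * (r * degree \<phi>) \<le> 2 * (n * degree \<phi>)"
      using dGK deg unfolding r mult.assoc by linarith
    then have "r * degree \<phi> \<le> n * degree \<phi>" by simp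
    then have rn: "r \<le> n" using dg by simp
    obtain p l where p: "prime p" "r + 1 + d \<le> p" "p \<le> 2 * n + d" and l: "l < n" "2 * n \<le> 2 * l + r + 1"
      "p dvd 2 * l + 1 + 2 * d"
      using exists_suitable_prime[OF d m3 r1 rn ex] by blast
    have pp: "prime (int p)" using p by simp
    have cp: "\<not> int p dvd c" "\<not> int p dvd content (A 0)" using ct[OF p(1,3)] by blast+
    then have A0: "A 0 \<noteq> 0" by auto
    define w where "w = odd_product d n"
    have w0: "w > 0" by (simp add: w_def)
    have F0: "coeff E 0 = smult (int w) (A 0)"
    proof -
      have "digit_weight d n 0 = w" by (simp add: digit_weight_def w_def odd_product_def lessThan_atLeast0)
      then show ?thesis using cE[of 0] by simp
    qed
    have F00: "coeff E 0 \<noteq> 0" unfolding F0 using w0 A0 by simp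
    have vF0: "multiplicity [:int p:] (coeff E 0) = multiplicity p w"
    proof (rule multiplicity_eqI)
      show "[:int p:] ^ multiplicity p w dvd coeff E 0"
        unfolding F0 using w0 const_poly_dvd_smult_iff[OF pp cp(2), of "int w"]
        by (simp add: multiplicity_dvd flip: of_nat_power)
      have "\<not> p ^ Suc (multiplicity p w) dvd w"
      proof
        assume "p ^ Suc (multiplicity p w) dvd w"
        then have "Suc (multiplicity p w) \<le> multiplicity p w" using p w0 by (intro multiplicity_geI) auto
        then show False by simp
      qed
      then show "\<not> [:int p:] ^ Suc (multiplicity p w) dvd coeff E 0"
        unfolding F0 using w0 const_poly_dvd_smult_iff[OF pp cp(2), of "int w" "Suc (multiplicity p w)"]
        by (simp del: power_Suc flip: of_nat_power)
    qed
    have min: "r * multiplicity [:int p:] (coeff E 0) < r * multiplicity [:int p:] (coeff E j) + j"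
      if j: "j > 0" "coeff E j \<noteq> 0" for j
    proof -
      obtain i where i: "j = 2 * i" "i \<le> n" using cE0 j by blast
      then have i1: "i \<ge> 1" using j by simp
      define w' where "w' = digit_weight d n i"
      have b0: "w' \<noteq> 0" using j(2) cE[OF i(2)] i(1) by (auto simp: w'_def)
      \<comment> \<open>Hence passing from digit 0 to digit 2i loses at most the valuation of
        \<open>odd_product d i\<close>, which r times stays below the gain 2i in the index.\<close>
      have "w dvd w' * odd_product d i"
        unfolding w'_def digit_weight_times_odd_product[OF i(2)] w_def by simp
      then have "multiplicity p w \<le> multiplicity p (w' * odd_product d i)"
        using b0 odd_product_pos[of d i] by (intro dvd_imp_multiplicity_le) auto
      also have "\<dots> = multiplicity p w' + multiplicity p (odd_product d i)"
        using p b0 odd_product_pos[of d i] by (intro prime_elem_multiplicity_mult_distrib) auto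
      finally have "r * multiplicity p w \<le> r * multiplicity p w' + r * multiplicity p (odd_product d i)"
        by (metis add_mult_distrib2 mult_le_mono2)
      moreover have "r * multiplicity p (odd_product d i) < 2 * i"
        by (rule multiplicity_odd_product[OF p(1,2) d i1])
      moreover have "multiplicity p w' \<le> multiplicity [:int p:] (coeff E j)"
      proof -
        define v where "v = multiplicity p w'"
        have "p ^ v dvd w'" unfolding v_def by (rule multiplicity_dvd)
        then obtain y where y: "w' = p ^ v * y" by (elim dvdE)
        have "coeff E j = smult (int w') (A i)" unfolding i(1) cE[OF i(2)] w'_def ..
        also have "int w' = int p ^ v * int y" unfolding y by simp
        also have "smult (int p ^ v * int y) (A i) = [:int p:] ^ v * smult (int y) (A i)"
          unfolding poly_const_pow by (simp add: mult.commute)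
        finally have "[:int p:] ^ v dvd coeff E j" by (rule dvdI)
        then have "[:int p:] ^ multiplicity p w' dvd coeff E j" unfolding v_def .
        then show ?thesis using prime_const_power_dvd_iff[OF pp j(2)] by blast
      qed
      then have "r * multiplicity p w' \<le> r * multiplicity [:int p:] (coeff E j)" by (rule mult_le_mono2)
      ultimately show ?thesis unfolding vF0 i(1) by linarith
    qed
    have low: "[:int p:] dvd coeff E j" if "j + r \<le> 2 * n" for j
    proof (cases "coeff E j = 0")
      case False
      then obtain i where i: "j = 2 * i" "i \<le> n" using cE0 by blast
      \<comment> \<open>2i + r \<le> 2n \<le> 2l + r + 1 gives 2i \<le> 2l + 1, and parity absorbs
        the 1.\<close>
      have "i \<le> l" using that l(2) i(1) by linarith
      then have "p dvd digit_weight d n i" using wdvd[OF l(3)] l(1) by blast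
      then have "int p dvd int (digit_weight d n i)" by simp
      then show ?thesis unfolding i(1) cE[OF i(2)] by (auto simp: const_poly_dvd_iff)
    qed auto
    have "\<not> int p dvd lead_coeff (poly E \<phi>)" using cp(1) E(5) by simp
    then show False
      using no_factor_of_degree[OF pp m irr[OF p(1,3)] _ _ E(3) GK E(4) _ r F00 min low] r1 rn by auto
  qed
  have "irreducible\<^sub>d (poly E \<phi>)"
  proof (rule irreducible\<^sub>dI)
    show "degree (poly E \<phi>) > 0" using E(4) dg n1 by simp
  next
    fix G K assume G: "degree G < degree (poly E \<phi>)" and K: "degree K < degree (poly E \<phi>)"
      and d1: "degree G > 0" "degree K > 0" and e: "poly E \<phi> = G * K"
    show False using step[OF e] step[of K G] e d1 by (cases "degree G \<le> degree K") (auto simp: mult.commute)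
  qed
  then show ?thesis by (simp only: E1)
qed

section \<open>From factors over Q to factors over Z\<close>

lemma clear_denominators:
  "\<exists>x G. x \<noteq> 0 \<and> smult (rat_of_int x) g = map_poly rat_of_int G"
proof (induction g)
  case 0
  show ?case by (intro exI[of _ 1] exI[of _ 0]) simp
next
  case (pCons q g)
  then obtain x G where x: "x \<noteq> 0" "smult (rat_of_int x) g = map_poly rat_of_int G" by blast
  obtain k d where q: "q = rat_of_int k / rat_of_int d" "d > 0"
    by (cases q) (auto simp: Fract_of_int_quotient)
  have "smult (rat_of_int (x * d)) (pCons q g) = pCons (rat_of_int (x * k)) (smult (rat_of_int d) (smult (rat_of_int x) g))"
    using q by (simp add: mult.commute)
  also have "\<dots> = map_poly rat_of_int (pCons (x * k) (smult d G))"
    unfolding x(2) by (intro poly_eqI) (simp add: coeff_map_poly coeff_pCons split: nat.splits)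
  finally show ?case using x(1) q(2) by (intro exI[of _ "x * d"] exI[of _ "pCons (x * k) (smult d G)"]) simp
qed

text \<open>Gauss's lemma: clearing denominators gives x y F = G K, and since contents multiply, F
  is the product of the two primitive parts up to sign and its own content.\<close>

lemma factor_over_rat:
  assumes F: "map_poly rat_of_int F = g * h" and nz: "F \<noteq> 0"
  shows "\<exists>G K. F = G * K \<and> degree G = degree g \<and> degree K = degree h"
proof -
  obtain x G where x: "x \<noteq> 0" "smult (rat_of_int x) g = map_poly rat_of_int G" using clear_denominators by blast
  obtain y K where y: "y \<noteq> 0" "smult (rat_of_int y) h = map_poly rat_of_int K" using clear_denominators by blast
  have "map_poly rat_of_int (smult (x * y) F) = smult (rat_of_int (x * y)) (map_poly rat_of_int F)"
    by (intro poly_eqI) (simp add: coeff_map_poly)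
  also have "\<dots> = smult (rat_of_int x) g * smult (rat_of_int y) h"
    unfolding F by (simp add: mult_ac)
  also have "\<dots> = map_poly rat_of_int (G * K)" unfolding x y by (simp add: of_int_poly_hom.hom_mult)
  finally have GK: "smult (x * y) F = G * K" by simp
  have dG: "degree G = degree g"
    using arg_cong[OF x(2), of degree] x(1) by simp
  have dK: "degree K = degree h"
    using arg_cong[OF y(2), of degree] y(1) by simp
  define D where "D = content F"
  have "normalize D = D" unfolding D_def by (rule normalize_content)
  then have "D \<ge> 0" by simp
  moreover have "D \<noteq> 0" using nz by (simp add: D_def)
  ultimately have D: "D > 0" by simp
  have "content (smult (x * y) F) = content G * content K" unfolding GK by (rule content_mult)
  then have c: "content G * content K = \<bar>x * y\<bar> * D" by (simp add: content_smult D_def)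
  have gen: "smult a A * smult b B = smult (a * b) (A * B)" for a b :: int and A B
    by (simp add: mult.commute)
  have "smult (x * y) F = smult (content G) (primitive_part G) * smult (content K) (primitive_part K)"
    unfolding GK by simp
  also have "\<dots> = smult (content G * content K) (primitive_part G * primitive_part K)" by (rule gen)
  also note c
  also have "\<bar>x * y\<bar> = x * y * sgn (x * y)" by (rule abs_sgn)
  finally have "smult (x * y) F = smult (x * y) (smult (sgn (x * y) * D) (primitive_part G * primitive_part K))"
    by (simp add: mult.assoc)
  then have "F = smult (sgn (x * y) * D) (primitive_part G * primitive_part K)"
    using x(1) y(1) by (metis mult_eq_0_iff smult_cancel)
  then have "F = primitive_part G * smult (sgn (x * y) * D) (primitive_part K)" by simp
  moreover have "sgn (x * y) * D \<noteq> 0" using x(1) y(1) D by (simp add: sgn_if)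
  ultimately show ?thesis using dG dK
    by (intro exI[of _ "primitive_part G"] exI[of _ "smult (sgn (x * y) * D) (primitive_part K)"]) simp
qed

lemma irreducible_over_rat:
  assumes "irreducible\<^sub>d F"
  shows "irreducible (map_poly rat_of_int F)"
proof -
  have d: "degree F > 0" and no: "\<And>G K. degree G < degree F \<Longrightarrow> degree K < degree F \<Longrightarrow> F \<noteq> G * K"
    using assms unfolding irreducible\<^sub>d_def by auto
  have "irreducible\<^sub>d (map_poly rat_of_int F)"
  proof (rule irreducible\<^sub>dI)
    fix g h assume gh: "map_poly rat_of_int F = g * h"
      and dg: "degree g < degree (map_poly rat_of_int F)" "degree h < degree (map_poly rat_of_int F)"
    have "F \<noteq> 0" using d by auto
    from factor_over_rat[OF gh this] obtain G K where "F = G * K" "degree G = degree g" "degree K = degree h" by blast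
    then show False using no[of G K] dg by simp
  qed (use d in simp)
  then show ?thesis by simp
qed

lemma H_phi_eq:
  assumes m: "m = 2 * n + d" "d \<le> 1"
  shows "H_phi m \<phi> c a =
    \<phi> ^ d * (\<Sum>i\<le>n. smult (int (digit_weight d n i)) (if i = n then [:c:] else a i) * \<phi> ^ (2 * i))"
proof -
  have n: "m div 2 = n" using m by simp
  have "(\<Sum>j=1..n. smult (int (m choose (2*j)) * u (2*j)) (a (n - j) * \<phi> ^ (m - 2*j)))
     = (\<Sum>i<n. smult (int (m choose (2*(n - i))) * u (2*(n - i))) (a i * \<phi> ^ (2 * i + d)))"
  proof (rule sum.reindex_bij_witness[of _ "\<lambda>i. n - i" "\<lambda>j. n - j"])
    fix j assume j: "j \<in> {1..n}"
    then have "j \<le> n" by simp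
    then have "m - 2 * j = 2 * (n - j) + d" unfolding m(1) by arith
    then show "smult (int (m choose (2*(n - (n - j)))) * u (2*(n - (n - j)))) (a (n - j) * \<phi> ^ (2 * (n - j) + d))
      = smult (int (m choose (2*j)) * u (2*j)) (a (n - j) * \<phi> ^ (m - 2*j))" using j by simp
  qed auto
  also have "\<dots> = (\<Sum>i<n. \<phi> ^ d * (smult (int (digit_weight d n i)) (if i = n then [:c:] else a i) * \<phi> ^ (2 * i)))"
  proof (rule sum.cong[OF refl])
    fix i assume "i \<in> {..<n}"
    then show "smult (int (m choose (2*(n - i))) * u (2*(n - i))) (a i * \<phi> ^ (2 * i + d))
      = \<phi> ^ d * (smult (int (digit_weight d n i)) (if i = n then [:c:] else a i) * \<phi> ^ (2 * i))"
      unfolding m(1) using binomial_times_u[OF m(2), of i n] by (simp add: power_add mult_ac)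
  qed
  also have "\<dots> = \<phi> ^ d * (\<Sum>i<n. smult (int (digit_weight d n i)) (if i = n then [:c:] else a i) * \<phi> ^ (2 * i))"
    by (rule sum_distrib_left[symmetric])
  finally have s: "(\<Sum>j=1..n. smult (int (m choose (2*j)) * u (2*j)) (a (n - j) * \<phi> ^ (m - 2*j)))
     = \<phi> ^ d * (\<Sum>i<n. smult (int (digit_weight d n i)) (if i = n then [:c:] else a i) * \<phi> ^ (2 * i))" .
  have "smult c (\<phi> ^ m) = \<phi> ^ d * (smult (int (digit_weight d n n)) [:c:] * \<phi> ^ (2 * n))"
    unfolding m(1) by (simp add: digit_weight_def power_add mult_ac)
  moreover have "{..n} = insert n {..<n}" by auto
  ultimately show ?thesis unfolding H_phi_def n s by (simp add: algebra_simps)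
qed

theorem theorem1p5:
  fixes m :: nat and \<phi> :: "int poly" and c :: int and a :: "nat \<Rightarrow> int poly"
  assumes "m \<ge> 3"
    and "monic \<phi>"
    and "\<forall>p::nat. prime p \<and> p \<le> m \<longrightarrow> poly_mod.irreducible_m (int p) \<phi>"
    and "\<forall>i < m div 2. degree (a i) < degree \<phi>"
    and "\<forall>p::nat. prime p \<and> p \<le> m \<longrightarrow> \<not> int p dvd content (smult c (a 0))"
  shows "(even m \<longrightarrow> irreducible (map_poly rat_of_int (H_phi m \<phi> c a)))
       \<and> (odd m \<and> (\<forall>k::nat. k \<ge> 2 \<longrightarrow> m \<noteq> 3 ^ k) \<longrightarrow>
           (\<exists>g :: rat poly. map_poly rat_of_int (H_phi m \<phi> c a) = map_poly rat_of_int \<phi> * g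
                \<and> irreducible g))"
proof -
  define n where "n = m div 2"
  define A where "A i = (if i = n then [:c:] else a i)" for i
  define F where "F d = (\<Sum>i\<le>n. smult (int (digit_weight d n i)) (A i) * \<phi> ^ (2 * i))" for d
  have n1: "n \<ge> 1" using assms(1) by (simp add: n_def)
  have ct: "\<not> int p dvd c \<and> \<not> int p dvd content (A 0)" if "prime p" "p \<le> m" for p :: nat
  proof -
    have "\<not> int p dvd content (smult c (a 0))" using assms(5) that by blast
    then have "\<not> int p dvd \<bar>c\<bar> * content (a 0)" by (simp add: content_smult)
    \<comment> \<open>As n \<ge> 1, \<open>A 0\<close> is \<open>a 0\<close> and not the constant at
      index n.\<close>
    then show ?thesis using n1 by (auto simp: A_def)
  qed
  have irr: "irreducible (map_poly rat_of_int (F d))"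
    if d: "m = 2 * n + d" "d \<le> 1" and ex: "d = 1 \<Longrightarrow> \<forall>k\<ge>2. m \<noteq> 3 ^ k" for d
  proof -
    have "irreducible\<^sub>d (F d)" unfolding F_def
      using assms ct ex d(1) by (intro irreducible_digit_sum[OF d(2)]) (auto simp: A_def n_def[symmetric])
    then show ?thesis by (rule irreducible_over_rat)
  qed
  show ?thesis
  proof (intro conjI impI)
    assume "even m"
    then have d: "m = 2 * n + 0" by (simp add: n_def)
    have "H_phi m \<phi> c a = F 0" using H_phi_eq[OF d] by (simp add: F_def A_def)
    then show "irreducible (map_poly rat_of_int (H_phi m \<phi> c a))" using irr[OF d] by simp
  next
    assume o: "odd m \<and> (\<forall>k::nat. k \<ge> 2 \<longrightarrow> m \<noteq> 3 ^ k)"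
    then have d: "m = 2 * n + 1" by (simp add: n_def)
    have "H_phi m \<phi> c a = \<phi> * F 1" using H_phi_eq[OF d] by (simp add: F_def A_def)
    then have "map_poly rat_of_int (H_phi m \<phi> c a) = map_poly rat_of_int \<phi> * map_poly rat_of_int (F 1)"
      by (simp add: of_int_poly_hom.hom_mult)
    moreover have "irreducible (map_poly rat_of_int (F 1))" using o by (intro irr[OF d]) auto
    ultimately show "\<exists>g. map_poly rat_of_int (H_phi m \<phi> c a) = map_poly rat_of_int \<phi> * g \<and> irreducible g"
      by blast
  qed
qed

end
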